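(* In the following $N$ ranges over even positive integers and $h=\sqrt2\,N^{-1/2}$. (i) There exist constants $C$ and $N_0$ such that for all $N\ge N_0$ and all $g\in\Sigma^5(\mathbb{R})$, $$\|\pi_h(Hg)-H_h(\pi_hg)\|_{\ell^2(h\mathbb{Z})}\le C h^2\|g\|_{\Sigma^5(\mathbb{R})}.$$ (ii) For all $\delta\in(0,1)$ and $\sigma\ge0$ there exist constants $C$ and $N_0$ such that for all $N\ge N_0$, $$\left\|\langle a\rangle^{\sigma}\left(\rho_h(a)-\tfrac{1}{\sqrt\pi}e^{-a^2}\right)\right\|_{\ell^2(h\mathbb{Z})}\le C h^{2-\delta},$$ and, for every integer $n$ with $0\le n\le\frac13\delta|\log h|$, $$\left\|\langle a\rangle^{\sigma}\left(\varphi_{n,h}-\pi_h\psi_n\right)\right\|_{\ell^2(h\mathbb{Z})}\le C h^{2-\delta}.$$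
   Context: $H=-\partial_x^2+x^2$ on $\mathbb{R}$. $\langle x\rangle=(1+x^2)^{1/2}$. For $n\ge0$, $\Sigma^n(\mathbb{R})=\{\psi\in L^2(\mathbb{R}):\|\psi\|_{\Sigma^n(\mathbb{R})}:=\|\psi\|_{H^n(\mathbb{R})}+\|\langle x\rangle^n\psi\|_{L^2(\mathbb{R})}<\infty\}$. For $f\in H^1(\mathbb{R})$ (continuous representative), $\pi_hf:h\mathbb{Z}\to\mathbb{C}$ is $(\pi_hf)(a)=f(a)$. The norm is $\|u\|_{\ell^2(h\mathbb{Z})}^2=h\sum_{a\in h\mathbb{Z}}|u(a)|^2$; $a$ denotes the variable in $h\mathbb{Z}$. Hermite functions: $\psi_n(x)=\frac{1}{\pi^{1/4}2^{n/2}\sqrt{n!}}e^{-x^2/2}H_n(x)$, with $H_0=1$, $H_{-1}=0$, $H_{n+1}(x)=2xH_n(x)-2nH_{n-1}(x)$. Set $A_h=h\mathbb{Z}\cap[-1/h,1/h]$. Scaled Kravchuk polynomials: $k_{0,h}=1$, $k_{n,h}=0$ for $n<0$, $k_{n+1,h}(x)=2x\,k_{n,h}(x)-2n\left(1-h^2\frac{n-1}{2}\right)k_{n-1,h}(x)$. Kravchuk functions: for $0\le n\le N$, $a\in h\mathbb{Z}$, $\varphi_{n,h}(a)=\alpha_{n,h}k_{n,h}(a)\sqrt{\rho_h(a)}$, where $\alpha_{n,h}=\frac1{h^n}\sqrt{\frac{(N-n)!}{N!\,n!}}$, $\rho_h(a)=\frac1{h2^N}\binom Nk$ with $k=\frac1{h^2}+\frac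 ah$ for $a\in A_h$, and $\rho_h(a)=0$ for $a\notin A_h$. Discrete operator: for $a\in A_h$, $$H_hu(a)=-\tfrac1{h^2}\sqrt{(1+ah+h^2)(1-ah)}\,u(a+h)-\tfrac1{h^2}\sqrt{(1-ah+h^2)(1+ah)}\,u(a-h)+\left(1+\tfrac2{h^2}\right)u(a),$$ and $H_hu(a)=0$ for $a\in h\mathbb{Z}\setminus A_h$. *)

theory Defs
  imports "HOL-Analysis.Analysis"
begin

definition jap :: "real \<Rightarrow> real" where
  "jap x = sqrt (1 + x\<^sup>2)"

text \<open>
  Elements of the function spaces on the real line are represented by arbitrary
  Lebesgue measurable representatives. Every notion below that takes such a function
  as an argument depends only on its class modulo null sets.
\<close>

definition L2 :: "(real \<Rightarrow> complex) set" where
  "L2 = {f. f \<in> borel_measurable lebesgue \<and> integrable lebesgue (\<lambda>x. (cmod (f x))\<^sup>2)}"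

definition L2_norm :: "(real \<Rightarrow> complex) \<Rightarrow> real" where
  "L2_norm f = sqrt (LINT x|lebesgue. (cmod (f x))\<^sup>2)"

definition test_function :: "(real \<Rightarrow> real) \<Rightarrow> bool" where
  "test_function p \<longleftrightarrow>
     (\<forall>k x. ((deriv ^^ k) p) field_differentiable (at x)) \<and> compact (closure {x. p x \<noteq> 0})"

text \<open>Real-valued test functions suffice, by linearity.\<close>

definition has_weak_deriv :: "nat \<Rightarrow> (real \<Rightarrow> complex) \<Rightarrow> (real \<Rightarrow> complex) \<Rightarrow> bool" where
  "has_weak_deriv k f g \<longleftrightarrow>
     (\<forall>p. test_function p \<longrightarrow>
        (LINT x|lebesgue. (deriv ^^ k) p x *\<^sub>R f x) =
        (- 1) ^ k * (LINT x|lebesgue. p x *\<^sub>R g x))"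

definition weak_deriv :: "nat \<Rightarrow> (real \<Rightarrow> complex) \<Rightarrow> real \<Rightarrow> complex" where
  "weak_deriv k f = (SOME g. g \<in> L2 \<and> has_weak_deriv k f g)"

definition Sobolev :: "nat \<Rightarrow> (real \<Rightarrow> complex) set" where
  "Sobolev n = {f \<in> L2. \<forall>k\<le>n. \<exists>g\<in>L2. has_weak_deriv k f g}"

definition Sobolev_norm :: "nat \<Rightarrow> (real \<Rightarrow> complex) \<Rightarrow> real" where
  "Sobolev_norm n f = sqrt (\<Sum>k\<le>n. (L2_norm (weak_deriv k f))\<^sup>2)"

definition Sigma_space :: "nat \<Rightarrow> (real \<Rightarrow> complex) set" where
  "Sigma_space n = {f \<in> Sobolev n. (\<lambda>x. jap x ^ n *\<^sub>R f x) \<in> L2}"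

definition Sigma_norm :: "nat \<Rightarrow> (real \<Rightarrow> complex) \<Rightarrow> real" where
  "Sigma_norm n f = Sobolev_norm n f + L2_norm (\<lambda>x. jap x ^ n *\<^sub>R f x)"

text \<open>The harmonic oscillator, with the second derivative taken in the weak sense.\<close>

definition harm_osc :: "(real \<Rightarrow> complex) \<Rightarrow> real \<Rightarrow> complex" where
  "harm_osc f x = - weak_deriv 2 f x + x\<^sup>2 *\<^sub>R f x"

definition grid :: "real \<Rightarrow> real set" where
  "grid h = range (\<lambda>j::int. h * of_int j)"

definition ell2 :: "real \<Rightarrow> (real \<Rightarrow> complex) set" where
  "ell2 h = {u. (\<lambda>a. (cmod (u a))\<^sup>2) summable_on grid h}"

definition ell2_norm :: "real \<Rightarrow> (real \<Rightarrow> complex) \<Rightarrow> real" where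
  "ell2_norm h u = sqrt (h * (\<Sum>\<^sub>\<infinity>a\<in>grid h. (cmod (u a))\<^sup>2))"

text \<open>Two continuous functions that agree almost everywhere are equal, so the
  continuous representative is unique whenever it exists.\<close>

definition cont_rep :: "(real \<Rightarrow> complex) \<Rightarrow> real \<Rightarrow> complex" where
  "cont_rep f = (THE g. continuous_on UNIV g \<and> (AE x in lebesgue. f x = g x))"

definition grid_proj :: "real \<Rightarrow> (real \<Rightarrow> complex) \<Rightarrow> real \<Rightarrow> complex" where
  "grid_proj h f = restrict (cont_rep f) (grid h)"

text \<open>The recurrences are started at \<open>n = 0\<close> and \<open>n = 1\<close>: at \<open>n = 0\<close> the
  coefficient \<open>2 n\<close> of the term with index \<open>n - 1 = -1\<close> vanishes.\<close>

fun hermite :: "nat \<Rightarrow> real \<Rightarrow> real" where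
  "hermite 0 x = 1"
| "hermite (Suc 0) x = 2 * x"
| "hermite (Suc (Suc n)) x = 2 * x * hermite (Suc n) x - 2 * real (Suc n) * hermite n x"

definition hermite_fun :: "nat \<Rightarrow> real \<Rightarrow> real" where
  "hermite_fun n x =
     1 / (pi powr (1/4) * 2 powr (real n / 2) * sqrt (fact n)) * exp (- x\<^sup>2 / 2) * hermite n x"

fun kravchuk :: "real \<Rightarrow> nat \<Rightarrow> real \<Rightarrow> real" where
  "kravchuk h 0 x = 1"
| "kravchuk h (Suc 0) x = 2 * x"
| "kravchuk h (Suc (Suc n)) x =
     2 * x * kravchuk h (Suc n) x
     - 2 * real (Suc n) * (1 - h\<^sup>2 * ((real (Suc n) - 1) / 2)) * kravchuk h n x"

definition step :: "nat \<Rightarrow> real" where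
  "step N = sqrt 2 * real N powr (- 1/2)"

definition grid_support :: "real \<Rightarrow> real set" where
  "grid_support h = grid h \<inter> {- 1/h .. 1/h}"

text \<open>For even \<open>N > 0\<close>, \<open>h = step N\<close> and \<open>a \<in> grid_support h\<close>, the real number
  \<open>1/h\<^sup>2 + a/h = N/2 + a/h\<close> is an integer between \<open>0\<close> and \<open>N\<close>; the floor only
  converts its type.\<close>

definition rho :: "nat \<Rightarrow> real \<Rightarrow> real" where
  "rho N a = (let h = step N in
     if a \<in> grid_support h
     then 1 / (h * 2 ^ N) * real (N choose (nat \<lfloor>1 / h\<^sup>2 + a / h\<rfloor>))
     else 0)"

text \<open>Meaningful only for \<open>n \<le> N\<close>.\<close>

definition kravchuk_fun :: "nat \<Rightarrow> nat \<Rightarrow> real \<Rightarrow> real" where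
  "kravchuk_fun N n a =
     1 / step N ^ n * sqrt (fact (N - n) / (fact N * fact n))
       * kravchuk (step N) n a * sqrt (rho N a)"

definition disc_osc :: "real \<Rightarrow> (real \<Rightarrow> complex) \<Rightarrow> real \<Rightarrow> complex" where
  "disc_osc h u a =
     (if a \<in> grid_support h
      then - (1 / h\<^sup>2 * sqrt ((1 + a * h + h\<^sup>2) * (1 - a * h))) *\<^sub>R u (a + h)
           - (1 / h\<^sup>2 * sqrt ((1 - a * h + h\<^sup>2) * (1 + a * h))) *\<^sub>R u (a - h)
           + (1 + 2 / h\<^sup>2) *\<^sub>R u a
      else 0)"

end

theory Submission
  imports Defs
begin

text \<open>
  Write \<open>h = step N\<close> and \<open>N = 2 m\<close>, so that \<open>h\<^sup>2 = 1 / m\<close>. All constants below are uniform in \<open>N\<close>, and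
  no lower bound on \<open>N\<close> is needed.

  Consistency of the discrete operator. A function \<open>g\<close> in the space \<open>Sigma_space 5\<close> has a continuous
  representative \<open>G 0\<close> that is four times continuously differentiable, with derivatives \<open>G 1\<close>, ..., \<open>G 4\<close>,
  and \<open>G 4\<close> is an indefinite integral of the fifth weak derivative (\<open>Sobolev_smooth_representatives\<close>;
  this rests on the du Bois-Reymond lemma). Taylor expansion of the two hopping coefficients and of the
  second difference shows that the local error at a grid point \<open>a\<close> is at most a constant times \<open>h\<close> times
  the integral over \<open>{a - h..a + h}\<close> of
  \<open>jap x ^ 4 * (|g| + |g'|) + jap x ^ 2 * (|g''| + |g'''|) + |g''''|\<close> (\<open>consistency_pointwise\<close>).
  Outside the support of the operator the factor \<open>h\<^sup>2\<close> comes from \<open>1 < h \<bar>a\<bar>\<close>. By the Cauchy-Schwarz inequality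
  and bounded overlap of the intervals the discrete norm of the error is then at most a constant times \<open>h\<^sup>2\<close>
  times the \<open>L2\<close> norm of this function. That norm is controlled by \<open>Sigma_norm 5 g\<close>, because integration by
  parts bounds the square of the norm of \<open>jap x ^ (5 - k) * G k x\<close> by the product of the norms with
  indices \<open>k - 1\<close> and \<open>k + 1\<close> and lower order terms, and these inequalities interpolate between
  \<open>k = 0\<close> and \<open>k = 5\<close> (\<open>cutnorm_step\<close>, \<open>interpolation_chain\<close>, \<open>Sigma_weighted_bounds\<close>).

  Asymptotics of the Kravchuk functions. With \<open>a = h j\<close> the weight \<open>rho N a\<close> is its central value, which the
  Wallis product controls with relative error \<open>O(1 / m)\<close>, times a ratio of binomial coefficients
  whose logarithm for \<open>2 \<bar>j\<bar> \<le> m\<close> is \<open>- a\<^sup>2 + O(h\<^sup>2 (1 + a\<^sup>2)\<^sup>2)\<close>. Since \<open>rho\<close> is also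
  dominated by a Gaussian, the square root of \<open>rho\<close> differs from \<open>pi powr (- 1/4) * exp (- a\<^sup>2 / 2)\<close> by
  \<open>O(h\<^sup>2 (1 + a\<^sup>2)\<^sup>2 exp (- a\<^sup>2 / 4))\<close> at every grid point (\<open>sqrt_rho_vs_gauss\<close>). The Kravchuk and Hermite polynomials
  are both bounded by \<open>(2 \<bar>x\<bar> + sqrt (2 n)) ^ n\<close>, and their recurrences differ by a term of size \<open>h\<^sup>2 n\<^sup>2\<close>,
  so they differ by at most \<open>h\<^sup>2 n\<^sup>2\<close> times this bound (\<open>kravchuk_minus_hermite\<close>). After normalization the
  bound is at most \<open>3 ^ n * exp (n / 2) * exp (x\<^sup>2 / 8)\<close>, where the last factor is absorbed by the Gaussian. Altogether
  the error is \<open>O(h\<^sup>2 exp (3 n))\<close> times a rapidly decreasing function (\<open>kravchuk_fun_vs_hermite_fun\<close>), and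
  \<open>exp (3 n)\<close> is at most \<open>h powr (- \<delta>)\<close> in the stated range of \<open>n\<close>.
\<close>

section \<open>The binomial weight and the Gaussian\<close>

lemma ln_one_minus_second_order:
  fixes x :: real assumes "0 \<le> x" "x \<le> 1/2"
  shows "\<bar>ln (1 - x) + x + x\<^sup>2 / 2\<bar> \<le> x ^ 3"
proof -
  have up: "ln (1 - x) + x + x\<^sup>2 / 2 \<le> ln (1 - 0) + 0 + 0\<^sup>2 / 2"
    by (rule DERIV_nonpos_imp_nonincreasing[of 0 x "\<lambda>x. ln (1 - x) + x + x\<^sup>2 / 2"])
       (use assms in \<open>auto intro!: exI derivative_eq_intros simp: field_simps\<close>)
  have lo: "ln (1 - x) + x + x\<^sup>2 / 2 + x ^ 3 \<ge> ln (1 - 0) + 0 + 0\<^sup>2 / 2 + 0 ^ 3"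
  proof (rule DERIV_nonneg_imp_nondecreasing[of 0 x "\<lambda>x. ln (1 - x) + x + x\<^sup>2 / 2 + x ^ 3"])
    fix z assume z: "0 \<le> z" "z \<le> x"
    then have "z * (z * (2 - 3 * z)) \<ge> 0" using assms by (intro mult_nonneg_nonneg) auto
    then have "0 \<le> - 1 / (1 - z) + 1 + z + 3 * z\<^sup>2"
      using z assms by (simp add: field_simps power2_eq_square)
    moreover have "((\<lambda>x. ln (1 - x) + x + x\<^sup>2 / 2 + x ^ 3) has_real_derivative
        (- 1 / (1 - z) + 1 + z + 3 * z\<^sup>2)) (at z)"
      using z assms by (auto intro!: derivative_eq_intros simp: field_simps)
    ultimately show "\<exists>y. ((\<lambda>x. ln (1 - x) + x + x\<^sup>2 / 2 + x ^ 3) has_real_derivative y) (at z) \<and> 0 \<le> y"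
      by blast
  qed (use assms in auto)
  show ?thesis using up lo assms by (simp add: abs_if)
qed

lemma ln_one_plus_second_order:
  fixes x :: real assumes "0 \<le> x"
  shows "\<bar>ln (1 + x) - x + x\<^sup>2 / 2\<bar> \<le> x ^ 3"
proof -
  have up: "ln (1 + x) - x + x\<^sup>2 / 2 - x ^ 3 \<le> ln (1 + 0) - 0 + 0\<^sup>2 / 2 - 0 ^ 3"
  proof (rule DERIV_nonpos_imp_nonincreasing[of 0 x "\<lambda>x. ln (1 + x) - x + x\<^sup>2 / 2 - x ^ 3"])
    fix z assume z: "0 \<le> z" "z \<le> x"
    have "1 / (1 + z) - 1 + z - 3 * z\<^sup>2 = - (2 * z\<^sup>2 + 3 * z ^ 3) / (1 + z)"
      using z by (simp add: divide_simps power2_eq_square power3_eq_cube) (simp add: algebra_simps)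
    moreover have "0 \<le> (2 * z\<^sup>2 + 3 * z ^ 3) / (1 + z)" using z by simp
    ultimately have "0 \<ge> 1 / (1 + z) - 1 + z - 3 * z\<^sup>2" by linarith
    moreover have "((\<lambda>x. ln (1 + x) - x + x\<^sup>2 / 2 - x ^ 3) has_real_derivative
        (1 / (1 + z) - 1 + z - 3 * z\<^sup>2)) (at z)"
      using z assms by (auto intro!: derivative_eq_intros simp: field_simps)
    ultimately show "\<exists>y. ((\<lambda>x. ln (1 + x) - x + x\<^sup>2 / 2 - x ^ 3) has_real_derivative y) (at z) \<and> y \<le> 0"
      by blast
  qed (use assms in auto)
  have lo: "ln (1 + x) - x + x\<^sup>2 / 2 \<ge> ln (1 + 0) - 0 + 0\<^sup>2 / 2"
  proof (rule DERIV_nonneg_imp_nondecreasing[of 0 x "\<lambda>x. ln (1 + x) - x + x\<^sup>2 / 2"])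
    fix z assume z: "0 \<le> z" "z \<le> x"
    then have "0 \<le> 1 / (1 + z) - 1 + z"
      using assms by (simp add: field_simps)
    moreover have "((\<lambda>x. ln (1 + x) - x + x\<^sup>2 / 2) has_real_derivative
        (1 / (1 + z) - 1 + z)) (at z)"
      using z assms by (auto intro!: derivative_eq_intros simp: field_simps)
    ultimately show "\<exists>y. ((\<lambda>x. ln (1 + x) - x + x\<^sup>2 / 2) has_real_derivative y) (at z) \<and> 0 \<le> y"
      by blast
  qed (use assms in auto)
  show ?thesis using up lo assms by (simp add: abs_if)
qed

text \<open>Binomial coefficients of \<open>2 m\<close> relative to the central one, as a function of the distance \<open>j\<close>
  from the centre.\<close>

definition binom_ratio :: "nat \<Rightarrow> nat \<Rightarrow> real" where
  "binom_ratio m j = real ((2 * m) choose (m + j)) / real ((2 * m) choose m)"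

lemma binom_ratio_0 [simp]: "binom_ratio m 0 = 1"
  by (simp add: binom_ratio_def)

lemma binom_ratio_pos: "j \<le> m \<Longrightarrow> 0 < binom_ratio m j"
  by (simp add: binom_ratio_def)

lemma binom_ratio_Suc:
  assumes "j < m"
  shows "binom_ratio m (Suc j) = binom_ratio m j * (real m - real j) / (real m + real j + 1)"
proof -
  have "(2 * m - (m + j)) * (2 * m choose (m + j)) = Suc (m + j) * (2 * m choose Suc (m + j))"
    using binomial_absorb_comp[of "2*m" "m+j"] binomial_absorption[of "m+j" "2*m"] by simp
  then have "real (m - j) * real (2 * m choose (m + j)) = real (Suc (m + j)) * real (2 * m choose Suc (m + j))"
    by (metis add_diff_cancel_left diff_add_inverse mult_2 of_nat_mult)
  then have "(real m - real j) * real (2 * m choose (m + j)) = (real m + real j + 1) * real (2 * m choose Suc (m + j))"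
    using assms by (simp add: of_nat_diff algebra_simps)
  then have "real (2 * m choose Suc (m + j)) = real (2 * m choose (m + j)) * (real m - real j) / (real m + real j + 1)"
    by (simp add: nonzero_eq_divide_eq add_nonneg_eq_0_iff mult.commute)
  then show ?thesis by (simp add: binom_ratio_def)
qed

lemma binom_ratio_le_gauss:
  assumes "j \<le> m" "0 < m"
  shows "binom_ratio m j \<le> exp (- (real j)\<^sup>2 / (2 * real m))"
  using assms(1)
proof (induction j)
  case (Suc j)
  have "(real m - real j) / (real m + real j + 1) = 1 + (- ((2 * real j + 1) / (real m + real j + 1)))"
    by (simp add: field_simps)
  also have "\<dots> \<le> exp (- ((2 * real j + 1) / (real m + real j + 1)))" by (rule exp_ge_add_one_self)
  also have "\<dots> \<le> exp (- ((2 * real j + 1) / (2 * real m)))"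
    using Suc.prems by (simp add: frac_le)
  finally have 1: "(real m - real j) / (real m + real j + 1) \<le> exp (- ((2 * real j + 1) / (2 * real m)))" .
  have "binom_ratio m (Suc j) = binom_ratio m j * ((real m - real j) / (real m + real j + 1))"
    using binom_ratio_Suc[of j m] Suc.prems by simp
  also have "\<dots> \<le> exp (- (real j)\<^sup>2 / (2 * real m)) * exp (- ((2 * real j + 1) / (2 * real m)))"
    using Suc 1 binom_ratio_pos[of j m] by (intro mult_mono) auto
  also have "\<dots> = exp (- (real (Suc j))\<^sup>2 / (2 * real m))"
    unfolding exp_add[symmetric] using assms(2) by (simp add: field_simps power2_eq_square)
  finally show ?case .
qed simp

text \<open>Each factor is \<open>(1 - i / m) / (1 + (i + 1) / m)\<close>. The first order terms add up to \<open>- j\<^sup>2 / m\<close>; the second order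
  terms nearly cancel, which is why the error is \<open>O(j\<^sup>2 / m\<^sup>2 + j\<^sup>4 / m\<^sup>3)\<close>.\<close>

lemma ln_binom_ratio:
  assumes "2 * j \<le> m" "0 < m"
  shows "\<bar>ln (binom_ratio m j) + (real j)\<^sup>2 / real m\<bar> \<le> (real j)\<^sup>2 / (real m)\<^sup>2 + 2 * real j ^ 4 / real m ^ 3"
  using assms(1)
proof (induction j)
  case (Suc j)
  define M where "M = real m"
  define x where "x = real j / M"
  define y where "y = (real j + 1) / M"
  have M: "M > 0" using assms M_def by auto
  have jM: "2 * (real j + 1) \<le> M" using of_nat_mono[OF Suc.prems, where ?'a=real] unfolding M_def by simp
  have x: "0 \<le> x" "x \<le> 1/2" and y: "0 \<le> y" and xy: "x \<le> y"
    using M jM by (auto simp: x_def y_def field_simps)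
  have eq: "ln (binom_ratio m (Suc j)) = ln (binom_ratio m j) + (ln (1 - x) - ln (1 + y))"
  proof -
    have "binom_ratio m (Suc j) = binom_ratio m j * ((1 - x) / (1 + y))"
    proof -
      have "1 - x = (M - real j) / M" "1 + y = (M + real j + 1) / M"
        using M by (auto simp: x_def y_def field_simps)
      then show ?thesis using binom_ratio_Suc[of j m] Suc.prems M by (simp add: M_def)
    qed
    moreover have "binom_ratio m j > 0" using binom_ratio_pos Suc.prems by simp
    ultimately show ?thesis using x y by (simp add: ln_mult ln_div)
  qed
  have a: "\<bar>ln (1 - x) + x + x\<^sup>2 / 2\<bar> \<le> y ^ 3"
    using ln_one_minus_second_order[OF x] power_mono[OF xy x(1), of 3] by linarith
  have b: "\<bar>ln (1 + y) - y + y\<^sup>2 / 2\<bar> \<le> y ^ 3" using ln_one_plus_second_order[OF y] .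
  have c: "y\<^sup>2 - x\<^sup>2 = (2 * real j + 1) / M\<^sup>2" "x + y = (2 * real j + 1) / M"
    using M by (auto simp: x_def y_def field_simps power2_eq_square)
  \<comment> \<open>The quadratic terms of the two expansions enter with opposite signs and leave \<open>(y\<^sup>2 - x\<^sup>2) / 2\<close>.\<close>
  have d: "\<bar>ln (1 - x) - ln (1 + y) + (2 * real j + 1) / M\<bar> \<le> (2 * real j + 1) / (2 * M\<^sup>2) + 2 * y ^ 3"
  proof -
    have "(y\<^sup>2 - x\<^sup>2) / 2 = (2 * real j + 1) / (2 * M\<^sup>2)" using c(1) by simp
    moreover have "y\<^sup>2 - x\<^sup>2 \<ge> 0" using power_mono[OF xy x(1), of 2] by simp
    moreover have "ln (1 - x) - ln (1 + y) + (x + y)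
        = (ln (1 - x) + x + x\<^sup>2 / 2) - (ln (1 + y) - y + y\<^sup>2 / 2) + (y\<^sup>2 - x\<^sup>2) / 2"
      by (simp add: diff_divide_distrib)
    moreover have "\<bar>(y\<^sup>2 - x\<^sup>2) / 2\<bar> = (y\<^sup>2 - x\<^sup>2) / 2" using calculation(2) by simp
    ultimately show ?thesis using a b unfolding c(2)[symmetric]
      by (simp only: abs_le_iff) argo
  qed
  have IH: "\<bar>ln (binom_ratio m j) + (real j)\<^sup>2 / M\<bar> \<le> (real j)\<^sup>2 / M\<^sup>2 + 2 * real j ^ 4 / M ^ 3"
    using Suc M_def by simp
  have "(real j)\<^sup>2 / M + (2 * real j + 1) / M = (real (Suc j))\<^sup>2 / M"
    by (simp add: add_divide_distrib[symmetric] power2_eq_square algebra_simps)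
  then have 1: "\<bar>ln (binom_ratio m (Suc j)) + (real (Suc j))\<^sup>2 / M\<bar>
      \<le> ((real j)\<^sup>2 / M\<^sup>2 + (2 * real j + 1) / (2 * M\<^sup>2)) + (2 * real j ^ 4 / M ^ 3 + 2 * y ^ 3)"
    using IH d eq by linarith
  have 2: "(real j)\<^sup>2 / M\<^sup>2 + (2 * real j + 1) / (2 * M\<^sup>2) \<le> (real (Suc j))\<^sup>2 / M\<^sup>2"
    using M by (simp add: divide_simps power2_eq_square algebra_simps)
  have 3: "2 * real j ^ 4 / M ^ 3 + 2 * y ^ 3 \<le> 2 * real (Suc j) ^ 4 / M ^ 3"
  proof -
    have "real j ^ 4 + (real j + 1) ^ 3 \<le> (real j + 1) ^ 4"
    proof -
      have "real j * real j ^ 3 \<le> real j * (real j + 1) ^ 3"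
        by (intro mult_left_mono power_mono) auto
      then show ?thesis by (simp add: power4_eq_xxxx power3_eq_cube algebra_simps)
    qed
    then have "(real j ^ 4 + (real j + 1) ^ 3) / M ^ 3 \<le> (real j + 1) ^ 4 / M ^ 3"
      using M by (intro divide_right_mono) auto
    moreover have "y ^ 3 = (real j + 1) ^ 3 / M ^ 3" by (simp add: y_def power_divide)
    ultimately show ?thesis by (simp only: add_divide_distrib of_nat_Suc add.commute[of 1])
  qed
  show ?case using 1 2 3 unfolding M_def by linarith
qed simp

text \<open>The Wallis product equals \<open>m / ((2 m + 1) c\<^sup>2)\<close>. It increases to \<open>pi / 2\<close>, whereas its multiple
  by \<open>(2 m + 1) / (2 m)\<close> decreases to the same limit; this gives both bounds.\<close>

lemma wallis_central_binomial:
  assumes "0 < m"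
  defines "c \<equiv> sqrt (real m) * real ((2 * m) choose m) / 4 ^ m"
  shows "pi * c\<^sup>2 \<le> 1" "2 * real m / (2 * real m + 1) \<le> pi * c\<^sup>2" "c > 0"
proof -
  define P where "P = (\<lambda>n. \<Prod>k=1..n. (4*real k^2) / (4*real k^2 - 1))"
  define c' where "c' = (\<lambda>n. real n * (real ((2*n) choose n) / 4 ^ n)\<^sup>2)"
  define Q where "Q = (\<lambda>n. P n * (2 * real n + 1) / (2 * real n))"
  have lim: "P \<longlonglongrightarrow> pi / 2" using wallis unfolding P_def .
  have PSuc: "P (Suc n) = P n * (4 * (real n + 1)^2 / (4 * (real n + 1)^2 - 1))" for n
    by (simp add: P_def add.commute)
  have den: "4 * (real n + 1)^2 - 1 > 0" for n :: nat
    by (simp add: power2_eq_square algebra_simps add_pos_nonneg)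
  have Ppos: "P n > 0" for n
  proof (induction n)
    case 0 then show ?case by (simp add: P_def)
  next
    case (Suc n) then show ?case using den[of n] by (simp add: PSuc)
  qed
  have incP: "incseq P"
  proof (rule incseq_SucI)
    fix n
    have "1 \<le> 4 * (real n + 1)^2 / (4 * (real n + 1)^2 - 1)" using den[of n] by (simp add: field_simps)
    then show "P n \<le> P (Suc n)" using Ppos[of n] unfolding PSuc
      by (metis mult.right_neutral mult_le_cancel_left_pos)
  qed
  have Ple: "P n \<le> pi / 2" for n using incseq_le[OF incP lim] .
  have decQ: "Q (Suc n) \<ge> Q (Suc (Suc n))" for n
  proof -
    define x where "x = real n + 1"
    have x: "x \<ge> 1" by (simp add: x_def)
    have d: "4 * (x + 1)^2 - 1 = (2 * x + 1) * (2 * x + 3)" by (simp add: power2_eq_square algebra_simps)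
    have e: "P (Suc (Suc n)) = P (Suc n) * (4 * (x + 1)^2 / ((2 * x + 1) * (2 * x + 3)))"
      using PSuc[of "Suc n"] d by (simp add: x_def add.commute)
    have "(4 * (x + 1)^2 / ((2 * x + 1) * (2 * x + 3))) * ((2 * x + 3) / (2 * (x + 1)))
        = 2 * (x + 1) / (2 * x + 1)"
      using x by (simp add: divide_simps power2_eq_square) (simp add: algebra_simps)
    also have "\<dots> \<le> (2 * x + 1) / (2 * x)" using x by (simp add: divide_simps algebra_simps)
    finally have "P (Suc n) * ((4 * (x + 1)^2 / ((2 * x + 1) * (2 * x + 3))) * ((2 * x + 3) / (2 * (x + 1))))
        \<le> P (Suc n) * ((2 * x + 1) / (2 * x))"
      using Ppos[of "Suc n"] by (intro mult_left_mono) auto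
    moreover have "Q (Suc (Suc n)) = P (Suc n) * ((4 * (x + 1)^2 / ((2 * x + 1) * (2 * x + 3))) * ((2 * x
      + 3) / (2 * (x + 1))))"
      unfolding Q_def e by (simp add: x_def algebra_simps)
    moreover have "Q (Suc n) = P (Suc n) * ((2 * x + 1) / (2 * x))"
      unfolding Q_def by (simp add: x_def algebra_simps)
    ultimately show ?thesis by simp
  qed
  have limQ: "(\<lambda>n. Q (Suc n)) \<longlonglongrightarrow> pi / 2"
  proof -
    have "(\<lambda>n. (2 * real n + 1) / (2 * real n)) \<longlonglongrightarrow> 1"
    proof -
      have "(\<lambda>n. 1 + (1/2) * inverse (real n)) \<longlonglongrightarrow> 1 + (1/2) * 0"
        by (intro tendsto_intros lim_inverse_n)
      moreover have "\<forall>\<^sub>F n in sequentially. 1 + (1/2) * inverse (real n) = (2 * real n + 1) / (2 * real n)"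
        using eventually_gt_at_top[of 0] by eventually_elim (auto simp: field_simps)
      ultimately show ?thesis by (simp add: tendsto_cong)
    qed
    then have "Q \<longlonglongrightarrow> pi / 2 * 1" unfolding Q_def times_divide_eq_right[symmetric]
      by (intro tendsto_mult lim)
    then show ?thesis by (simp add: LIMSEQ_Suc)
  qed
  have Qge: "Q (Suc n) \<ge> pi / 2" for n
    using decseq_ge[OF decseq_SucI limQ, of n] decQ by simp
  have binSuc: "real ((2 * Suc n) choose Suc n) = real ((2*n) choose n) * (2 * (2 * real n + 1) / (real n + 1))" for n
  proof -
    have "Suc n * (2 * Suc n choose Suc n) = 2 * Suc n * (Suc (2*n) choose n)"
      using binomial_absorption[of n "2 * Suc n"] by simp
    then have "Suc n * (2 * Suc n choose Suc n) = Suc n * (2 * (Suc (2*n) choose n))" by (simp only: mult_ac)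
    then have 1: "(2 * Suc n choose Suc n) = 2 * (Suc (2*n) choose n)" by (simp only: mult_cancel1) simp
    have "Suc n * (Suc (2*n) choose n) = Suc n * (Suc (2*n) choose Suc n)"
      using binomial_symmetric[of n "Suc (2*n)"] by simp
    also have "\<dots> = Suc (2*n) * (2*n choose n)" using binomial_absorption[of n "Suc (2*n)"] by simp
    finally have "real (Suc n) * real (Suc (2*n) choose n) = real (Suc (2*n)) * real (2*n choose n)"
      unfolding of_nat_mult[symmetric] by simp
    then show ?thesis unfolding 1 by (simp add: field_simps)
  qed
  have cP: "(real ((2*n) choose n) / 4 ^ n)\<^sup>2 * (2 * real n + 1) * P n = 1" for n
  proof (induction n)
    case 0 then show ?case by (simp add: P_def)
  next
    case (Suc n)
    define x where "x = real n + 1"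
    have x: "x \<ge> 1" by (simp add: x_def)
    define B where "B = real ((2*n) choose n) / 4 ^ n"
    have d: "4 * x^2 - 1 = (2 * x - 1) * (2 * x + 1)" by (simp add: power2_eq_square algebra_simps)
    have b: "real ((2 * Suc n) choose Suc n) / 4 ^ Suc n = B * ((2 * x - 1) / (2 * x))"
      unfolding binSuc using x by (simp add: x_def B_def divide_simps) (simp add: algebra_simps)
    have p: "P (Suc n) = P n * (4 * x\<^sup>2 / ((2 * x - 1) * (2 * x + 1)))"
      unfolding PSuc d[symmetric] by (simp add: x_def)
    have IH: "B\<^sup>2 * (2 * x - 1) * P n = 1" 
    proof -
      have "2 * x - 1 = 2 * real n + 1" by (simp add: x_def)
      then show ?thesis using Suc by (simp only: B_def)
    qed
    have s: "2 * real (Suc n) + 1 = 2 * x + 1" by (simp add: x_def)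
    have "((2 * x - 1) / (2 * x))\<^sup>2 * (2 * x + 1) * (4 * x\<^sup>2 / ((2 * x - 1) * (2 * x + 1))) = 2 * x - 1"
      using x by (simp add: divide_simps power2_eq_square)
    then have "(B * ((2 * x - 1) / (2 * x)))\<^sup>2 * (2 * x + 1) * (P n * (4 * x\<^sup>2 / ((2 * x - 1) * (2 * x + 1))))
        = B\<^sup>2 * (2 * x - 1) * P n"
    proof -
      have "(B * t)\<^sup>2 * u * (p * v) = B\<^sup>2 * (t\<^sup>2 * u * v) * p" for t u v p :: real
        by (simp add: power2_eq_square ac_simps)
      then show ?thesis
        using \<open>((2 * x - 1) / (2 * x))\<^sup>2 * (2 * x + 1) * (4 * x\<^sup>2 / ((2 * x - 1) * (2 * x + 1))) = 2 * x - 1\<close>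
        by presburger
    qed
    then show ?case unfolding b p s using IH by simp
  qed
  obtain n where n: "m = Suc n" using assms(1) by (cases m) auto
  have c2: "c\<^sup>2 = real m * (real ((2 * m) choose m) / 4 ^ m)\<^sup>2"
    unfolding c_def by (simp add: power_mult_distrib power_divide)
  have cc: "c\<^sup>2 * (2 * real m + 1) * P m = real m" using cP[of m] unfolding c2
    by (simp only: mult.assoc mult_1_right)
  have m: "real m > 0" using assms(1) by simp
  have "c\<^sup>2 * Q m = 1/2" unfolding Q_def using cc m by (simp add: field_simps)
  moreover have "c\<^sup>2 * Q m \<ge> c\<^sup>2 * (pi / 2)" using Qge[of n] n by (intro mult_left_mono) auto
  ultimately show "pi * c\<^sup>2 \<le> 1" by (simp add: algebra_simps)
  have "c\<^sup>2 * (2 * real m + 1) * P m \<le> c\<^sup>2 * (2 * real m + 1) * (pi / 2)"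
    using Ple[of m] by (intro mult_left_mono) auto
  then have "real m \<le> c\<^sup>2 * (2 * real m + 1) * (pi / 2)" using cc by simp
  then show "2 * real m / (2 * real m + 1) \<le> pi * c\<^sup>2" using m by (simp add: field_simps)
  show "c > 0" using m unfolding c_def by simp
qed

lemma abs_exp_diff_le:
  fixes u v w :: real assumes "u \<le> w" "v \<le> w"
  shows "\<bar>exp u - exp v\<bar> \<le> \<bar>u - v\<bar> * exp w"
proof -
  have *: "exp p - exp q \<le> (p - q) * exp w" if "q \<le> p" "p \<le> w" for p q :: real
  proof -
    have "exp p - exp q = (1 - exp (q - p)) * exp p" by (simp add: exp_diff field_simps)
    also have "\<dots> \<le> (p - q) * exp w"
      using that exp_ge_add_one_self[of "q - p"] by (intro mult_mono) (simp_all add: algebra_simps)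
    finally show ?thesis .
  qed
  show ?thesis using *[of u v] *[of v u] assms by (cases "u \<le> v") (auto simp: abs_if)
qed

lemma step_even: "step (2 * m) = 1 / sqrt (real m)"
  by (simp add: step_def powr_minus powr_half_sqrt real_sqrt_mult field_simps)

text \<open>The weight at the grid point with index \<open>j\<close>. It vanishes for \<open>\<bar>j\<bar> > m\<close>.\<close>

lemma rho_grid:
  fixes j :: int
  assumes "0 < m"
  shows "rho (2 * m) (step (2 * m) * of_int j)
    = (if \<bar>j\<bar> \<le> int m then sqrt (real m) * real ((2 * m) choose m) / 4 ^ m * binom_ratio m (nat \<bar>j\<bar>) else 0)"
proof -
  define h where "h = step (2 * m)"
  have h: "h = 1 / sqrt (real m)" "h > 0" "1 / h = sqrt (real m)" "1 / h\<^sup>2 = real m"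
    using assms by (auto simp: h_def step_even power_divide)
  have mem: "h * of_int j \<in> grid_support h \<longleftrightarrow> \<bar>j\<bar> \<le> int m"
  proof -
    have 1: "1 / h = h * real m" using h(2,4) by (simp add: field_simps power2_eq_square)
    have "h * of_int j \<in> grid_support h \<longleftrightarrow> - 1 / h \<le> h * of_int j \<and> h * of_int j \<le> 1 / h"
      by (auto simp: grid_support_def grid_def)
    also have "\<dots> \<longleftrightarrow> - real m \<le> of_int j \<and> of_int j \<le> real m"
      using h(2) 1 by (simp add: minus_divide_left[symmetric] del: mult_minus_right)
         (metis mult_le_cancel_left_pos mult_minus_right)
    also have "\<dots> \<longleftrightarrow> \<bar>j\<bar> \<le> int m" by linarith
    finally show ?thesis .
  qed
  show ?thesis
  proof (cases "\<bar>j\<bar> \<le> int m")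
    case True
    have "1 / h\<^sup>2 + h * of_int j / h = of_int (int m + j)" using h by simp
    then have fl: "nat \<lfloor>1 / h\<^sup>2 + h * of_int j / h\<rfloor> = nat (int m + j)" by simp
    have "((2 * m) choose nat (int m + j)) = ((2 * m) choose (m + nat \<bar>j\<bar>))"
    proof (cases "j \<ge> 0")
      case True then show ?thesis by (simp add: nat_add_distrib)
    next
      case False
      then have "nat (int m + j) = 2 * m - (m + nat \<bar>j\<bar>)" "m + nat \<bar>j\<bar> \<le> 2 * m" using True by auto
      then show ?thesis using binomial_symmetric[of "m + nat \<bar>j\<bar>" "2 * m"] by simp
    qed
    moreover have "real ((2 * m) choose m) > 0" by simp
    moreover have "1 / (h * 2 ^ (2 * m)) = sqrt (real m) / 4 ^ m"
      using h by (simp add: power_mult)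
    ultimately show ?thesis using True mem fl
      by (simp add: rho_def Let_def binom_ratio_def h_def[symmetric])
  next
    case False
    then show ?thesis using mem by (simp add: rho_def Let_def h_def[symmetric])
  qed
qed

text \<open>The local limit theorem with a rate, for the square root of the weight. For \<open>2 \<bar>j\<bar> \<le> m\<close> the
  logarithms are compared; beyond that both functions are at most \<open>exp (- a\<^sup>2 / 4)\<close>, and \<open>1 \<le> 4 h\<^sup>2 a\<^sup>2\<close>.\<close>

lemma sqrt_rho_vs_gauss:
  fixes j :: int
  assumes "0 < m"
  defines "h \<equiv> step (2 * m)"
  defines "a \<equiv> h * of_int j"
  shows "0 \<le> rho (2 * m) a"
    and "sqrt (rho (2 * m) a) \<le> exp (- a\<^sup>2 / 4)"
    and "\<bar>sqrt (rho (2 * m) a) - exp (- a\<^sup>2 / 2) / pi powr (1/4)\<bar> \<le> 4 * h\<^sup>2 * (1 + a\<^sup>2)\<^sup>2 * exp (- a\<^sup>2 / 4)"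
proof -
  define M where "M = real m"
  define i where "i = nat \<bar>j\<bar>"
  define c where "c = sqrt (real m) * real ((2 * m) choose m) / 4 ^ m"
  have M: "M > 0" using assms M_def by simp
  have h2: "h\<^sup>2 = 1 / M" and h0: "h > 0"
    using assms M by (auto simp: h_def step_even power_divide M_def)
  have ij: "\<bar>real_of_int j\<bar> = real i" by (simp add: i_def)
  then have a2: "a\<^sup>2 = (real i)\<^sup>2 / M"
    unfolding a_def power_mult_distrib h2 by (metis power2_abs mult.left_neutral times_divide_eq_left)
  have c: "pi * c\<^sup>2 \<le> 1" "2 * M / (2 * M + 1) \<le> pi * c\<^sup>2" "c > 0"
    using wallis_central_binomial[OF assms(1)] by (auto simp: c_def M_def)
  have rho: "rho (2 * m) a = (if i \<le> m then c * binom_ratio m i else 0)"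
    unfolding a_def h_def rho_grid[OF assms(1)] i_def c_def by auto
  have pi4: "pi powr (1/4) \<ge> 1" using pi_gt3 by (intro ge_one_powr_ge_zero) auto
  have far: "1 \<le> 4 * h\<^sup>2 * (1 + a\<^sup>2)\<^sup>2" if "\<not> 2 * i \<le> m"
  proof -
    have "M \<le> 2 * real i" using that by (simp add: M_def)
    then have "M\<^sup>2 \<le> (2 * real i)\<^sup>2" using M by (intro power_mono) auto
    then have "1 \<le> 4 * h\<^sup>2 * a\<^sup>2" using M unfolding h2 a2 by (simp add: field_simps power2_eq_square)
    also have "\<dots> \<le> 4 * h\<^sup>2 * (1 + a\<^sup>2)\<^sup>2"
      by (intro mult_left_mono) (auto simp: power2_sum)
    finally show ?thesis .
  qed
  have gauss: "0 \<le> exp (- a\<^sup>2 / 2) / pi powr (1/4)" "exp (- a\<^sup>2 / 2) / pi powr (1/4) \<le> exp (- a\<^sup>2 / 4)"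
  proof -
    have "exp (- a\<^sup>2 / 2) / pi powr (1/4) \<le> exp (- a\<^sup>2 / 2) / 1"
      using pi4 by (intro divide_left_mono) auto
    then show "exp (- a\<^sup>2 / 2) / pi powr (1/4) \<le> exp (- a\<^sup>2 / 4)"
      by (rule order_trans) (simp)
  qed simp
  show nonneg: "0 \<le> rho (2 * m) a" using rho c(3) binom_ratio_pos[of i m] by auto
  have main: "sqrt (rho (2 * m) a) \<le> exp (- a\<^sup>2 / 4) \<and>
    \<bar>sqrt (rho (2 * m) a) - exp (- a\<^sup>2 / 2) / pi powr (1/4)\<bar> \<le> 4 * h\<^sup>2 * (1 + a\<^sup>2)\<^sup>2 * exp (- a\<^sup>2 / 4)"
  proof (cases "i \<le> m")
    case False
    then have "1 * exp (- a\<^sup>2 / 4) \<le> 4 * h\<^sup>2 * (1 + a\<^sup>2)\<^sup>2 * exp (- a\<^sup>2 / 4)"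
      using far by (intro mult_right_mono) auto
    then have "exp (- a\<^sup>2 / 4) \<le> 4 * h\<^sup>2 * (1 + a\<^sup>2)\<^sup>2 * exp (- a\<^sup>2 / 4)" by simp
    then have "exp (- a\<^sup>2 / 2) / pi powr (1/4) \<le> 4 * h\<^sup>2 * (1 + a\<^sup>2)\<^sup>2 * exp (- a\<^sup>2 / 4)"
      using gauss(2) by linarith
    then show ?thesis using False rho gauss(1) by simp
  next
    case True
    define T where "T = ln (pi * c\<^sup>2) / 2 + ln (binom_ratio m i)"
    have Bpos: "binom_ratio m i > 0" using binom_ratio_pos True by simp
    have pc: "pi * c\<^sup>2 > 0" using c by simp
    have "exp T = sqrt pi * c * binom_ratio m i"
    proof -
      have "exp (ln (pi * c\<^sup>2) / 2) = sqrt (pi * c\<^sup>2)"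
        using pc by (intro real_sqrt_unique[symmetric]) (auto simp: power2_eq_square exp_add[symmetric])
      then show ?thesis unfolding T_def exp_add using Bpos c(3) by (simp add: real_sqrt_mult)
    qed
    then have "rho (2 * m) a = exp T / sqrt pi" using rho True by (simp add: field_simps)
    then have "sqrt (rho (2 * m) a) = sqrt (exp T) / sqrt (sqrt pi)" by (simp add: real_sqrt_divide)
    moreover have "sqrt (exp T) = exp (T / 2)"
      by (rule real_sqrt_unique) (auto simp: power2_eq_square exp_add[symmetric])
    moreover have "sqrt (sqrt pi) = pi powr (1/4)"
      by (simp add: powr_half_sqrt[symmetric] powr_powr)
    ultimately have sr: "sqrt (rho (2 * m) a) = exp (T / 2) / pi powr (1/4)" by simp
    have lnc: "ln (pi * c\<^sup>2) \<le> 0" using c(1) pc by simp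
    have "ln (binom_ratio m i) \<le> - a\<^sup>2 / 2"
      using binom_ratio_le_gauss[OF True assms(1)] ln_le_cancel_iff[OF Bpos, of "exp (- (real i)\<^sup>2 / (2 * M))"]
      unfolding a2 M_def by (simp add: field_simps)
    then have T: "T / 2 \<le> - a\<^sup>2 / 4" using lnc unfolding T_def by simp
    have s1: "sqrt (rho (2 * m) a) \<le> exp (- a\<^sup>2 / 4)"
    proof -
      have "exp (T / 2) / pi powr (1/4) \<le> exp (T / 2) / 1"
        using pi4 by (intro divide_left_mono) auto
      also have "\<dots> \<le> exp (- a\<^sup>2 / 4)" using T by simp
      finally show ?thesis using sr by simp
    qed
    have "\<bar>sqrt (rho (2 * m) a) - exp (- a\<^sup>2 / 2) / pi powr (1/4)\<bar> \<le> 4 * h\<^sup>2 * (1 + a\<^sup>2)\<^sup>2 * exp (- a\<^sup>2 / 4)"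
    proof (cases "2 * i \<le> m")
      case False
      have "\<bar>sqrt (rho (2 * m) a) - exp (- a\<^sup>2 / 2) / pi powr (1/4)\<bar> \<le> 1 * exp (- a\<^sup>2 / 4)"
        using s1 gauss real_sqrt_ge_zero[OF nonneg] by linarith
      also have "\<dots> \<le> 4 * h\<^sup>2 * (1 + a\<^sup>2)\<^sup>2 * exp (- a\<^sup>2 / 4)"
        using far[OF False] by (intro mult_right_mono) auto
      finally show ?thesis .
    next
      case near: True
      have "ln (pi * c\<^sup>2) \<ge> ln (2 * M / (2 * M + 1))" using c M by (intro ln_mono) auto
      also have "ln (2 * M / (2 * M + 1)) = - ln (1 + 1 / (2 * M))"
        using M by (subst ln_inverse[symmetric]) (auto simp: field_simps)
      finally have "ln (pi * c\<^sup>2) \<ge> - (1 / (2 * M))" using ln_add_one_self_le_self[of "1 / (2 * M)"] M by simp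
      then have l1: "\<bar>ln (pi * c\<^sup>2) / 2\<bar> \<le> h\<^sup>2 / 4" using lnc h2 by simp
      have "\<bar>ln (binom_ratio m i) + a\<^sup>2\<bar> \<le> (real i)\<^sup>2 / M\<^sup>2 + 2 * real i ^ 4 / M ^ 3"
        using ln_binom_ratio[OF near assms(1)] unfolding a2 M_def by simp
      also have "\<dots> = h\<^sup>2 * a\<^sup>2 + 2 * h\<^sup>2 * (a\<^sup>2)\<^sup>2"
        unfolding h2 a2 using M by (simp add: field_simps power2_eq_square power3_eq_cube power4_eq_xxxx)
      finally have l2: "\<bar>ln (binom_ratio m i) + a\<^sup>2\<bar> \<le> h\<^sup>2 * a\<^sup>2 + 2 * h\<^sup>2 * (a\<^sup>2)\<^sup>2" .
      have "\<bar>T + a\<^sup>2\<bar> \<le> h\<^sup>2 / 4 + (h\<^sup>2 * a\<^sup>2 + 2 * h\<^sup>2 * (a\<^sup>2)\<^sup>2)" using l1 l2 unfolding T_def by linarith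
      also have "\<dots> = h\<^sup>2 * (1/4 + a\<^sup>2 + 2 * (a\<^sup>2)\<^sup>2)" by (simp add: algebra_simps)
      also have "\<dots> \<le> h\<^sup>2 * (2 * (1 + a\<^sup>2)\<^sup>2)" by (intro mult_left_mono) (auto simp: power2_sum)
      finally have l3: "\<bar>T + a\<^sup>2\<bar> \<le> 2 * h\<^sup>2 * (1 + a\<^sup>2)\<^sup>2" by simp
      have "\<bar>exp (T / 2) - exp (- a\<^sup>2 / 2)\<bar> \<le> \<bar>T / 2 - - a\<^sup>2 / 2\<bar> * exp (- a\<^sup>2 / 4)"
        using T by (intro abs_exp_diff_le) auto
      also have "\<dots> \<le> (4 * h\<^sup>2 * (1 + a\<^sup>2)\<^sup>2) * exp (- a\<^sup>2 / 4)"
        using l3 by (intro mult_right_mono) auto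
      finally have l4: "\<bar>exp (T / 2) - exp (- a\<^sup>2 / 2)\<bar> \<le> 4 * h\<^sup>2 * (1 + a\<^sup>2)\<^sup>2 * exp (- a\<^sup>2 / 4)" .
      have "\<bar>sqrt (rho (2 * m) a) - exp (- a\<^sup>2 / 2) / pi powr (1/4)\<bar> = \<bar>exp (T / 2) - exp (- a\<^sup>2 / 2)\<bar> / pi powr (1/4)"
        unfolding sr by (simp add: diff_divide_distrib[symmetric] abs_divide)
      also have "\<dots> \<le> \<bar>exp (T / 2) - exp (- a\<^sup>2 / 2)\<bar> / 1"
        using pi4 by (intro divide_left_mono) auto
      finally show ?thesis using l4 by simp
    qed
    with s1 show ?thesis by simp
  qed
  show "sqrt (rho (2 * m) a) \<le> exp (- a\<^sup>2 / 4)" using main by blast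
  show "\<bar>sqrt (rho (2 * m) a) - exp (- a\<^sup>2 / 2) / pi powr (1/4)\<bar> \<le> 4 * h\<^sup>2 * (1 + a\<^sup>2)\<^sup>2 * exp (- a\<^sup>2 / 4)"
    using main by blast
qed

section \<open>Kravchuk and Hermite polynomials\<close>

text \<open>A common majorant of the Kravchuk and Hermite polynomials of degree \<open>n\<close>.\<close>

definition growth :: "nat \<Rightarrow> real \<Rightarrow> real" where
  "growth n x = (2 * \<bar>x\<bar> + sqrt (2 * real n)) ^ n"

lemma growth_nonneg: "0 \<le> growth n x"
  by (simp add: growth_def)

text \<open>The Hermite recurrence is the Kravchuk recurrence with \<open>h = 0\<close>.\<close>

lemma hermite_eq_kravchuk: "hermite n x = kravchuk 0 n x"
  by (induction n x rule: hermite.induct) auto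

text \<open>The majorant is compatible with the three-term recurrence: with \<open>b\<close> the base for the index
  \<open>n + 2\<close>, the bounds \<open>b ^ (n + 1)\<close> and \<open>b ^ n\<close> for two consecutive terms give \<open>b ^ (n + 2)\<close> for the next one.\<close>

lemma growth_base:
  fixes n :: nat and x :: real
  defines "b \<equiv> 2 * \<bar>x\<bar> + sqrt (2 * real (Suc (Suc n)))"
  shows "0 \<le> b" "growth (Suc n) x \<le> b ^ Suc n" "growth n x \<le> b ^ n"
    "2 * \<bar>x\<bar> * b + 2 * real (Suc (Suc n)) \<le> b\<^sup>2" "growth (Suc (Suc n)) x = b ^ n * b\<^sup>2"
proof -
  show b: "0 \<le> b" by (simp add: b_def)
  show "growth (Suc n) x \<le> b ^ Suc n" "growth n x \<le> b ^ n"
    unfolding growth_def b_def by (intro power_mono; simp)+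
  show "growth (Suc (Suc n)) x = b ^ n * b\<^sup>2"
    unfolding growth_def b_def by (simp add: power2_eq_square)
  have "b\<^sup>2 = 2 * \<bar>x\<bar> * b + 2 * \<bar>x\<bar> * sqrt (2 * real (Suc (Suc n))) + (sqrt (2 * real (Suc (Suc n))))\<^sup>2"
    unfolding b_def by (simp only: power2_eq_square algebra_simps)
  then show "2 * \<bar>x\<bar> * b + 2 * real (Suc (Suc n)) \<le> b\<^sup>2" by simp
qed

text \<open>The condition on \<open>n\<close> keeps the factor \<open>1 - h\<^sup>2 (k - 1) / 2\<close> of the recurrence between \<open>0\<close>
  and \<open>1\<close>.\<close>

lemma kravchuk_bound:
  assumes "h\<^sup>2 * real n \<le> 2"
  shows "\<bar>kravchuk h n x\<bar> \<le> growth n x"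
  using assms
proof (induction h n x rule: kravchuk.induct)
  case (1 h x) then show ?case by (simp add: growth_def)
next
  case (2 h x) then show ?case by (simp add: growth_def abs_mult)
next
  case (3 h n x)
  define b where "b = 2 * \<bar>x\<bar> + sqrt (2 * real (Suc (Suc n)))"
  note B = growth_base[where n=n and x=x, folded b_def]
  define k where "k = 1 - h\<^sup>2 * ((real (Suc n) - 1) / 2)"
  have mon: "h\<^sup>2 * real i \<le> 2" if "i \<le> Suc (Suc n)" for i
    using "3.prems" mult_left_mono[of "real i" "real (Suc (Suc n))" "h\<^sup>2"] that by simp
  have k: "\<bar>k\<bar> \<le> 1" using mon[of n] by (auto simp: k_def abs_le_iff)
  have IH1: "\<bar>kravchuk h (Suc n) x\<bar> \<le> b ^ Suc n" using "3.IH"(1) mon[of "Suc n"] B(2) by simp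
  have IH2: "\<bar>kravchuk h n x\<bar> \<le> b ^ n" using "3.IH"(2) mon[of n] B(3) by simp
  have "\<bar>kravchuk h (Suc (Suc n)) x\<bar> \<le> \<bar>2 * x * kravchuk h (Suc n) x\<bar> + \<bar>2 * real (Suc n) * k * kravchuk h n x\<bar>"
    unfolding kravchuk.simps k_def[symmetric] by (rule abs_triangle_ineq4)
  also have "\<dots> = 2 * \<bar>x\<bar> * \<bar>kravchuk h (Suc n) x\<bar> + 2 * real (Suc n) * \<bar>k\<bar> * \<bar>kravchuk h n x\<bar>"
    by (simp add: abs_mult)
  also have "\<dots> \<le> 2 * \<bar>x\<bar> * b ^ Suc n + 2 * real (Suc n) * 1 * b ^ n"
    using IH1 IH2 k B(1) by (intro add_mono mult_mono) auto
  also have "\<dots> \<le> b ^ n * (2 * \<bar>x\<bar> * b + 2 * real (Suc (Suc n)))"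
    using B(1) by (simp add: algebra_simps)
  also have "\<dots> \<le> b ^ n * b\<^sup>2" using B by (intro mult_left_mono) auto
  finally show ?case using B(5) by simp
qed

lemma hermite_bound: "\<bar>hermite n x\<bar> \<le> growth n x"
  unfolding hermite_eq_kravchuk by (rule kravchuk_bound) simp

lemma kravchuk_minus_hermite:
  assumes "h\<^sup>2 * real n \<le> 2"
  shows "\<bar>kravchuk h n x - hermite n x\<bar> \<le> h\<^sup>2 * (real n)\<^sup>2 * growth n x"
  using assms
proof (induction h n x rule: kravchuk.induct)
  case (3 h n x)
  define b where "b = 2 * \<bar>x\<bar> + sqrt (2 * real (Suc (Suc n)))"
  note B = growth_base[where n=n and x=x, folded b_def]
  define D where "D = (\<lambda>i. kravchuk h i x - hermite i x)"
  have mon: "h\<^sup>2 * real i \<le> 2" if "i \<le> Suc (Suc n)" for i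
    using "3.prems" mult_left_mono[of "real i" "real (Suc (Suc n))" "h\<^sup>2"] that by simp
  have IH1: "\<bar>D (Suc n)\<bar> \<le> h\<^sup>2 * (real (Suc n))\<^sup>2 * b ^ Suc n"
    using "3.IH"(1) mon[of "Suc n"] mult_left_mono[OF B(2), of "h\<^sup>2 * (real (Suc n))\<^sup>2"] unfolding D_def by simp
  have IH2: "\<bar>D n\<bar> \<le> h\<^sup>2 * (real n)\<^sup>2 * b ^ n"
    using "3.IH"(2) mon[of n] mult_left_mono[OF B(3), of "h\<^sup>2 * (real n)\<^sup>2"] unfolding D_def by simp
  have kb: "\<bar>kravchuk h n x\<bar> \<le> b ^ n" using kravchuk_bound[OF mon[of n], of x] B(3) by simp
  have "D (Suc (Suc n)) = 2 * x * D (Suc n) - 2 * real (Suc n) * D n + h\<^sup>2 * real (Suc n) * real n * kravchuk h n x"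
    unfolding D_def by (simp add: field_simps)
  then have "\<bar>D (Suc (Suc n))\<bar> \<le> \<bar>2 * x * D (Suc n)\<bar> + \<bar>2 * real (Suc n) * D n\<bar>
    + \<bar>h\<^sup>2 * real (Suc n) * real n * kravchuk h n x\<bar>"
    by linarith
  also have "\<dots> = 2 * \<bar>x\<bar> * \<bar>D (Suc n)\<bar> + 2 * real (Suc n) * \<bar>D n\<bar> + h\<^sup>2 * real (Suc n) * real n * \<bar>kravchuk h n x\<bar>"
    by (simp add: abs_mult)
  also have "\<dots> \<le> 2 * \<bar>x\<bar> * (h\<^sup>2 * (real (Suc n))\<^sup>2 * b ^ Suc n) + 2 * real (Suc n) * (h\<^sup>2 * (real n)\<^sup>2 * b ^ n)
      + h\<^sup>2 * real (Suc n) * real n * b ^ n"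
    using IH1 IH2 kb by (intro add_mono mult_left_mono) auto
  also have "\<dots> = h\<^sup>2 * b ^ n * ((real (Suc n))\<^sup>2 * (2 * \<bar>x\<bar> * b) + (2 * real (Suc n) * (real n)\<^sup>2
    + real (Suc n) * real n))"
    by (simp add: algebra_simps)
  also have "\<dots> \<le> h\<^sup>2 * b ^ n * ((real (Suc (Suc n)))\<^sup>2 * (2 * \<bar>x\<bar> * b)
    + (real (Suc (Suc n)))\<^sup>2 * (2 * real (Suc (Suc n))))"
  proof -
    have "2 * real (Suc n) * (real n)\<^sup>2 + real (Suc n) * real n \<le> (real (Suc (Suc n)))\<^sup>2 * (2 * real (Suc (Suc n)))"
      by (simp add: power2_eq_square algebra_simps)
    then show ?thesis
      using B(1) by (intro mult_left_mono add_mono mult_right_mono power_mono) auto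
  qed
  also have "\<dots> = h\<^sup>2 * b ^ n * ((real (Suc (Suc n)))\<^sup>2 * (2 * \<bar>x\<bar> * b + 2 * real (Suc (Suc n))))"
    by (simp add: algebra_simps)
  also have "\<dots> \<le> h\<^sup>2 * b ^ n * ((real (Suc (Suc n)))\<^sup>2 * b\<^sup>2)"
    using B(1) B(4) by (intro mult_left_mono) auto
  finally show ?case unfolding D_def B(5) by (simp only: ac_simps)
qed (auto simp: growth_def)

lemma power_self_le_fact_exp: "real n ^ n \<le> fact n * exp (real n)"
proof -
  have s: "(\<lambda>k. real n ^ k /\<^sub>R fact k) sums exp (real n)" by (rule exp_converges)
  have "sum (\<lambda>k. real n ^ k /\<^sub>R fact k) {n} \<le> exp (real n)"
    unfolding sums_unique[OF s] by (rule sum_le_suminf[OF sums_summable[OF s]]) auto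
  then show ?thesis by (simp add: field_simps)
qed

text \<open>Uses \<open>n ^ n \<le> fact n * exp n\<close> and \<open>1 + y \<le> 3 exp (y\<^sup>2 / 16)\<close> with \<open>y = sqrt 2 * \<bar>x\<bar> / sqrt n\<close>.\<close>

lemma growth_normalized:
  "growth n x / (2 powr (real n / 2) * sqrt (fact n)) \<le> 3 ^ n * exp (real n / 2) * exp (x\<^sup>2 / 8)"
proof (cases "n = 0")
  case True then show ?thesis by (simp add: growth_def)
next
  case False
  define y where "y = sqrt 2 * \<bar>x\<bar> / sqrt (real n)"
  have y: "y \<ge> 0" "y\<^sup>2 = 2 * x\<^sup>2 / real n" using False
    by (auto simp: y_def power_divide power_mult_distrib)
  have "1 + y \<le> 3 * (1 + y\<^sup>2 / 16)"
  proof -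
    have "0 \<le> (3 / 16) * (y - 8/3)\<^sup>2 + 2/3" by simp
    also have "\<dots> = 3 * (1 + y\<^sup>2 / 16) - (1 + y)" by (simp add: power2_eq_square algebra_simps)
    finally show ?thesis by simp
  qed
  also have "\<dots> \<le> 3 * exp (y\<^sup>2 / 16)" by (intro mult_left_mono exp_ge_add_one_self) simp
  finally have "1 + y \<le> 3 * exp (y\<^sup>2 / 16)" .
  then have "(1 + y) ^ n \<le> (3 * exp (y\<^sup>2 / 16)) ^ n" using y by (intro power_mono) auto
  also have "\<dots> = 3 ^ n * exp (x\<^sup>2 / 8)"
    using False y(2) by (simp add: power_mult_distrib exp_of_nat_mult[symmetric])
  finally have 1: "(1 + y) ^ n \<le> 3 ^ n * exp (x\<^sup>2 / 8)" .
  have 2: "sqrt (real n) ^ n \<le> sqrt (fact n) * exp (real n / 2)"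
  proof -
    have "sqrt (exp (real n)) = exp (real n / 2)"
      by (rule real_sqrt_unique) (auto simp: power2_eq_square exp_add[symmetric])
    moreover have "sqrt (real n ^ n) \<le> sqrt (fact n * exp (real n))"
      using power_self_le_fact_exp by (rule real_sqrt_le_mono)
    ultimately show ?thesis by (simp add: real_sqrt_mult real_sqrt_power)
  qed
  have 3: "2 powr (real n / 2) = sqrt 2 ^ n"
    by (simp add: powr_half_sqrt[symmetric] powr_realpow[symmetric] powr_powr)
  have "2 * \<bar>x\<bar> + sqrt (2 * real n) = sqrt 2 * sqrt (real n) * (1 + y)"
    using False by (simp add: y_def real_sqrt_mult field_simps)
  then have "growth n x = sqrt 2 ^ n * (sqrt (real n) ^ n * (1 + y) ^ n)"
    by (simp add: growth_def power_mult_distrib)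
  also have "\<dots> \<le> sqrt 2 ^ n * ((sqrt (fact n) * exp (real n / 2)) * (3 ^ n * exp (x\<^sup>2 / 8)))"
    using 1 2 y by (intro mult_left_mono mult_mono) auto
  finally show ?thesis unfolding 3 by (simp add: field_simps)
qed

text \<open>Here \<open>t\<close> is the inverse of the product of \<open>1 - i / N\<close> over \<open>i < n\<close>.\<close>

lemma falling_factorial_ratio:
  assumes "n \<le> N" "0 < N"
  defines "t \<equiv> real N ^ n * fact (N - n) / fact N"
  shows "1 \<le> t" "t * (1 - (real n)\<^sup>2 / real N) \<le> 1"
proof -
  have "1 \<le> real N ^ n * fact (N - n) / fact N \<and> real N ^ n * fact (N - n) / fact N * (1 - (real n)\<^sup>2 / real N) \<le> 1"
    using assms(1)
  proof (induction n)
    case (Suc n)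
    define s where "s = real N ^ n * fact (N - n) / fact N"
    define p where "p = real N - real n"
    have p: "p > 0" "real N > 0" "p \<le> real N" using Suc.prems by (auto simp: p_def)
    have "fact (N - n) = p * fact (N - Suc n)"
      using Suc.prems by (simp add: p_def fact_reduce[of "N - n"] of_nat_diff)
    then have e: "real N ^ Suc n * fact (N - Suc n) / fact N = s * (real N / p)"
      using p by (simp add: s_def field_simps)
    have IH: "1 \<le> s" "s * (1 - (real n)\<^sup>2 / real N) \<le> 1" using Suc by (auto simp: s_def)
    have "1 * 1 \<le> s * (real N / p)" using IH p by (intro mult_mono) auto
    moreover have "(real N / p) * (1 - (real (Suc n))\<^sup>2 / real N) \<le> 1 - (real n)\<^sup>2 / real N"
    proof -
      have "real N * (real N - (real n + 1)\<^sup>2) \<le> p * (real N - (real n)\<^sup>2)"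
        by (simp add: p_def power2_eq_square algebra_simps)
      then have "(real N - (real n + 1)\<^sup>2) / p \<le> (real N - (real n)\<^sup>2) / real N"
        using p by (simp add: frac_le_eq divide_le_0_iff mult.commute diff_le_0_iff_le)
      moreover have "(real N / p) * (1 - (real (Suc n))\<^sup>2 / real N) = (real N - (real n + 1)\<^sup>2) / p"
        using p by (simp add: divide_simps)
      moreover have "1 - (real n)\<^sup>2 / real N = (real N - (real n)\<^sup>2) / real N"
        using p by (simp add: diff_divide_distrib)
      ultimately show ?thesis by (simp only:)
    qed
    then have "s * ((real N / p) * (1 - (real (Suc n))\<^sup>2 / real N)) \<le> s * (1 - (real n)\<^sup>2 / real N)"
      using IH by (intro mult_left_mono) auto
    ultimately show ?case unfolding e using IH by simp
  qed simp
  then show "1 \<le> t" "t * (1 - (real n)\<^sup>2 / real N) \<le> 1" by (auto simp: t_def)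
qed

text \<open>The normalizing factors of the Kravchuk and Hermite polynomials have relative distance \<open>O(n\<^sup>2 h\<^sup>2)\<close>.\<close>

lemma kravchuk_normalization:
  assumes "0 < m" "n\<^sup>2 \<le> m"
  defines "h \<equiv> step (2 * m)"
  defines "\<gamma> \<equiv> 1 / (2 powr (real n / 2) * sqrt (fact n))"
  shows "\<bar>1 / h ^ n * sqrt (fact (2 * m - n) / (fact (2 * m) * fact n)) - \<gamma>\<bar> \<le> (real n)\<^sup>2 * h\<^sup>2 * \<gamma>"
proof -
  define N where "N = 2 * m"
  define t where "t = real N ^ n * fact (N - n) / (fact N :: real)"
  have nm: "n \<le> m" using assms(2) by (metis le_trans power2_nat_le_imp_le le_square power2_eq_square)
  then have t: "1 \<le> t" "t * (1 - (real n)\<^sup>2 / real N) \<le> 1"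
    using falling_factorial_ratio[of n N] assms(1) by (auto simp: N_def t_def)
  have m: "real m > 0" using assms by simp
  have h2: "h\<^sup>2 = 1 / real m" using assms by (simp add: h_def step_even power_divide)
  define x where "x = (real n)\<^sup>2 / real N"
  have x: "0 \<le> x" "x \<le> 1/2" "2 * x = (real n)\<^sup>2 * h\<^sup>2"
  proof -
    have "(real n)\<^sup>2 \<le> real m" using of_nat_mono[OF assms(2), where ?'a = real] by simp
    then show "0 \<le> x" "x \<le> 1/2" "2 * x = (real n)\<^sup>2 * h\<^sup>2" using m by (auto simp: x_def N_def h2 field_simps)
  qed
  have t2: "t \<le> 1 + 2 * x"
  proof -
    have "1 \<le> (1 + 2 * x) * (1 - x)" using x(1,2) mult_nonneg_nonneg[of x "1 - 2 * x"]
      by (simp add: algebra_simps)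
    then have "t * (1 - x) \<le> (1 + 2 * x) * (1 - x)" using t(2) by (simp add: x_def)
    then show ?thesis using x by simp
  qed
  have q: "1 \<le> sqrt t" "sqrt t \<le> 1 + 2 * x"
  proof -
    show "1 \<le> sqrt t" using t by simp
    have "1 + 2 * x \<le> (1 + 2 * x)\<^sup>2" using x(1) by (intro self_le_power) auto
    then show "sqrt t \<le> 1 + 2 * x" using t2 x by (intro real_le_lsqrt) auto
  qed
  have \<gamma>: "\<gamma> > 0" by (simp add: \<gamma>_def)
  have "1 / h ^ n * sqrt (fact (2 * m - n) / (fact (2 * m) * fact n)) = \<gamma> * sqrt t"
  proof -
    have "1 / h ^ n = sqrt (real m) ^ n" using m by (simp add: h_def step_even power_divide)
    also have "\<dots> = sqrt (real m ^ n)" by (simp add: real_sqrt_power)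
    finally have 1: "1 / h ^ n = sqrt (real m ^ n)" .
    have "2 powr (real n / 2) = sqrt (2 ^ n)"
      by (simp add: powr_half_sqrt[symmetric] powr_realpow[symmetric] powr_powr)
    then have 2: "\<gamma> = sqrt (1 / (2 ^ n * fact n))" by (simp add: \<gamma>_def real_sqrt_mult real_sqrt_divide)
    have "real m ^ n * (fact (2 * m - n) / (fact (2 * m) * fact n)) = 1 / (2 ^ n * fact n) * t"
      by (simp add: t_def N_def power_mult_distrib)
    then show ?thesis unfolding 1 2 real_sqrt_mult[symmetric] by simp
  qed
  then have "1 / h ^ n * sqrt (fact (2 * m - n) / (fact (2 * m) * fact n)) - \<gamma> = \<gamma> * (sqrt t - 1)"
    by (simp add: algebra_simps)
  then have "\<bar>1 / h ^ n * sqrt (fact (2 * m - n) / (fact (2 * m) * fact n)) - \<gamma>\<bar> = \<gamma> * (sqrt t - 1)"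
    using q \<gamma> by simp
  also have "\<dots> \<le> \<gamma> * (2 * x)" using q \<gamma> by (intro mult_left_mono) auto
  finally show ?thesis using x(3) by (simp add: mult.commute)
qed

lemma kravchuk_fun_vs_hermite_fun:
  fixes j :: int
  assumes "0 < m" "n\<^sup>2 \<le> m"
  defines "h \<equiv> step (2 * m)"
  defines "a \<equiv> h * of_int j"
  shows "\<bar>kravchuk_fun (2 * m) n a - hermite_fun n a\<bar> \<le> 16 * h\<^sup>2 * exp (3 * real n) * ((1 + a\<^sup>2)\<^sup>2 * exp (- a\<^sup>2 / 8))"
proof -
  define \<gamma> where "\<gamma> = 1 / (2 powr (real n / 2) * sqrt (fact n))"
  define \<alpha> where "\<alpha> = 1 / h ^ n * sqrt (fact (2 * m - n) / (fact (2 * m) * fact n))"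
  define r where "r = sqrt (rho (2 * m) a)"
  define g where "g = exp (- a\<^sup>2 / 2) / pi powr (1/4)"
  define e where "e = exp (- a\<^sup>2 / 4)"
  define J where "J = (1 + a\<^sup>2)\<^sup>2"
  define k where "k = kravchuk h n a"
  define H where "H = hermite n a"
  define B where "B = growth n a"
  have h2: "h\<^sup>2 = 1 / real m" using assms by (simp add: h_def step_even power_divide)
  have nm: "n \<le> m" using assms(2) by (metis le_trans power2_nat_le_imp_le le_square power2_eq_square)
  then have hn: "h\<^sup>2 * real n \<le> 2" using assms(1) unfolding h2 by (simp add: field_simps)
  have \<gamma>: "\<gamma> \<ge> 0" by (simp add: \<gamma>_def)
  have r: "0 \<le> r" "r \<le> e" "\<bar>r - g\<bar> \<le> 4 * h\<^sup>2 * J * e"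
    using sqrt_rho_vs_gauss[OF assms(1), of j] by (auto simp: r_def e_def g_def J_def h_def a_def)
  have J: "J \<ge> 1" by (simp add: J_def)
  have e: "e > 0" by (simp add: e_def)
  have B: "0 \<le> B" "\<bar>k\<bar> \<le> B" "\<bar>H\<bar> \<le> B" "\<bar>k - H\<bar> \<le> h\<^sup>2 * (real n)\<^sup>2 * B"
    unfolding B_def k_def H_def using growth_nonneg kravchuk_bound[OF hn] hermite_bound
      kravchuk_minus_hermite[OF hn] by auto
  have \<alpha>: "\<bar>\<alpha> - \<gamma>\<bar> \<le> (real n)\<^sup>2 * h\<^sup>2 * \<gamma>"
    using kravchuk_normalization[OF assms(1,2)] by (simp add: \<alpha>_def \<gamma>_def h_def)
  have "kravchuk_fun (2 * m) n a - hermite_fun n a = \<alpha> * k * r - \<gamma> * H * g"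
    by (simp add: kravchuk_fun_def hermite_fun_def \<alpha>_def \<gamma>_def k_def H_def r_def g_def h_def mult_ac)
  also have "\<dots> = (\<alpha> - \<gamma>) * (k * r) + \<gamma> * ((k - H) * r) + \<gamma> * (H * (r - g))"
    by (simp add: algebra_simps)
  finally have "\<bar>kravchuk_fun (2 * m) n a - hermite_fun n a\<bar>
      \<le> \<bar>\<alpha> - \<gamma>\<bar> * (\<bar>k\<bar> * \<bar>r\<bar>) + \<gamma> * (\<bar>k - H\<bar> * \<bar>r\<bar>) + \<gamma> * (\<bar>H\<bar> * \<bar>r - g\<bar>)"
    using \<gamma> abs_triangle_ineq[of "(\<alpha> - \<gamma>) * (k * r) + \<gamma> * ((k - H) * r)" "\<gamma> * (H * (r - g))"]
      abs_triangle_ineq[of "(\<alpha> - \<gamma>) * (k * r)" "\<gamma> * ((k - H) * r)"]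
    by (simp add: abs_mult)
  also have "\<dots> \<le> ((real n)\<^sup>2 * h\<^sup>2 * \<gamma>) * (B * e) + \<gamma> * ((h\<^sup>2 * (real n)\<^sup>2 * B) * e) + \<gamma> * (B * (4 * h\<^sup>2 * J * e))"
    using \<gamma> r B \<alpha> e by (intro add_mono mult_mono mult_left_mono) auto
  also have "\<dots> = h\<^sup>2 * (\<gamma> * B) * e * ((real n)\<^sup>2 * 2 + 4 * J)" by (simp add: algebra_simps)
  also have "\<dots> \<le> h\<^sup>2 * (\<gamma> * B) * e * (((real n)\<^sup>2 * 2 + 4) * J)"
    using \<gamma> B e J mult_left_mono[OF J, of "(real n)\<^sup>2 * 2"] by (intro mult_left_mono) (auto simp: distrib_right)
  also have "\<dots> = h\<^sup>2 * e * J * (((real n)\<^sup>2 * 2 + 4) * (\<gamma> * B))" by (simp add: algebra_simps)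
  \<comment> \<open>The polynomial factor costs \<open>exp n\<close>, and \<open>3 ^ n\<close> costs \<open>exp (3 n / 2)\<close>.\<close>
  also have "\<dots> \<le> h\<^sup>2 * e * J * ((16 * exp (real n)) * ((exp (3 / 2 * real n) * exp (real n / 2)) * exp (a\<^sup>2 / 8)))"
  proof -
    have "\<gamma> * B \<le> 3 ^ n * exp (real n / 2) * exp (a\<^sup>2 / 8)"
      using growth_normalized[of n a] by (simp add: \<gamma>_def B_def)
    also have "\<dots> \<le> exp (3 / 2 * real n) * exp (real n / 2) * exp (a\<^sup>2 / 8)"
    proof -
      have "3 \<le> (1 + 1/2 :: real) ^ 3" by (simp add: power3_eq_cube)
      also have "\<dots> \<le> exp (1/2) ^ 3" using exp_ge_add_one_self[of "1/2"] by (intro power_mono) auto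
      also have "\<dots> = exp (3/2 :: real)" by (simp add: exp_of_nat_mult[symmetric])
      finally have "3 ^ n \<le> exp (3/2 :: real) ^ n" by (intro power_mono) auto
      also have "\<dots> = exp (3 / 2 * real n)" by (simp add: exp_of_nat_mult[symmetric] mult.commute)
      finally show ?thesis by (intro mult_right_mono) auto
    qed
    finally have 1: "\<gamma> * B \<le> (exp (3 / 2 * real n) * exp (real n / 2)) * exp (a\<^sup>2 / 8)" .
    have "(1 + real n / 2)\<^sup>2 \<le> exp (real n / 2) ^ 2"
      using exp_ge_add_one_self[of "real n / 2"] by (intro power_mono) auto
    also have "\<dots> = exp (real n)" by (simp add: power2_eq_square exp_add[symmetric])
    finally have "1 + real n + (real n)\<^sup>2 / 4 \<le> exp (real n)"
      by (simp add: power2_eq_square algebra_simps)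
    moreover have "0 \<le> (real n)\<^sup>2" by simp
    ultimately have 2: "(real n)\<^sup>2 * 2 + 4 \<le> 16 * exp (real n)"
      using of_nat_0_le_iff[of n] by linarith
    show ?thesis using \<gamma> B(1) J e by (intro mult_left_mono[OF mult_mono[OF 2 1]]) auto
  qed
  also have "\<dots> = 16 * h\<^sup>2 * (exp (real n) * exp (3 / 2 * real n) * exp (real n / 2)) * (J * (e * exp (a\<^sup>2 / 8)))"
    by (simp only: ac_simps)
  also have "exp (real n) * exp (3 / 2 * real n) * exp (real n / 2) = exp (3 * real n)"
    by (simp add: exp_add[symmetric])
  also have "e * exp (a\<^sup>2 / 8) = exp (- a\<^sup>2 / 8)" by (simp add: e_def exp_add[symmetric])
  finally show ?thesis by (simp add: J_def)
qed

section \<open>Summation over the grid\<close>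

text \<open>A uniform bound on finite sums gives both square summability and the bound of the norm.\<close>

lemma ell2I:
  assumes h: "0 < h" and B: "0 \<le> B"
    and bd: "\<And>F. finite F \<Longrightarrow> F \<subseteq> grid h \<Longrightarrow> h * (\<Sum>a\<in>F. (cmod (u a))\<^sup>2) \<le> B\<^sup>2"
  shows "u \<in> ell2 h \<and> ell2_norm h u \<le> B"
proof -
  have le: "(\<Sum>a\<in>F. (cmod (u a))\<^sup>2) \<le> B\<^sup>2 / h" if "finite F" "F \<subseteq> grid h" for F
    using bd[OF that] h by (simp add: field_simps)
  have sm: "(\<lambda>a. (cmod (u a))\<^sup>2) summable_on grid h"
    by (rule nonneg_bdd_above_summable_on) (auto simp: bdd_above_def intro!: exI[of _ "B\<^sup>2 / h"] le)
  have "h * (\<Sum>\<^sub>\<infinity>a\<in>grid h. (cmod (u a))\<^sup>2) \<le> B\<^sup>2"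
    using infsum_le_finite_sums[OF sm le] h by (simp add: field_simps)
  then have "ell2_norm h u \<le> B" unfolding ell2_norm_def using B by (simp add: real_le_lsqrt)
  then show ?thesis using sm by (simp add: ell2_def)
qed

text \<open>The sum is compared with the integral of \<open>1 / (1 + x\<^sup>2)\<close> through increments of the arctangent.\<close>

lemma grid_cauchy_sum:
  assumes "0 < h" "h \<le> 1" "finite F" "F \<subseteq> grid h"
  shows "h * (\<Sum>a\<in>F. 1 / (1 + a\<^sup>2)) \<le> 9"
proof -
  define f where "f = (\<lambda>j::int. h / (1 + (h * of_int j)\<^sup>2))"
  have stp: "f (int n + 1) \<le> arctan (h * (real n + 1)) - arctan (h * real n)" for n
  proof -
    have lt: "h * real n < h * (real n + 1)" using assms(1) by simp
    obtain z where z: "h * real n < z" "z < h * (real n + 1)"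
      "arctan (h * (real n + 1)) - arctan (h * real n) = (h * (real n + 1) - h * real n) * inverse (1 + z\<^sup>2)"
      using MVT2[OF lt, of arctan "\<lambda>z. inverse (1 + z\<^sup>2)"] DERIV_arctan by blast
    have "0 \<le> z" using z(1) assms(1) by (smt (verit) mult_nonneg_nonneg of_nat_0_le_iff)
    then have "z\<^sup>2 \<le> (h * (real n + 1))\<^sup>2" using z(2) by (intro power_mono) auto
    then have "h / (1 + (h * (real n + 1))\<^sup>2) \<le> h / (1 + z\<^sup>2)"
      using assms(1) by (intro divide_left_mono) (auto intro!: mult_pos_pos add_pos_nonneg)
    moreover have "f (int n + 1) = h / (1 + (h * (real n + 1))\<^sup>2)" by (simp add: f_def)
    moreover have "(h * (real n + 1) - h * real n) * inverse (1 + z\<^sup>2) = h / (1 + z\<^sup>2)"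
      by (simp add: algebra_simps divide_inverse)
    ultimately show ?thesis unfolding z(3) by (simp only:)
  qed
  have S: "sum f {- int n..int n} \<le> h + 2 * arctan (h * real n)" for n
  proof (induction n)
    case 0 then show ?case by (simp add: f_def)
  next
    case (Suc n)
    have "{- int (Suc n)..int (Suc n)} = insert (int n + 1) (insert (- (int n + 1)) {- int n..int n})" by auto
    then have "sum f {- int (Suc n)..int (Suc n)} = f (int n + 1) + (f (- (int n + 1)) + sum f {- int n..int n})"
      by (simp add: sum.insert)
    moreover have "f (- (int n + 1)) = f (int n + 1)" by (simp add: f_def power2_eq_square algebra_simps)
    ultimately show ?case using Suc stp[of n] by (simp add: add.commute)
  qed
  have inj: "inj_on (\<lambda>j::int. h * of_int j) A" for A using assms(1) by (auto simp: inj_on_def)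
  obtain J where J: "F = (\<lambda>j::int. h * of_int j) ` J" "finite J"
    using assms(3,4) inj unfolding grid_def by (metis finite_imageD subset_imageE)
  obtain n where n: "J \<subseteq> {- int n..int n}"
  proof -
    obtain b where b: "\<forall>j\<in>J. \<bar>j\<bar> \<le> b" using J(2) by (metis finite_imageI finite_nat_iff_bounded_le Max_ge image_eqI)
    have "J \<subseteq> {- int (nat b)..int (nat b)}" using b by force
    then show ?thesis by (rule that)
  qed
  have "h * (\<Sum>a\<in>F. 1 / (1 + a\<^sup>2)) = sum f J"
    unfolding J(1) by (subst sum.reindex[OF inj]) (simp add: sum_distrib_left f_def)
  also have "\<dots> \<le> sum f {- int n..int n}"
    using assms(1) by (intro sum_mono2 n) (auto simp: f_def intro!: divide_nonneg_nonneg)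
  also have "\<dots> \<le> h + 2 * arctan (h * real n)" by (rule S)
  also have "\<dots> \<le> 9" using arctan_ubound[of "h * real n"] assms(2) pi_less_4 by linarith
  finally show ?thesis .
qed

lemma ell2_of_decay:
  assumes "0 < h" "h \<le> 1" "0 \<le> K" and u: "\<And>a. a \<in> grid h \<Longrightarrow> cmod (u a) \<le> K / (1 + a\<^sup>2)"
  shows "u \<in> ell2 h \<and> ell2_norm h u \<le> 3 * K"
proof (rule ell2I)
  fix F assume F: "finite F" "F \<subseteq> grid h"
  have "(cmod (u a))\<^sup>2 \<le> K\<^sup>2 * (1 / (1 + a\<^sup>2))" if "a \<in> F" for a
  proof -
    have "(cmod (u a))\<^sup>2 \<le> (K / (1 + a\<^sup>2))\<^sup>2" using u that F by (intro power_mono) auto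
    also have "\<dots> = K\<^sup>2 / ((1 + a\<^sup>2) * (1 + a\<^sup>2))" by (simp add: power2_eq_square)
    also have "\<dots> \<le> K\<^sup>2 / ((1 + a\<^sup>2) * 1)"
      by (intro divide_left_mono mult_left_mono mult_pos_pos add_pos_nonneg) auto
    finally show ?thesis by simp
  qed
  then have "h * (\<Sum>a\<in>F. (cmod (u a))\<^sup>2) \<le> h * (\<Sum>a\<in>F. K\<^sup>2 * (1 / (1 + a\<^sup>2)))"
    using assms(1) by (intro mult_left_mono sum_mono) auto
  also have "\<dots> = K\<^sup>2 * (h * (\<Sum>a\<in>F. 1 / (1 + a\<^sup>2)))" by (simp add: sum_distrib_left algebra_simps)
  also have "\<dots> \<le> K\<^sup>2 * 9" using grid_cauchy_sum[OF assms(1,2) F] by (intro mult_left_mono) auto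
  finally show "h * (\<Sum>a\<in>F. (cmod (u a))\<^sup>2) \<le> (3 * K)\<^sup>2" by (simp add: power_mult_distrib)
qed (use assms in auto)

lemma weight_absorbed:
  assumes "0 \<le> \<sigma>"
  shows "\<exists>K\<ge>0. \<forall>a. jap a powr \<sigma> * ((1 + a\<^sup>2)\<^sup>2 * exp (- a\<^sup>2 / 8)) \<le> K / (1 + a\<^sup>2)"
proof -
  define p where "p = \<sigma> / 2 + 3"
  \<comment> \<open>With this scale, \<open>ln (y / c) \<le> y / c - 1\<close> turns \<open>y powr p\<close> into at most a multiple of \<open>exp (y / 8)\<close>.\<close>
  define c where "c = 8 * p"
  define K where "K = exp (p * ln c) * exp (1/8)"
  have p: "p > 0" "c > 0" using assms by (auto simp: p_def c_def)
  have "jap a powr \<sigma> * ((1 + a\<^sup>2)\<^sup>2 * exp (- a\<^sup>2 / 8)) \<le> K / (1 + a\<^sup>2)" for a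
  proof -
    define y where "y = 1 + a\<^sup>2"
    have y: "y \<ge> 1" by (simp add: y_def)
    have "ln (y / c) \<le> y / c - 1" using y p by (intro ln_le_minus_one) auto
    then have "ln y \<le> y / c + ln c" using y p by (simp add: ln_div)
    then have "p * ln y \<le> p * (y / c + ln c)" using p by (intro mult_left_mono) auto
    also have "\<dots> = y / 8 + p * ln c" using p by (simp add: c_def algebra_simps)
    finally have "exp (p * ln y) \<le> exp (y / 8 + p * ln c)" by simp
    then have "y powr p \<le> exp (p * ln c) * exp (y / 8)" using y by (simp add: powr_def exp_add mult.commute)
    then have "y powr p * exp (- a\<^sup>2 / 8) \<le> exp (p * ln c) * exp (y / 8) * exp (- a\<^sup>2 / 8)"
      by (intro mult_right_mono) auto
    also have "\<dots> = K" by (simp add: K_def y_def exp_add[symmetric] add_divide_distrib)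
    finally have 1: "y powr p * exp (- a\<^sup>2 / 8) \<le> K" .
    have "jap a powr \<sigma> = y powr (\<sigma> / 2)"
      using y by (simp add: jap_def y_def[symmetric] powr_half_sqrt[symmetric] powr_powr)
    moreover have "y powr p = y powr (\<sigma> / 2) * y ^ 3"
      using y by (simp add: p_def powr_add)
    ultimately have "y * (jap a powr \<sigma> * (y\<^sup>2 * exp (- a\<^sup>2 / 8))) \<le> K"
      using 1 by (simp add: power2_eq_square power3_eq_cube mult_ac)
    then show ?thesis using y unfolding y_def[symmetric] by (simp add: field_simps)
  qed
  moreover have "K \<ge> 0" by (simp add: K_def)
  ultimately show ?thesis by blast
qed

section \<open>Continuous representatives\<close>

lemma continuous_AE_eq:
  fixes F G :: "real \<Rightarrow> complex"
  assumes "continuous_on UNIV F" "continuous_on UNIV G" "AE x in lebesgue. F x = G x"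
  shows "F = G"
proof (rule ccontr)
  assume "F \<noteq> G"
  then have ne: "{x. F x \<noteq> G x} \<noteq> {}" by auto
  have op: "open {x. F x \<noteq> G x}" using assms(1,2) by (intro open_Collect_neq) auto
  then have "{x. F x \<noteq> G x} \<in> sets lebesgue" by auto
  then have "{x. F x \<noteq> G x} \<in> null_sets lebesgue" using assms(3) by (subst AE_iff_null_sets) auto
  then have "negligible {x. F x \<noteq> G x}" by (simp add: negligible_iff_null_sets)
  then show False using op open_not_negligible ne by blast
qed

lemma cont_rep_eq:
  assumes "continuous_on UNIV G" "AE x in lebesgue. f x = G x"
  shows "cont_rep f = G"
  unfolding cont_rep_def
proof (rule the_equality)
  show "continuous_on UNIV G \<and> (AE x in lebesgue. f x = G x)" using assms by simp
next
  fix g assume g: "continuous_on UNIV g \<and> (AE x in lebesgue. f x = g x)"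
  have "AE x in lebesgue. g x = G x" using assms(2) conjunct2[OF g] by eventually_elim auto
  then show "g = G" using continuous_AE_eq assms(1) g by blast
qed

lemma continuous_on_hermite_fun: "continuous_on UNIV (hermite_fun n)"
proof -
  have "continuous_on UNIV (hermite n)"
  proof (induction n rule: induct_nat_012)
    case (ge2 n)
    have "hermite (Suc (Suc n)) = (\<lambda>x. 2 * x * hermite (Suc n) x - 2 * real (Suc n) * hermite n x)" by auto
    then show ?case using ge2 by (auto intro!: continuous_intros)
  next
    case 0 then show ?case by (simp add: fun_eq_iff[symmetric] continuous_on_const)
  next
    case 1
    have "hermite 1 = (\<lambda>x. 2 * x)" by auto
    then show ?case by (auto intro!: continuous_intros)
  qed
  then show ?thesis unfolding hermite_fun_def by (intro continuous_intros) auto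
qed

lemma grid_proj_hermite_fun:
  assumes "a \<in> grid h"
  shows "grid_proj h (\<lambda>x. complex_of_real (hermite_fun n x)) a = complex_of_real (hermite_fun n a)"
proof -
  have "cont_rep (\<lambda>x. complex_of_real (hermite_fun n x)) = (\<lambda>x. complex_of_real (hermite_fun n x))"
    by (rule cont_rep_eq) (auto intro!: continuous_intros continuous_on_hermite_fun)
  then show ?thesis using assms by (simp add: grid_proj_def)
qed

section \<open>Asymptotics of the Kravchuk functions\<close>

lemma kravchuk_asymptotics:
  assumes "0 < \<delta>" "\<delta> < 1" "0 \<le> \<sigma>"
  shows "\<exists>C::real. \<forall>N. 0 < N \<and> even N \<longrightarrow>
              (\<lambda>a. complex_of_real
                     (jap a powr \<sigma> * (rho N a - 1 / sqrt pi * exp (- a\<^sup>2)))) \<in> ell2 (step N)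
            \<and> ell2_norm (step N)
                 (\<lambda>a. complex_of_real
                        (jap a powr \<sigma> * (rho N a - 1 / sqrt pi * exp (- a\<^sup>2))))
               \<le> C * step N powr (2 - \<delta>)
            \<and> (\<forall>n::nat. real n \<le> 1/3 * \<delta> * \<bar>ln (step N)\<bar> \<longrightarrow>
                 (\<lambda>a. complex_of_real (jap a powr \<sigma>)
                        * (complex_of_real (kravchuk_fun N n a)
                           - grid_proj (step N) (\<lambda>x. complex_of_real (hermite_fun n x)) a))
                   \<in> ell2 (step N)
               \<and> ell2_norm (step N)
                   (\<lambda>a. complex_of_real (jap a powr \<sigma>)
                          * (complex_of_real (kravchuk_fun N n a)
                             - grid_proj (step N) (\<lambda>x. complex_of_real (hermite_fun n x)) a))
                 \<le> C * step N powr (2 - \<delta>))"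
proof -
  obtain K where K: "K \<ge> 0" "\<And>a. jap a powr \<sigma> * ((1 + a\<^sup>2)\<^sup>2 * exp (- a\<^sup>2 / 8)) \<le> K / (1 + a\<^sup>2)"
    using weight_absorbed[OF assms(3)] by blast
  show ?thesis
  proof (intro exI[of _ "3 * (16 * K)"] allI impI)
    fix N :: nat assume "0 < N \<and> even N"
    then obtain m where m: "N = 2 * m" "0 < m" by auto
    define h where "h = step N"
    have hm: "h = 1 / sqrt (real m)" using m step_even by (simp add: h_def)
    have h: "0 < h" "h \<le> 1" using m by (auto simp: hm)
    have lnh: "ln h \<le> 0" using h by simp
    have h2: "h\<^sup>2 \<le> h powr (2 - \<delta>)"
    proof -
      have "h powr 2 \<le> h powr (2 - \<delta>)" using h assms by (intro powr_mono') auto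
      then show ?thesis using h by simp
    qed
    have scale: "cmod (complex_of_real (jap a powr \<sigma> * z)) \<le> (16 * K * A) / (1 + a\<^sup>2)"
      if "\<bar>z\<bar> \<le> 16 * A * ((1 + a\<^sup>2)\<^sup>2 * exp (- a\<^sup>2 / 8))" "A \<ge> 0" for a z A
    proof -
      have "cmod (complex_of_real (jap a powr \<sigma> * z)) = jap a powr \<sigma> * \<bar>z\<bar>"
        unfolding norm_of_real by (simp add: abs_mult)
      also have "\<dots> \<le> jap a powr \<sigma> * (16 * A * ((1 + a\<^sup>2)\<^sup>2 * exp (- a\<^sup>2 / 8)))"
        using that by (intro mult_left_mono) auto
      also have "\<dots> = (16 * A) * (jap a powr \<sigma> * ((1 + a\<^sup>2)\<^sup>2 * exp (- a\<^sup>2 / 8)))" by (simp only: ac_simps)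
      also have "\<dots> \<le> (16 * A) * (K / (1 + a\<^sup>2))" using that K by (intro mult_left_mono) auto
      finally show ?thesis by (simp add: mult_ac)
    qed
    have concl: "u \<in> ell2 h \<and> ell2_norm h u \<le> 3 * (16 * K) * h powr (2 - \<delta>)"
      if u: "\<And>j::int. cmod (u (h * of_int j)) \<le> (16 * K * A) / (1 + (h * of_int j)\<^sup>2)"
        and A: "0 \<le> A" "A \<le> h powr (2 - \<delta>)" for u A
    proof -
      have "u \<in> ell2 h \<and> ell2_norm h u \<le> 3 * (16 * K * A)"
        using u A K by (intro ell2_of_decay[OF h]) (auto simp: grid_def)
      moreover have "3 * (16 * K * A) \<le> 3 * (16 * K) * h powr (2 - \<delta>)"
        using mult_left_mono[OF A(2), of "3 * (16 * K)"] K(1) by simp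
      ultimately show ?thesis by linarith
    qed
    have g1: "(\<lambda>a. complex_of_real (jap a powr \<sigma> * (rho N a - 1 / sqrt pi * exp (- a\<^sup>2)))) \<in> ell2 h
      \<and> ell2_norm h (\<lambda>a. complex_of_real (jap a powr \<sigma> * (rho N a - 1 / sqrt pi * exp (- a\<^sup>2))))
        \<le> 3 * (16 * K) * h powr (2 - \<delta>)"
    proof (rule concl[where A = "h\<^sup>2"])
      fix j :: int
      define a where "a = h * of_int j"
      define r where "r = sqrt (rho N a)"
      define g where "g = exp (- a\<^sup>2 / 2) / pi powr (1/4)"
      define e where "e = exp (- a\<^sup>2 / 4)"
      have R: "0 \<le> rho N a" "r \<le> e" "\<bar>r - g\<bar> \<le> 4 * h\<^sup>2 * (1 + a\<^sup>2)\<^sup>2 * e"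
        using sqrt_rho_vs_gauss[OF m(2), of j] by (auto simp: a_def h_def m(1) r_def g_def e_def)
      have r0: "0 \<le> r" using R by (simp add: r_def)
      have g: "0 \<le> g" "g \<le> 1"
      proof -
        have "pi powr (1/4) \<ge> 1" using pi_gt3 by (intro ge_one_powr_ge_zero) auto
        moreover have "exp (- a\<^sup>2 / 2) \<le> 1" by simp
        ultimately have "exp (- a\<^sup>2 / 2) \<le> 1 * pi powr (1/4)" by linarith
        then show "g \<le> 1" unfolding g_def using pi_gt_zero by (subst pos_divide_le_eq) auto
      qed (simp add: g_def)
      have e: "e \<le> 1" "e > 0" "e \<le> exp (- a\<^sup>2 / 8)" by (auto simp: e_def)
      have "g\<^sup>2 = 1 / sqrt pi * exp (- a\<^sup>2)"
      proof -
        have "(pi powr (1/4))\<^sup>2 = sqrt pi"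
          by (simp add: powr_half_sqrt[symmetric] powr_powr powr_power)
        moreover have "(exp (- a\<^sup>2 / 2))\<^sup>2 = exp (- a\<^sup>2)" by (simp add: power2_eq_square exp_add[symmetric])
        ultimately show ?thesis by (simp add: g_def power_divide)
      qed
      moreover have "rho N a = r\<^sup>2" using R by (simp add: r_def)
      ultimately have "rho N a - 1 / sqrt pi * exp (- a\<^sup>2) = r\<^sup>2 - g\<^sup>2" by simp
      also have "\<dots> = (r - g) * (r + g)" by (simp add: power2_eq_square algebra_simps)
      finally have "\<bar>rho N a - 1 / sqrt pi * exp (- a\<^sup>2)\<bar> = \<bar>r - g\<bar> * (r + g)"
        using r0 g by (simp add: abs_mult)
      also have "\<dots> \<le> (4 * h\<^sup>2 * (1 + a\<^sup>2)\<^sup>2 * e) * 2"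
        using R r0 g e by (intro mult_mono) auto
      also have "\<dots> = 8 * h\<^sup>2 * (1 + a\<^sup>2)\<^sup>2 * e" by simp
      also have "\<dots> \<le> 16 * h\<^sup>2 * (1 + a\<^sup>2)\<^sup>2 * exp (- a\<^sup>2 / 8)"
        using e by (intro mult_mono) auto
      finally have "\<bar>rho N a - 1 / sqrt pi * exp (- a\<^sup>2)\<bar> \<le> 16 * h\<^sup>2 * ((1 + a\<^sup>2)\<^sup>2 * exp (- a\<^sup>2 / 8))"
        by (simp add: mult.assoc)
      from scale[OF this] show "cmod (complex_of_real (jap (h * of_int j) powr \<sigma> * (rho N (h * of_int j)
        - 1 / sqrt pi * exp (- (h * of_int j)\<^sup>2))))
        \<le> 16 * K * h\<^sup>2 / (1 + (h * of_int j)\<^sup>2)" by (simp add: a_def)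
    qed (use h2 in auto)
    have g2: "(\<lambda>a. complex_of_real (jap a powr \<sigma>) * (complex_of_real (kravchuk_fun N n a)
           - grid_proj h (\<lambda>x. complex_of_real (hermite_fun n x)) a)) \<in> ell2 h
      \<and> ell2_norm h (\<lambda>a. complex_of_real (jap a powr \<sigma>) * (complex_of_real (kravchuk_fun N n a)
           - grid_proj h (\<lambda>x. complex_of_real (hermite_fun n x)) a)) \<le> 3 * (16 * K) * h powr (2 - \<delta>)"
      if n: "real n \<le> 1/3 * \<delta> * \<bar>ln h\<bar>" for n
    proof (rule concl[where A = "h\<^sup>2 * exp (3 * real n)"])
      have nm: "n\<^sup>2 \<le> m"
      proof -
        have "\<bar>ln h\<bar> = ln (sqrt (real m))" using m h by (simp add: hm ln_div)
        also have "\<dots> \<le> sqrt (real m)" using m by (intro ln_bound) auto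
        finally have l: "\<bar>ln h\<bar> \<le> sqrt (real m)" .
        have "1/3 * \<delta> * \<bar>ln h\<bar> \<le> 1 * \<bar>ln h\<bar>" using assms by (intro mult_right_mono) auto
        then have "real n \<le> sqrt (real m)" using n l by linarith
        then have "(real n)\<^sup>2 \<le> (sqrt (real m))\<^sup>2" by (intro power_mono) auto
        then show ?thesis by (simp flip: of_nat_power)
      qed
      show "h\<^sup>2 * exp (3 * real n) \<le> h powr (2 - \<delta>)"
      proof -
        have "exp (3 * real n) \<le> exp (- \<delta> * ln h)" using n lnh by simp
        also have "\<dots> = h powr (- \<delta>)" using h by (simp add: powr_def)
        finally have "h\<^sup>2 * exp (3 * real n) \<le> h powr 2 * h powr (- \<delta>)"
          using h by (intro mult_mono) auto
        also have "\<dots> = h powr (2 - \<delta>)" by (simp flip: powr_add)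
        finally show ?thesis .
      qed
      fix j :: int
      define a where "a = h * of_int j"
      have ag: "a \<in> grid h" by (auto simp: a_def grid_def)
      have "\<bar>kravchuk_fun N n a - hermite_fun n a\<bar> \<le> 16 * (h\<^sup>2 * exp (3 * real n)) * ((1 + a\<^sup>2)\<^sup>2 * exp (- a\<^sup>2 / 8))"
        using kravchuk_fun_vs_hermite_fun[OF m(2) nm, of j] by (simp add: a_def h_def m(1) mult.assoc)
      from scale[OF this] show "cmod (complex_of_real (jap (h * of_int j) powr \<sigma>) * (complex_of_real
        (kravchuk_fun N n (h * of_int j))
           - grid_proj h (\<lambda>x. complex_of_real (hermite_fun n x)) (h * of_int j)))
        \<le> 16 * K * (h\<^sup>2 * exp (3 * real n)) / (1 + (h * of_int j)\<^sup>2)"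
        using grid_proj_hermite_fun[OF ag, of n] unfolding a_def[symmetric] by simp
    qed simp
    show "(\<lambda>a. complex_of_real (jap a powr \<sigma> * (rho N a - 1 / sqrt pi * exp (- a\<^sup>2)))) \<in> ell2 (step N)
      \<and> ell2_norm (step N) (\<lambda>a. complex_of_real (jap a powr \<sigma> * (rho N a - 1 / sqrt pi * exp (- a\<^sup>2))))
        \<le> 3 * (16 * K) * step N powr (2 - \<delta>)
      \<and> (\<forall>n::nat. real n \<le> 1/3 * \<delta> * \<bar>ln (step N)\<bar> \<longrightarrow>
        (\<lambda>a. complex_of_real (jap a powr \<sigma>) * (complex_of_real (kravchuk_fun N n a)
           - grid_proj (step N) (\<lambda>x. complex_of_real (hermite_fun n x)) a)) \<in> ell2 (step N)
      \<and> ell2_norm (step N) (\<lambda>a. complex_of_real (jap a powr \<sigma>) * (complex_of_real (kravchuk_fun N n a)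
           - grid_proj (step N) (\<lambda>x. complex_of_real (hermite_fun n x)) a)) \<le> 3 * (16 * K) * step N powr (2 - \<delta>))"
      using g1 g2 unfolding h_def by blast
  qed
qed

section \<open>Smooth functions and bump functions\<close>

text \<open>Infinite differentiability, in the form used in the definition of test functions.\<close>

definition smooth :: "(real \<Rightarrow> real) \<Rightarrow> bool" where
  "smooth p \<longleftrightarrow> (\<forall>k x. ((deriv ^^ k) p) field_differentiable (at x))"

text \<open>A convenient criterion: membership in a set of functions that is closed under differentiation.\<close>

lemma smooth_family:
  assumes S: "\<And>f. f \<in> S \<Longrightarrow> \<exists>g\<in>S. \<forall>x. (f has_field_derivative g x) (at x)" and f: "f \<in> S"
  shows "smooth f"
proof -
  have mem: "(deriv ^^ k) f \<in> S" for k
  proof (induction k)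
    case (Suc k)
    obtain g where g: "g \<in> S" "\<forall>x. ((deriv ^^ k) f has_field_derivative g x) (at x)" using S Suc by blast
    then have "deriv ((deriv ^^ k) f) = g" using DERIV_imp_deriv by blast
    then show ?case using g by simp
  qed (simp add: f)
  show ?thesis unfolding smooth_def
    using S[OF mem] field_differentiable_def by blast
qed

lemma smooth_deriv_has: "smooth p \<Longrightarrow> (((deriv ^^ k) p) has_field_derivative (deriv ^^ Suc k) p x) (at x)"
  by (simp add: smooth_def DERIV_deriv_iff_field_differentiable)

lemma smooth_has_deriv: "smooth p \<Longrightarrow> (p has_field_derivative deriv p x) (at x)"
  using smooth_deriv_has[of p 0 x] by simp

lemma smooth_deriv: "smooth p \<Longrightarrow> smooth (deriv p)"
  unfolding smooth_def by (metis comp_apply funpow_Suc_right)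

lemma smooth_antideriv:
  assumes "smooth p" "\<And>x. (q has_field_derivative p x) (at x)"
  shows "smooth q"
proof (rule smooth_family[of "insert q (range (\<lambda>k. (deriv ^^ k) p))"])
  fix f assume "f \<in> insert q (range (\<lambda>k. (deriv ^^ k) p))"
  then consider "f = q" | k where "f = (deriv ^^ k) p" by blast
  then show "\<exists>g\<in>insert q (range (\<lambda>k. (deriv ^^ k) p)). \<forall>x. (f has_field_derivative g x) (at x)"
  proof cases
    case 1
    then show ?thesis using assms(2) by (intro bexI[of _ "(deriv ^^ 0) p"] insertI2 rangeI) simp
  next
    case 2 then show ?thesis using smooth_deriv_has[OF assms(1)]
      by (intro bexI[of _ "(deriv ^^ Suc k) p"] insertI2 rangeI) simp
  qed
qed simp

lemma smooth_lincomb: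
  assumes "smooth p" "smooth q"
  shows "smooth (\<lambda>x. a * p x + b * q x)"
proof (rule smooth_family[of "{\<lambda>x. a * (deriv ^^ k) p x + b * (deriv ^^ k) q x |k. True}"])
  fix f assume "f \<in> {\<lambda>x. a * (deriv ^^ k) p x + b * (deriv ^^ k) q x |k. True}"
  then obtain k where f: "f = (\<lambda>x. a * (deriv ^^ k) p x + b * (deriv ^^ k) q x)" by blast
  have "(f has_field_derivative a * (deriv ^^ Suc k) p x + b * (deriv ^^ Suc k) q x) (at x)" for x
    unfolding f using smooth_deriv_has[OF assms(1), of k x] smooth_deriv_has[OF assms(2), of k x]
    by (auto intro!: derivative_eq_intros)
  then show "\<exists>g\<in>{\<lambda>x. a * (deriv ^^ k) p x + b * (deriv ^^ k) q x |k. True}. \<forall>x. (f has_field_derivative g x) (at x)"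
    by (intro bexI[of _ "\<lambda>x. a * (deriv ^^ Suc k) p x + b * (deriv ^^ Suc k) q x"]) blast+
next
  show "(\<lambda>x. a * p x + b * q x) \<in> {\<lambda>x. a * (deriv ^^ k) p x + b * (deriv ^^ k) q x |k. True}"
    by (intro CollectI exI[of _ 0]) simp
qed

lemma smooth_affine:
  assumes "smooth p"
  shows "smooth (\<lambda>x. p (c * x + d))"
proof (rule smooth_family[of "{\<lambda>x. c ^ k * (deriv ^^ k) p (c * x + d) |k. True}"])
  fix f assume "f \<in> {\<lambda>x. c ^ k * (deriv ^^ k) p (c * x + d) |k. True}"
  then obtain k where f: "f = (\<lambda>x. c ^ k * (deriv ^^ k) p (c * x + d))" by blast
  have "(f has_field_derivative c ^ Suc k * (deriv ^^ Suc k) p (c * x + d)) (at x)" for x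
  proof -
    have "((\<lambda>x. (deriv ^^ k) p (c * x + d)) has_field_derivative (deriv ^^ Suc k) p (c * x + d) * c) (at x)"
      by (rule DERIV_chain2[where f = "(deriv ^^ k) p" and g = "\<lambda>x. c * x + d"])
         (use smooth_deriv_has[OF assms, of k "c * x + d"] in \<open>auto intro!: derivative_eq_intros\<close>)
    then show ?thesis unfolding f by (auto intro!: derivative_eq_intros)
  qed
  then show "\<exists>g\<in>{\<lambda>x. c ^ k * (deriv ^^ k) p (c * x + d) |k. True}. \<forall>x. (f has_field_derivative g x) (at x)"
    by (intro bexI[of _ "\<lambda>x. c ^ Suc k * (deriv ^^ Suc k) p (c * x + d)"]) blast+
next
  show "(\<lambda>x. p (c * x + d)) \<in> {\<lambda>x. c ^ k * (deriv ^^ k) p (c * x + d) |k. True}"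
    by (intro CollectI exI[of _ 0]) simp
qed

lemma smooth_continuous: "smooth p \<Longrightarrow> continuous_on S p"
  by (meson DERIV_isCont continuous_at_imp_continuous_on smooth_has_deriv)

text \<open>The functions \<open>P (1 / x) exp (- 1 / x)\<close> for \<open>x > 0\<close>, extended by zero, with \<open>P\<close> a polynomial. They form a
  class closed under differentiation.\<close>

definition flat_exp :: "real poly \<Rightarrow> real \<Rightarrow> real" where
  "flat_exp P x = (if x > 0 then poly P (1 / x) * exp (- (1 / x)) else 0)"

lemma poly_times_exp_minus_tendsto_0: "((\<lambda>y. poly P y * exp (- y)) \<longlongrightarrow> 0) at_top" for P :: "real poly"
proof -
  have "((\<lambda>y. \<Sum>i\<le>degree P. coeff P i * (y ^ i / exp y)) \<longlongrightarrow> (\<Sum>i\<le>degree P. coeff P i * 0)) at_top"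
    by (intro tendsto_sum tendsto_mult tendsto_const tendsto_power_div_exp_0)
  moreover have "(\<lambda>y. \<Sum>i\<le>degree P. coeff P i * (y ^ i / exp y)) = (\<lambda>y. poly P y * exp (- y))"
    by (simp add: poly_altdef exp_minus sum_distrib_right divide_inverse mult.assoc)
  ultimately show ?thesis by simp
qed

lemma flat_exp_deriv:
  "(flat_exp P has_field_derivative flat_exp ([:0, 0, 1:] * (P - pderiv P)) x) (at x)"
proof -
  consider "x > 0" | "x < 0" | "x = 0" by linarith
  then show ?thesis
  proof cases
    case 1
    have "((\<lambda>x. poly P (1 / x) * exp (- (1 / x))) has_field_derivative flat_exp ([:0, 0, 1:] * (P
      - pderiv P)) x) (at x)"
      unfolding flat_exp_def using 1
      by (auto intro!: derivative_eq_intros DERIV_chain2[OF poly_DERIV] simp: field_simps power2_eq_square)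
    then show ?thesis
      by (rule DERIV_cong_ev[THEN iffD1, rotated 3])
         (use eventually_nhds_in_open[of "{0<..}" x] 1 in \<open>auto simp: flat_exp_def elim!: eventually_mono\<close>)
  next
    case 2
    have "((\<lambda>x. 0) has_field_derivative 0) (at x)" by simp
    then have "(flat_exp P has_field_derivative 0) (at x)"
      by (rule DERIV_cong_ev[THEN iffD1, rotated 3])
         (use eventually_nhds_in_open[of "{..<0}" x] 2 in \<open>auto simp: flat_exp_def elim!: eventually_mono\<close>)
    then show ?thesis using 2 by (simp add: flat_exp_def)
  next
    case 3
    have "((\<lambda>h. flat_exp P h / h) \<longlongrightarrow> 0) (at_right 0)"
    proof -
      have "((\<lambda>h. poly ([:0, 1:] * P) (inverse h) * exp (- inverse h)) \<longlongrightarrow> 0) (at_right 0)"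
        by (rule filterlim_compose[OF poly_times_exp_minus_tendsto_0 filterlim_inverse_at_top_right])
      moreover have "\<forall>\<^sub>F h in at_right 0. poly ([:0, 1:] * P) (inverse h) * exp (- inverse h) = flat_exp P h / h"
        by (auto simp: eventually_at_right_field flat_exp_def field_simps intro!: exI[of _ 1])
      ultimately show ?thesis by (simp add: tendsto_cong)
    qed
    moreover have "((\<lambda>h. flat_exp P h / h) \<longlongrightarrow> 0) (at_left 0)"
    proof -
      have "\<forall>\<^sub>F h in at_left 0. 0 = flat_exp P h / h"
        by (auto simp: eventually_at_left_field flat_exp_def intro!: exI[of _ "-1"])
      then show ?thesis by (rule Lim_transform_eventually[OF tendsto_const])
    qed
    ultimately have "((\<lambda>h. flat_exp P h / h) \<longlongrightarrow> 0) (at 0)" by (simp add: filterlim_at_split)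
    then show ?thesis using 3 by (simp add: has_field_derivative_iff flat_exp_def)
  qed
qed

text \<open>Sums of products of a function \<open>flat_exp P x\<close> and a reflected one \<open>flat_exp Q (1 - x)\<close>. The class
  contains a bump function supported in the unit interval and is closed under differentiation.\<close>

inductive_set bump_class :: "(real \<Rightarrow> real) set" where
  base: "(\<lambda>x. flat_exp P x * flat_exp Q (1 - x)) \<in> bump_class"
| add: "f \<in> bump_class \<Longrightarrow> g \<in> bump_class \<Longrightarrow> (\<lambda>x. f x + g x) \<in> bump_class"

lemma bump_class_deriv:
  "f \<in> bump_class \<Longrightarrow> \<exists>g\<in>bump_class. \<forall>x. (f has_field_derivative g x) (at x)"
proof (induction rule: bump_class.induct)
  case (base P Q)
  define D where "D = (\<lambda>P::real poly. [:0, 0, 1:] * (P - pderiv P))"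
  have "((\<lambda>x. flat_exp P x * flat_exp Q (1 - x)) has_field_derivative
      flat_exp (D P) x * flat_exp Q (1 - x) + flat_exp P x * flat_exp (- D Q) (1 - x)) (at x)" for x
  proof -
    have "((\<lambda>x. flat_exp Q (1 - x)) has_field_derivative flat_exp (D Q) (1 - x) * (- 1)) (at x)"
      unfolding D_def by (rule DERIV_chain2[OF flat_exp_deriv]) (auto intro!: derivative_eq_intros)
    moreover have "flat_exp (D Q) (1 - x) * (- 1) = flat_exp (- D Q) (1 - x)" by (simp add: flat_exp_def)
    ultimately have 1: "((\<lambda>x. flat_exp Q (1 - x)) has_field_derivative flat_exp (- D Q) (1 - x)) (at x)" by simp
    have "(flat_exp P has_field_derivative flat_exp (D P) x) (at x)"
      unfolding D_def by (rule flat_exp_deriv)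
    from DERIV_mult[OF this 1] show ?thesis by (simp add: mult.commute)
  qed
  moreover have "(\<lambda>x. flat_exp (D P) x * flat_exp Q (1 - x) + flat_exp P x * flat_exp (- D Q) (1 - x)) \<in> bump_class"
    by (intro bump_class.intros)
  ultimately show ?case
    by (intro bexI[of _ "\<lambda>x. flat_exp (D P) x * flat_exp Q (1 - x) + flat_exp P x * flat_exp (- D Q) (1 - x)"]) blast+
next
  case (add f g)
  then obtain f' g' where "f' \<in> bump_class" "g' \<in> bump_class"
    "\<forall>x. (f has_field_derivative f' x) (at x)" "\<forall>x. (g has_field_derivative g' x) (at x)" by blast
  then show ?case by (intro bexI[of _ "\<lambda>x. f' x + g' x"]) (auto intro: bump_class.add DERIV_add)
qed

lemma test_function_iff: "test_function p \<longleftrightarrow> smooth p \<and> (\<exists>R. \<forall>x. R \<le> \<bar>x\<bar> \<longrightarrow> p x = 0)"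
proof -
  have "compact (closure {x. p x \<noteq> 0}) \<longleftrightarrow> (\<exists>R. \<forall>x. R \<le> \<bar>x\<bar> \<longrightarrow> p x = 0)"
  proof
    assume "compact (closure {x. p x \<noteq> 0})"
    then have "bounded {x. p x \<noteq> 0}" by simp
    then obtain R where "\<forall>x\<in>{x. p x \<noteq> 0}. norm x \<le> R" by (auto simp: bounded_iff)
    then show "\<exists>R. \<forall>x. R \<le> \<bar>x\<bar> \<longrightarrow> p x = 0" by (intro exI[of _ "R + 1"]) force
  next
    assume "\<exists>R. \<forall>x. R \<le> \<bar>x\<bar> \<longrightarrow> p x = 0"
    then obtain R where "\<forall>x. R \<le> \<bar>x\<bar> \<longrightarrow> p x = 0" by blast
    then have "bounded {x. p x \<noteq> 0}" unfolding bounded_iff by (intro exI[of _ R]) force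
    then show "compact (closure {x. p x \<noteq> 0})" by simp
  qed
  then show ?thesis by (simp add: test_function_def smooth_def)
qed

lemma deriv_zero_outside:
  fixes p :: "real \<Rightarrow> real"
  assumes "\<And>x. R \<le> \<bar>x\<bar> \<Longrightarrow> p x = 0" "\<bar>R\<bar> < \<bar>x\<bar>"
  shows "deriv p x = 0"
proof -
  have "\<forall>\<^sub>F y in nhds x. y \<in> {y. \<bar>R\<bar> < \<bar>y\<bar>}"
    using assms(2) by (intro eventually_nhds_in_open open_Collect_less continuous_intros) auto
  then have "\<forall>\<^sub>F y in nhds x. p y = 0" by eventually_elim (auto intro: assms(1))
  then have "(p has_field_derivative 0) (at x)"
    using DERIV_cong_ev[of x x p "\<lambda>_. 0" 0 0] by auto
  then show ?thesis by (rule DERIV_imp_deriv)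
qed

lemma test_function_deriv:
  assumes "test_function p" shows "test_function (deriv p)"
proof -
  obtain R where R: "\<And>x. R \<le> \<bar>x\<bar> \<Longrightarrow> p x = 0" and sp: "smooth p"
    using assms unfolding test_function_iff by blast
  have "deriv p x = 0" if "\<bar>R\<bar> + 1 \<le> \<bar>x\<bar>" for x
    using that by (intro deriv_zero_outside[OF R]) auto
  then show ?thesis using smooth_deriv[OF sp] unfolding test_function_iff by blast
qed

lemma exists_bump: "\<exists>p. test_function p \<and> (\<forall>x. 0 \<le> p x) \<and> (\<forall>x. x \<le> 0 \<or> 1 \<le> x \<longrightarrow> p x = 0) \<and> (\<forall>x. 0 < x \<and> x < 1 \<longrightarrow> 0 < p x)"
proof -
  define p where "p = (\<lambda>x. flat_exp 1 x * flat_exp 1 (1 - x))"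
  have "smooth p" unfolding p_def
    by (rule smooth_family[of bump_class]) (use bump_class_deriv bump_class.base in auto)
  moreover have p: "\<forall>x. 0 \<le> p x" "\<forall>x. x \<le> 0 \<or> 1 \<le> x \<longrightarrow> p x = 0" "\<forall>x. 0 < x \<and> x < 1 \<longrightarrow> 0 < p x"
    by (auto simp: p_def flat_exp_def)
  moreover have "\<forall>x. 1 \<le> \<bar>x\<bar> \<longrightarrow> p x = 0" using p(2) by (auto simp: abs_if)
  ultimately show ?thesis unfolding test_function_iff by blast
qed

text \<open>A smooth function that vanishes on a half line \<open>{..A}\<close> has an antiderivative that
  vanishes there too.\<close>

lemma antiderivative_from_left:
  assumes "smooth p" "\<And>x. x \<le> A \<Longrightarrow> p x = 0"
  obtains q where "\<And>x. (q has_field_derivative p x) (at x)" "\<And>x. x \<le> A \<Longrightarrow> q x = 0" "smooth q"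
    "\<And>x. q x = integral {A..x} p"
proof -
  define q where "q = (\<lambda>x. integral {A - 1..x} p)"
  have cont: "continuous_on S p" for S using assms(1) smooth_continuous by blast
  have zero: "q x = 0" if "x \<le> A" for x
  proof -
    have "integral {A - 1..x} p = integral {A - 1..x} (\<lambda>x. 0)"
      using assms(2) that by (intro integral_cong) auto
    then show ?thesis by (simp add: q_def)
  qed
  have der: "(q has_field_derivative p x) (at x)" for x
  proof (cases "x < A")
    case True
    have "((\<lambda>x. 0) has_field_derivative 0) (at x)" by simp
    then have "(q has_field_derivative 0) (at x)"
      by (rule DERIV_cong_ev[THEN iffD1, rotated 3])
         (use eventually_nhds_in_open[of "{..<A}" x] True zero in \<open>auto elim!: eventually_mono\<close>)
    then show ?thesis using True assms(2) by simp
  next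
    case False
    have "(q has_field_derivative p x) (at x within {A - 1..x + 1})"
      unfolding q_def using False by (intro integral_has_real_derivative cont) auto
    then show ?thesis using False by (simp add: at_within_Icc_at)
  qed
  have "q x = integral {A..x} p" for x
  proof (cases "x \<le> A")
    case True
    have "integral {A..x} p = 0"
      using True by (cases "x = A") auto
    then show ?thesis using zero True by simp
  next
    case False
    have "integral {A - 1..A} p + integral {A..x} p = integral {A - 1..x} p"
      using False by (intro Henstock_Kurzweil_Integration.integral_combine integrable_continuous_real cont) auto
    then show ?thesis using zero[of A] unfolding q_def by simp
  qed
  then show ?thesis using that der zero smooth_antideriv[OF assms(1) der] by blast
qed

lemma exists_smooth_step:
  "\<exists>s. smooth s \<and> (\<forall>x\<le>0. s x = 0) \<and> (\<forall>x\<ge>1. s x = 1) \<and> (\<forall>x. 0 \<le> s x \<and> s x \<le> 1) \<and> test_function (deriv s)"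
proof -
  obtain p where p: "test_function p" "\<And>x. 0 \<le> p x" "\<And>x. x \<le> 0 \<or> 1 \<le> x \<Longrightarrow> p x = 0"
    "\<And>x. 0 < x \<and> x < 1 \<Longrightarrow> 0 < p x" using exists_bump by blast
  have sm: "smooth p" using p(1) test_function_iff by blast
  obtain q where q: "\<And>x. (q has_field_derivative p x) (at x)" "\<And>x. x \<le> 0 \<Longrightarrow> q x = 0" "smooth q"
    using antiderivative_from_left[OF sm, of 0] p(3) by metis
  have pos: "q 1 > 0"
  proof -
    have "q 0 < q 1"
      by (rule DERIV_pos_imp_increasing_open) (use q(1) p(4) smooth_continuous[OF q(3)] in auto)
    then show ?thesis using q(2) by simp
  qed
  have mono: "q x \<le> q y" if "x \<le> y" for x y
    using that q(1) p(2) by (intro DERIV_nonneg_imp_nondecreasing[of x y q]) blast+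
  have one: "q x = q 1" if "x \<ge> 1" for x
  proof -
    have "q x \<le> q 1"
      using that q(1) p(3) by (intro DERIV_nonpos_imp_nonincreasing[of 1 x q]) (metis order_refl)+
    then show ?thesis using mono[OF that] by simp
  qed
  define s where "s = (\<lambda>x. (1 / q 1) * q x + 0 * q x)"
  have "smooth s" unfolding s_def by (intro smooth_lincomb q(3))
  moreover have "\<forall>x\<le>0. s x = 0" using q(2) by (simp add: s_def)
  moreover have "s x = 1" if "x \<ge> 1" for x using one[OF that] pos by (simp add: s_def)
  moreover have "0 \<le> s x \<and> s x \<le> 1" for x
  proof -
    have "0 \<le> q x" using mono[of "min x 0" x] q(2)[of "min x 0"] by simp
    moreover have "q x \<le> q 1" using mono[of x "max x 1"] one[of "max x 1"] by simp
    ultimately show ?thesis using pos by (simp add: s_def)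
  qed
  moreover have "test_function (deriv s)"
  proof -
    have "deriv s x = (1 / q 1) * p x" for x
      unfolding s_def using pos by (intro DERIV_imp_deriv) (auto intro!: derivative_eq_intros q(1))
    then have "deriv s = (\<lambda>x. (1 / q 1) * p x + 0 * p x)" by auto
    moreover have "smooth (\<lambda>x. (1 / q 1) * p x + 0 * p x)" by (intro smooth_lincomb sm)
    ultimately show ?thesis using p(1) unfolding test_function_iff by auto
  qed
  ultimately show ?thesis by blast
qed

section \<open>Test functions separate locally integrable functions\<close>

text \<open>Absolute (Lebesgue) integrability on every compact interval.\<close>

definition locally_absint :: "(real \<Rightarrow> complex) \<Rightarrow> bool" where
  "locally_absint f \<longleftrightarrow> (\<forall>a b. f absolutely_integrable_on {a..b})"

lemma absint_continuous_mult:
  fixes f g :: "real \<Rightarrow> complex"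
  assumes "continuous_on {a..b} f" "g absolutely_integrable_on {a..b}"
  shows "(\<lambda>x. f x * g x) absolutely_integrable_on {a..b}"
proof (rule absolutely_integrable_bounded_measurable_product[OF bilinear_times _ _ _ assms(2)])
  show "f \<in> borel_measurable (lebesgue_on {a..b})"
    by (rule continuous_imp_measurable_on_sets_lebesgue[OF assms(1)]) auto
  show "bounded (f ` {a..b})"
    using assms(1) compact_continuous_image compact_imp_bounded by blast
qed auto

lemma locally_absintD: "locally_absint f \<Longrightarrow> f absolutely_integrable_on {a..b}"
  "locally_absint f \<Longrightarrow> f integrable_on {a..b}"
  by (auto simp: locally_absint_def set_lebesgue_integral_eq_integral(1))

lemma locally_absint_continuous: "continuous_on UNIV f \<Longrightarrow> locally_absint f"
  unfolding locally_absint_def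
  by (meson absolutely_integrable_continuous_real continuous_on_subset subset_UNIV)

text \<open>Pairings with compactly supported functions are integrals over a compact interval.\<close>

lemma LINT_eq_integral:
  fixes f :: "real \<Rightarrow> complex"
  assumes "locally_absint f" "continuous_on UNIV p" "\<And>x. R \<le> \<bar>x\<bar> \<Longrightarrow> p x = 0"
  shows "(LINT x|lebesgue. p x *\<^sub>R f x) = integral {- R..R} (\<lambda>x. of_real (p x) * f x)"
proof -
  have "(\<lambda>x. of_real (p x) * f x) absolutely_integrable_on {-R..R}"
    using assms by (intro absint_continuous_mult locally_absintD continuous_intros) (auto intro: continuous_on_subset)
  then have "integral {- R..R} (\<lambda>x. of_real (p x) * f x) = (LINT x:{-R..R}|lebesgue. of_real (p x) * f x)"
    by (rule set_lebesgue_integral_eq_integral(2)[symmetric])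
  also have "\<dots> = (LINT x|lebesgue. p x *\<^sub>R f x)"
    unfolding set_lebesgue_integral_def
  proof (rule Bochner_Integration.integral_cong[OF refl])
    fix x
    show "indicat_real {-R..R} x *\<^sub>R (of_real (p x) * f x) = p x *\<^sub>R f x"
      using assms(3)[of x] by (cases "x \<in> {-R..R}") (auto simp: scaleR_conv_of_real)
  qed
  finally show ?thesis by simp
qed

text \<open>If all integrals over intervals vanish, Henstock's lemma makes the Riemann sums of the norm
  arbitrarily small, so the norm has integral zero.\<close>

lemma AE_zero_if_interval_integrals_zero:
  fixes v :: "real \<Rightarrow> complex"
  assumes v: "locally_absint v" and z: "\<And>a b. a \<le> b \<Longrightarrow> integral {a..b} v = 0"
  shows "AE x in lebesgue. v x = 0"
proof -
  have "AE x in lebesgue. x \<in> {- real n..real n} \<longrightarrow> v x = 0" for n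
  proof -
    let ?S = "cbox (- real n) (real n)"
    have vi: "v integrable_on ?S" using v locally_absintD by simp
    have h0: "((\<lambda>x. norm (v x)) has_integral 0) ?S"
      unfolding has_integral
    proof (intro allI impI)
      fix e :: real assume "e > 0"
      obtain \<gamma> where \<gamma>: "gauge \<gamma>" "\<And>p. \<lbrakk>p tagged_partial_division_of ?S; \<gamma> fine p\<rbrakk> \<Longrightarrow>
             sum (\<lambda>(x,k). norm(measure lborel k *\<^sub>R v x - integral k v)) p < e"
        by (rule Henstock_lemma[OF vi \<open>e > 0\<close>]) blast
      have "norm ((\<Sum>(x, k)\<in>D. measure lborel k *\<^sub>R norm (v x)) - 0) < e" if D: "D tagged_division_of ?S
        \<and> \<gamma> fine D" for D
      proof -
        have "sum (\<lambda>(x,k). norm(measure lborel k *\<^sub>R v x - integral k v)) D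
          = (\<Sum>(x, k)\<in>D. measure lborel k *\<^sub>R norm (v x))"
        proof (rule sum.cong[OF refl], clarify)
          fix x k assume xk: "(x, k) \<in> D"
          then obtain a b where k: "k = cbox a b" using D tagged_division_ofD(4) by blast
          have "integral k v = 0" unfolding k using z[of a b] by (cases "a \<le> b") auto
          then show "norm (measure lborel k *\<^sub>R v x - integral k v) = measure lborel k *\<^sub>R norm (v x)" by simp
        qed
        moreover have "0 \<le> (\<Sum>(x, k)\<in>D. measure lborel k *\<^sub>R norm (v x))"
          by (intro sum_nonneg) auto
        moreover have "sum (\<lambda>(x,k). norm(measure lborel k *\<^sub>R v x - integral k v)) D < e"
          using \<gamma>(2) D tagged_division_of_def by blast
        ultimately show ?thesis by simp
      qed
      then show "\<exists>\<gamma>. gauge \<gamma> \<and> (\<forall>\<D>. \<D> tagged_division_of ?S \<and> \<gamma> fine \<D> \<longrightarrow>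
          norm ((\<Sum>(x, k)\<in>\<D>. measure lborel k *\<^sub>R norm (v x)) - 0) < e)"
        using \<gamma>(1) by blast
    qed
    have ai: "(\<lambda>x. norm (v x)) absolutely_integrable_on ?S"
      using absolutely_integrable_norm[OF locally_absintD(1)[OF v, of "- real n" "real n"]] by (simp add: o_def)
    have "(LINT x|lebesgue. indicat_real ?S x *\<^sub>R norm (v x)) = 0"
      using set_lebesgue_integral_eq_integral(2)[OF ai] integral_unique[OF h0]
      by (simp add: set_lebesgue_integral_def)
    then have "AE x in lebesgue. indicat_real ?S x *\<^sub>R norm (v x) = 0"
      using ai unfolding set_integrable_def
      by (subst (asm) integral_nonneg_eq_0_iff_AE) auto
    then show ?thesis by eventually_elim (auto simp: indicator_def split: if_splits)
  qed
  then have "AE x in lebesgue. \<forall>n. x \<in> {- real n..real n} \<longrightarrow> v x = 0"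
    by (subst AE_all_countable) auto
  then show ?thesis
  proof eventually_elim
    case (elim x)
    obtain n where "\<bar>x\<bar> \<le> real n" using real_arch_simple by blast
    then show ?case using elim by (auto simp: abs_le_iff)
  qed
qed

text \<open>The fundamental lemma of the calculus of variations. The indicator of an interval is the
  dominated limit of differences of steepening smooth steps.\<close>

lemma AE_zero_if_test_integrals_zero:
  fixes v :: "real \<Rightarrow> complex"
  assumes v: "locally_absint v" and z: "\<And>p. test_function p \<Longrightarrow> (LINT x|lebesgue. p x *\<^sub>R v x) = 0"
  shows "AE x in lebesgue. v x = 0"
proof (rule AE_zero_if_interval_integrals_zero[OF v])
  fix a b :: real assume ab: "a \<le> b"
  obtain s where s: "smooth s" "\<forall>x\<le>0. s x = 0" "\<forall>x\<ge>1. s x = 1" "\<forall>x. 0 \<le> s x \<and> s x \<le> 1"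
    using exists_smooth_step by blast
  define R where "R = \<bar>a\<bar> + \<bar>b\<bar> + 2"
  \<comment> \<open>These functions converge pointwise to the indicator of \<open>{a<..b}\<close> and stay between \<open>- 1\<close> and \<open>1\<close>.\<close>
  define p where "p = (\<lambda>n x. 1 * s (real n * x + - real n * a) + (- 1) * s (real n * x + - real n * b))"
  have smp: "smooth (p n)" for n unfolding p_def by (intro smooth_lincomb smooth_affine s(1))
  have out: "p n x = 0" if "R \<le> \<bar>x\<bar>" for n x
  proof (cases "n = 0")
    case True then show ?thesis by (simp add: p_def)
  next
    case False
    then have n: "real n \<ge> 1" by simp
    have "x \<le> a \<and> x \<le> b \<or> x \<ge> a + 1 \<and> x \<ge> b + 1" using that by (auto simp: R_def abs_if split: if_splits)
    then show ?thesis
    proof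
      assume "x \<le> a \<and> x \<le> b"
      then have "real n * x + - real n * a \<le> 0" "real n * x + - real n * b \<le> 0"
        using n by (auto intro!: mult_left_mono)
      then show ?thesis using s(2) by (simp add: p_def)
    next
      assume x: "x \<ge> a + 1 \<and> x \<ge> b + 1"
      have "1 * 1 \<le> real n * (x - a)" "1 * 1 \<le> real n * (x - b)" using x n by (intro mult_mono; simp)+
      then have "real n * x + - real n * a \<ge> 1" "real n * x + - real n * b \<ge> 1" by (auto simp: algebra_simps)
      then show ?thesis using s(3) by (simp add: p_def)
    qed
  qed
  have tp: "test_function (p n)" for n using smp out unfolding test_function_iff by blast
  have zero: "integral {-R..R} (\<lambda>x. of_real (p n x) * v x) = 0" for n
    using z[OF tp[of n]] LINT_eq_integral[OF v smooth_continuous[OF smp[of n]] out] by simp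
  have lim1: "(\<lambda>n. s (real n * x + - real n * c)) \<longlonglongrightarrow> (if x > c then 1 else 0)" for x c
  proof (cases "x > c")
    case True
    obtain n0 :: nat where n0: "1 / (x - c) \<le> real n0" using real_arch_simple by blast
    have "\<forall>\<^sub>F n in sequentially. s (real n * x + - real n * c) = 1"
      using eventually_ge_at_top[of n0]
    proof eventually_elim
      case (elim n)
      then have "1 / (x - c) \<le> real n" using n0 by linarith
      then have "1 \<le> real n * (x - c)" using True by (simp add: divide_le_eq)
      then show ?case using s(3) by (simp add: algebra_simps)
    qed
    then show ?thesis using True by (simp add: tendsto_eventually)
  next
    case False
    then have "real n * x + - real n * c \<le> 0" for n by (auto intro!: mult_left_mono)
    then show ?thesis using False s(2) by simp
  qed
  define g where "g = (\<lambda>x. of_real ((if x > a then 1 else 0) - (if x > b then 1 else 0)) * v x)"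
  have "(\<lambda>n. integral {-R..R} (\<lambda>x. of_real (p n x) * v x)) \<longlonglongrightarrow> integral {-R..R} g"
  proof (rule dominated_convergence(2))
    show "(\<lambda>x. of_real (p k x) * v x) integrable_on {-R..R}" for k
      using smooth_continuous[OF smp[of k]] v
      by (intro set_lebesgue_integral_eq_integral(1) absint_continuous_mult locally_absintD continuous_intros)
    show "(\<lambda>x. norm (v x)) integrable_on {-R..R}"
      using v locally_absintD(1) absolutely_integrable_on_def by blast
    show "norm (of_real (p k x) * v x) \<le> norm (v x)" for k x
    proof -
      have "\<bar>p k x\<bar> \<le> 1" using s(4) unfolding p_def by (smt (verit))
      then show ?thesis by (simp add: norm_mult mult_left_le_one_le)
    qed
    show "(\<lambda>n. of_real (p n x) * v x) \<longlonglongrightarrow> g x" for x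
    proof -
      have "(\<lambda>n. p n x) \<longlonglongrightarrow> 1 * (if x > a then 1 else 0) + (- 1) * (if x > b then 1 else 0)"
        unfolding p_def by (intro tendsto_intros lim1)
      then have "(\<lambda>n. of_real (p n x) * v x) \<longlonglongrightarrow> of_real (1 * (if x > a then 1 else 0)
        + (- 1) * (if x > b then 1 else 0)) * v x"
        by (intro tendsto_intros)
      then show ?thesis unfolding g_def by simp
    qed
  qed
  then have g0: "integral {-R..R} g = 0" unfolding zero using LIMSEQ_unique tendsto_const by blast
  have "integral {-R..R} g = integral {a..b} v"
  proof -
    have "integral {-R..R} g = integral {-R..R} (\<lambda>x. if x \<in> {a..b} then v x else 0)"
      by (rule integral_spike[of "{a}"]) (use ab in \<open>auto simp: g_def\<close>)
    also have "\<dots> = integral ({a..b} \<inter> {-R..R}) v" by (rule integral_restrict_Int)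
    also have "{a..b} \<inter> {-R..R} = {a..b}" by (auto simp: R_def)
    finally show ?thesis .
  qed
  then show "integral {a..b} v = 0" using g0 by simp
qed

section \<open>Integration by parts for indefinite integrals\<close>

text \<open>A function is constant if its increments over short intervals are arbitrarily small multiples of
  the increments of a fixed function.\<close>

lemma eq_if_increments_small:
  fixes R :: "real \<Rightarrow> 'a::real_normed_vector" and \<mu> :: "real \<Rightarrow> real"
  assumes ab: "a \<le> b"
    and small: "\<And>e. e > 0 \<Longrightarrow> \<exists>d>0. \<forall>x y. a \<le> x \<and> x \<le> y \<and> y \<le> b \<and> y - x < d \<longrightarrow> norm (R y - R x) \<le> e * (\<mu> y - \<mu> x)"
  shows "R b = R a"
proof -
  have le: "norm (R b - R a) \<le> e * (\<mu> b - \<mu> a)" if e: "e > 0" for e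
  proof -
    obtain d where d: "d > 0" "\<And>x y. a \<le> x \<Longrightarrow> x \<le> y \<Longrightarrow> y \<le> b \<Longrightarrow> y - x < d \<Longrightarrow> norm (R y - R x) \<le> e * (\<mu> y - \<mu> x)"
      using small[OF e] by blast
    obtain n :: nat where n: "(b - a) / d < real n" using reals_Archimedean2 by blast
    have npos: "real n > 0" using n ab d(1) by (metis divide_nonneg_pos diff_ge_0_iff_ge le_less_trans)
    define t where "t = (\<lambda>i::nat. a + real i * ((b - a) / real n))"
    have step: "0 \<le> (b - a) / real n" "(b - a) / real n < d"
      using ab npos n d(1) by (auto simp: field_simps)
    have tS: "t (Suc i) = t i + (b - a) / real n" for i by (simp add: t_def distrib_right add_divide_distrib)
    have tn: "t n = b" using npos by (simp add: t_def)
    have ta: "a \<le> t i" for i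
      unfolding t_def using mult_nonneg_nonneg[OF of_nat_0_le_iff[of i] step(1)] by linarith
    have tb: "t i \<le> b" if "i \<le> n" for i
    proof -
      have "real i * ((b - a) / real n) \<le> real n * ((b - a) / real n)"
        using that step(1) by (intro mult_right_mono) auto
      then show ?thesis using npos by (simp add: t_def)
    qed
    have "i \<le> n \<Longrightarrow> norm (R (t i) - R a) \<le> e * (\<mu> (t i) - \<mu> a)" for i
    proof (induction i)
      case 0 then show ?case by (simp add: t_def)
    next
      case (Suc i)
      have "norm (R (t (Suc i)) - R (t i)) \<le> e * (\<mu> (t (Suc i)) - \<mu> (t i))"
        using Suc.prems step ta[of i] tb[of "Suc i"] by (intro d(2)) (auto simp: tS)
      moreover have "norm (R (t (Suc i)) - R a) \<le> norm (R (t (Suc i)) - R (t i)) + norm (R (t i) - R a)"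
        using norm_triangle_ineq[of "R (t (Suc i)) - R (t i)" "R (t i) - R a"] by simp
      ultimately show ?case using Suc by (simp add: algebra_simps)
    qed
    from this[of n] show ?thesis by (simp add: tn)
  qed
  have "norm (R b - R a) \<le> 0"
  proof (rule field_le_epsilon)
    fix e :: real assume e: "e > 0"
    define c where "c = \<bar>\<mu> b - \<mu> a\<bar> + 1"
    have c: "c > 0" "\<mu> b - \<mu> a \<le> c" by (auto simp: c_def)
    have "norm (R b - R a) \<le> e / c * (\<mu> b - \<mu> a)" using e c by (intro le) auto
    also have "\<dots> \<le> e / c * c" using e c by (intro mult_left_mono) auto
    finally show "norm (R b - R a) \<le> 0 + e" using c by simp
  qed
  then show ?thesis by simp
qed

text \<open>Integration by parts for a continuously differentiable factor \<open>F\<close> and an indefinite integral \<open>G\<close>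
  of a merely integrable function \<open>w\<close>. The defect \<open>R\<close> of the identity satisfies
  \<open>R y - R x = (integral of F' t (G y - G t)) + (integral of (F x - F t) w t)\<close> over \<open>{x..y}\<close>, which is small relative
  to the integral of \<open>|F'| + |w|\<close> by uniform continuity.\<close>

lemma integration_by_parts_indefinite:
  fixes F F' G w :: "real \<Rightarrow> complex"
  assumes ab: "a \<le> b"
    and F: "\<And>x. x \<in> {a..b} \<Longrightarrow> (F has_vector_derivative F' x) (at x within {a..b})"
    and F': "continuous_on {a..b} F'"
    and w: "w absolutely_integrable_on {a..b}"
    and G: "\<And>x. x \<in> {a..b} \<Longrightarrow> G x = G a + integral {a..x} w"
  shows "integral {a..b} (\<lambda>x. F' x * G x) + integral {a..b} (\<lambda>x. F x * w x) = F b * G b - F a * G a"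
proof -
  have wi: "w integrable_on {a..b}" using w set_lebesgue_integral_eq_integral(1) by blast
  have nwi: "(\<lambda>x. norm (w x)) integrable_on {a..b}" using w absolutely_integrable_on_def by blast
  have cF: "continuous_on {a..b} F" using F
    by (meson continuous_on_vector_derivative)
  have cG: "continuous_on {a..b} G"
  proof -
    have "continuous_on {a..b} (\<lambda>x. G a + integral {a..x} w)"
      by (intro continuous_intros indefinite_integral_continuous_1 wi)
    then show ?thesis by (rule continuous_on_eq) (rule G[symmetric])
  qed
  have i1: "(\<lambda>x. F' x * G x) integrable_on {a..b}"
    by (intro integrable_continuous_real continuous_intros F' cG)
  have i2: "(\<lambda>x. F x * w x) integrable_on {a..b}"
    using absint_continuous_mult[OF cF w] set_lebesgue_integral_eq_integral(1) by blast
  have i3: "(\<lambda>x. norm (F' x) + norm (w x)) integrable_on {a..b}"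
    by (intro integrable_add nwi integrable_continuous_real continuous_intros F')
  define R where "R = (\<lambda>x. F x * G x - integral {a..x} (\<lambda>t. F' t * G t) - integral {a..x} (\<lambda>t. F t * w t))"
  define \<mu> where "\<mu> = (\<lambda>x. integral {a..x} (\<lambda>t. norm (F' t) + norm (w t)))"
  have "R b = R a"
  proof (rule eq_if_increments_small[OF ab, where \<mu> = \<mu>])
    fix e :: real assume e: "e > 0"
    obtain d1 where d1: "d1 > 0" "\<And>x y. x \<in> {a..b} \<Longrightarrow> y \<in> {a..b} \<Longrightarrow> dist y x < d1 \<Longrightarrow> dist (F y) (F x) < e"
      using compact_uniformly_continuous[OF cF] e unfolding uniformly_continuous_on_def by (metis compact_Icc)
    obtain d2 where d2: "d2 > 0" "\<And>x y. x \<in> {a..b} \<Longrightarrow> y \<in> {a..b} \<Longrightarrow> dist y x < d2 \<Longrightarrow> dist (G y) (G x) < e"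
      using compact_uniformly_continuous[OF cG] e unfolding uniformly_continuous_on_def by (metis compact_Icc)
    have "norm (R y - R x) \<le> e * (\<mu> y - \<mu> x)" if xy: "a \<le> x" "x \<le> y" "y \<le> b" "y - x < min d1 d2" for x y
    proof -
      have sub: "{x..y} \<subseteq> {a..b}" using xy by auto
      have comb: "integral {a..y} f - integral {a..x} f = integral {x..y} f" if "f integrable_on {a..b}"
        for f :: "real \<Rightarrow> 'b::banach"
      proof -
        have "f integrable_on {a..y}" using that xy integrable_subinterval_real
          by (metis atLeastatMost_subset_iff order_refl)
        from Henstock_Kurzweil_Integration.integral_combine[OF xy(1,2) this] show ?thesis by (simp add: algebra_simps)
      qed
      have subi: "f integrable_on {x..y}" if "f integrable_on {a..b}" for f :: "real \<Rightarrow> 'b::banach"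
        using that sub integrable_subinterval_real by blast
      have FF: "integral {x..y} F' = F y - F x"
      proof (rule integral_unique, rule fundamental_theorem_of_calculus[OF xy(2)])
        fix t assume "t \<in> {x..y}"
        then show "(F has_vector_derivative F' t) (at t within {x..y})"
          using F sub has_vector_derivative_within_subset by blast
      qed
      have GG: "integral {x..y} w = G y - G x"
        using comb[OF wi] G[of y] G[of x] xy by (simp add: algebra_simps)
      have F'i: "F' integrable_on {x..y}" using subi integrable_continuous_real[OF F'] by blast
      have e1: "integral {x..y} (\<lambda>t. F' t * (G y - G t)) = (F y - F x) * G y - integral {x..y} (\<lambda>t. F' t * G t)"
      proof -
        have "integral {x..y} (\<lambda>t. F' t * (G y - G t)) = integral {x..y} (\<lambda>t. F' t * G y - F' t * G t)"
          by (simp add: right_diff_distrib)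
        also have "\<dots> = integral {x..y} (\<lambda>t. F' t * G y) - integral {x..y} (\<lambda>t. F' t * G t)"
          by (intro Henstock_Kurzweil_Integration.integral_diff integrable_on_mult_left F'i subi i1)
        finally show ?thesis using FF by simp
      qed
      have e2: "integral {x..y} (\<lambda>t. (F x - F t) * w t) = F x * (G y - G x) - integral {x..y} (\<lambda>t. F t * w t)"
      proof -
        have "integral {x..y} (\<lambda>t. (F x - F t) * w t) = integral {x..y} (\<lambda>t. F x * w t - F t * w t)"
          by (simp add: left_diff_distrib)
        also have "\<dots> = integral {x..y} (\<lambda>t. F x * w t) - integral {x..y} (\<lambda>t. F t * w t)"
          by (intro Henstock_Kurzweil_Integration.integral_diff integrable_on_mult_right subi wi i2)
        finally show ?thesis using GG by simp
      qed
      have eqR: "R y - R x = integral {x..y} (\<lambda>t. F' t * (G y - G t)) + integral {x..y} (\<lambda>t. (F x - F t) * w t)"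
        unfolding e1 e2 R_def comb[OF i1, symmetric] comb[OF i2, symmetric] by (simp add: algebra_simps)
      have sm: "norm (G y - G t) \<le> e" "norm (F x - F t) \<le> e" if "t \<in> {x..y}" for t
        using d1(2)[of t x] d2(2)[of t y] that xy by (auto simp: dist_norm)
      have b1: "norm (integral {x..y} (\<lambda>t. F' t * (G y - G t))) \<le> integral {x..y} (\<lambda>t. e * norm (F' t))"
      proof (rule integral_norm_bound_integral)
        show "(\<lambda>t. F' t * (G y - G t)) integrable_on {x..y}"
          using sub by (intro integrable_continuous_real continuous_intros continuous_on_subset[OF F']
            continuous_on_subset[OF cG])
        show "(\<lambda>t. e * norm (F' t)) integrable_on {x..y}"
          using sub by (intro integrable_continuous_real continuous_intros continuous_on_subset[OF F'])
        show "norm (F' t * (G y - G t)) \<le> e * norm (F' t)" if "t \<in> {x..y}" for t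
          using mult_left_mono[OF sm(1)[OF that], of "norm (F' t)"] by (simp add: norm_mult mult.commute)
      qed
      have b2: "norm (integral {x..y} (\<lambda>t. (F x - F t) * w t)) \<le> integral {x..y} (\<lambda>t. e * norm (w t))"
      proof (rule integral_norm_bound_integral)
        have "(\<lambda>t. F x * w t - F t * w t) integrable_on {x..y}"
          by (intro integrable_diff integrable_on_mult_right subi wi i2)
        then show "(\<lambda>t. (F x - F t) * w t) integrable_on {x..y}" by (simp add: left_diff_distrib)
        show "(\<lambda>t. e * norm (w t)) integrable_on {x..y}" by (intro integrable_on_mult_right subi nwi)
        show "norm ((F x - F t) * w t) \<le> e * norm (w t)" if "t \<in> {x..y}" for t
          using sm(2)[OF that] by (simp add: norm_mult mult_right_mono)
      qed
      have "norm (R y - R x) \<le> integral {x..y} (\<lambda>t. e * norm (F' t)) + integral {x..y} (\<lambda>t. e * norm (w t))"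
        unfolding eqR using norm_triangle_ineq b1 b2 by (meson add_mono order_trans)
      also have "\<dots> = integral {x..y} (\<lambda>t. e * norm (F' t) + e * norm (w t))"
        using sub by (intro Henstock_Kurzweil_Integration.integral_add[symmetric] integrable_on_mult_right subi[OF nwi]
          integrable_continuous_real continuous_intros continuous_on_subset[OF F'])
      also have "\<dots> = integral {x..y} (\<lambda>t. e * (norm (F' t) + norm (w t)))" by (simp add: distrib_left)
      also have "\<dots> = e * integral {x..y} (\<lambda>t. norm (F' t) + norm (w t))" by simp
      also have "\<dots> = e * (\<mu> y - \<mu> x)" unfolding \<mu>_def comb[OF i3] ..
      finally show ?thesis .
    qed
    then show "\<exists>d>0. \<forall>x y. a \<le> x \<and> x \<le> y \<and> y \<le> b \<and> y - x < d \<longrightarrow> norm (R y - R x) \<le> e * (\<mu> y - \<mu> x)"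
      using d1(1) d2(1) by (intro exI[of _ "min d1 d2"]) auto
  qed
  then show ?thesis unfolding R_def by (simp add: algebra_simps)
qed

lemma locally_absint_diff_continuous:
  assumes "locally_absint f" "continuous_on UNIV g"
  shows "locally_absint (\<lambda>x. f x - g x)"
  using assms locally_absint_continuous[OF assms(2)] unfolding locally_absint_def
  by (auto intro: set_integral_diff)

section \<open>The du Bois-Reymond lemma\<close>

lemma indefinite_integral_real_line:
  assumes w: "locally_absint w"
  obtains F where "continuous_on UNIV F" "\<And>a b. a \<le> b \<Longrightarrow> F b - F a = integral {a..b} w"
proof -
  define F where "F = (\<lambda>x. integral {0..x} w - integral {x..0} w)"
  have inc: "F b - F a = integral {a..b} w" if ab: "a \<le> b" for a b
  proof -
    note comb = Henstock_Kurzweil_Integration.integral_combine[OF _ _ locally_absintD(2)[OF w]]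
    consider "0 \<le> a" | "b \<le> 0" | "a < 0" "0 < b" by linarith
    then show ?thesis
    proof cases
      case 1
      have "integral {a..0} w = 0" "integral {b..0} w = 0" using 1 ab by (cases "a = 0"; cases "b = 0"; simp)+
      then show ?thesis using comb[of 0 a b] 1 ab by (simp add: F_def algebra_simps)
    next
      case 2
      have "integral {0..a} w = 0" "integral {0..b} w = 0" using 2 ab by (cases "a = 0"; cases "b = 0"; simp)+
      then show ?thesis using comb[of a b 0] 2 ab by (simp add: F_def algebra_simps)
    next
      case 3
      then show ?thesis using comb[of a 0 b] by (simp add: F_def algebra_simps)
    qed
  qed
  have "continuous_on UNIV F"
  proof (rule continuous_at_imp_continuous_on, rule ballI)
    fix x :: real
    have "continuous_on {x - 1..x + 1} (\<lambda>y. F (x - 1) + integral {x - 1..y} w)"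
      by (intro continuous_intros indefinite_integral_continuous_1 locally_absintD(2)[OF w])
    moreover have "F y = F (x - 1) + integral {x - 1..y} w" if "y \<in> {x - 1..x + 1}" for y
      using inc[of "x - 1" y] that by (simp add: algebra_simps)
    ultimately have "continuous_on {x - 1..x + 1} F"
      using continuous_on_eq[of "{x - 1..x + 1}" "\<lambda>y. F (x - 1) + integral {x - 1..y} w" F] by presburger
    then show "isCont F x" by (rule continuous_on_interior) simp
  qed
  then show ?thesis using inc that by blast
qed

text \<open>A locally integrable function with vanishing weak derivative is constant. For a test function \<open>p\<close>
  with integral \<open>k\<close>, the function \<open>p - k s'\<close> is the derivative of a test function, where \<open>s\<close> is a smooth step.\<close>

lemma du_Bois_Reymond:
  fixes u :: "real \<Rightarrow> complex"
  assumes u: "locally_absint u" and z: "\<And>p. test_function p \<Longrightarrow> (LINT x|lebesgue. deriv p x *\<^sub>R u x) = 0"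
  shows "\<exists>c. AE x in lebesgue. u x = c"
proof -
  obtain s where s: "smooth s" "\<forall>x\<le>0. s x = 0" "\<forall>x\<ge>1. s x = 1" "test_function (deriv s)"
    using exists_smooth_step by blast
  define c where "c = (LINT x|lebesgue. deriv s x *\<^sub>R u x)"
  have "AE x in lebesgue. u x - c = 0"
  proof (rule AE_zero_if_test_integrals_zero)
    show v: "locally_absint (\<lambda>x. u x - c)" by (rule locally_absint_diff_continuous[OF u]) (intro continuous_intros)
    fix p assume p: "test_function p"
    obtain R0 R1 where R0: "\<And>x. R0 \<le> \<bar>x\<bar> \<Longrightarrow> p x = 0" and R1: "\<And>x. R1 \<le> \<bar>x\<bar> \<Longrightarrow> deriv s x = 0"
      using p s(4) unfolding test_function_iff by blast
    define R where "R = \<bar>R0\<bar> + \<bar>R1\<bar> + 2"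
    have Rp: "\<And>x. R \<le> \<bar>x\<bar> \<Longrightarrow> p x = 0" "\<And>x. R \<le> \<bar>x\<bar> \<Longrightarrow> deriv s x = 0" "R \<ge> 2"
      using R0 R1 by (auto simp: R_def)
    have sp: "smooth p" using p test_function_iff by blast
    obtain q where q: "\<And>x. (q has_field_derivative p x) (at x)" "\<And>x. x \<le> - R \<Longrightarrow> q x = 0" "smooth q" "\<And>x. q x
      = integral {- R..x} p"
    proof -
      have "p x = 0" if "x \<le> - R" for x using Rp(1)[of x] that by (simp add: abs_if)
      then show ?thesis using antiderivative_from_left[OF sp, of "- R"] that by blast
    qed
    define k where "k = integral {- R..R} p"
    \<comment> \<open>To the right of the supports \<open>q\<close> equals \<open>k\<close> and \<open>s\<close> equals \<open>1\<close>, so \<open>r\<close> is a test function.\<close>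
    define r where "r = (\<lambda>x. 1 * q x + (- k) * s x)"
    have dr: "deriv r x = p x - k * deriv s x" for x
      unfolding r_def by (rule DERIV_imp_deriv) (auto intro!: derivative_eq_intros q(1) smooth_has_deriv s(1))
    have qR: "q x = k" if "x \<ge> R" for x
    proof -
      have "q x = q R"
      proof (rule antisym)
        have d: "(q has_real_derivative 0) (at y)" if "R \<le> y" for y
          using q(1)[of y] Rp(1)[of y] that by simp
        show "q x \<le> q R" using that d
          by (intro DERIV_nonpos_imp_nonincreasing[of R x q]) auto
        show "q R \<le> q x" using that d
          by (intro DERIV_nonneg_imp_nondecreasing[of R x q]) auto
      qed
      then show ?thesis using q(4) by (simp add: k_def)
    qed
    have "r x = 0" if "R \<le> \<bar>x\<bar>" for x
    proof (cases "x \<ge> 0")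
      case True then show ?thesis using that qR[of x] s(3) Rp(3) by (simp add: r_def)
    next
      case False then show ?thesis using that q(2)[of x] s(2) Rp(3) by (simp add: r_def)
    qed
    moreover have "smooth r" unfolding r_def by (intro smooth_lincomb q(3) s(1))
    ultimately have tr: "test_function r" unfolding test_function_iff by blast
    have cp: "continuous_on UNIV p" "continuous_on UNIV (deriv s)" "continuous_on UNIV (deriv r)"
      using sp s(1) \<open>smooth r\<close> smooth_continuous smooth_deriv by blast+
    have ip: "(\<lambda>x. of_real (g x) * f x) integrable_on {-R..R}"
      if "continuous_on UNIV g" "locally_absint f" for g and f :: "real \<Rightarrow> complex"
      using that by (intro set_lebesgue_integral_eq_integral(1) absint_continuous_mult locally_absintD
        continuous_intros)
        (auto intro: continuous_on_subset)
    have "0 = integral {-R..R} (\<lambda>x. of_real (deriv r x) * u x)"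
      using z[OF tr] LINT_eq_integral[OF u cp(3), of R] Rp by (simp add: dr)
    also have "\<dots> = integral {-R..R} (\<lambda>x. of_real (p x) * u x - of_real k * (of_real (deriv s x) * u x))"
      unfolding dr by (simp add: algebra_simps)
    also have "\<dots> = integral {-R..R} (\<lambda>x. of_real (p x) * u x) - of_real k * integral {-R..R} (\<lambda>x. of_real (deriv
      s x) * u x)"
      using cp u by (subst Henstock_Kurzweil_Integration.integral_diff) (auto intro!: ip integrable_on_mult_right)
    also have "integral {-R..R} (\<lambda>x. of_real (deriv s x) * u x) = c"
      unfolding c_def using LINT_eq_integral[OF u cp(2), of R] Rp by simp
    finally have 1: "integral {-R..R} (\<lambda>x. of_real (p x) * u x) = of_real k * c" by simp
    have pk: "integral {-R..R} (\<lambda>x. complex_of_real (p x)) = of_real k"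
      unfolding k_def by (intro integral_unique has_integral_of_real integrable_integral integrable_continuous_real)
        (use cp in \<open>auto intro: continuous_on_subset\<close>)
    have "(LINT x|lebesgue. p x *\<^sub>R (u x - c)) = integral {-R..R} (\<lambda>x. of_real (p x) * (u x - c))"
      using LINT_eq_integral[OF v cp(1)] Rp by blast
    also have "\<dots> = integral {-R..R} (\<lambda>x. of_real (p x) * u x - of_real (p x) * c)" by (simp add: algebra_simps)
    also have "\<dots> = integral {-R..R} (\<lambda>x. of_real (p x) * u x) - integral {-R..R} (\<lambda>x. of_real (p x) * c)"
      using cp u by (intro Henstock_Kurzweil_Integration.integral_diff ip) (auto intro: locally_absint_continuous)
    also have "integral {-R..R} (\<lambda>x. of_real (p x) * c) = of_real k * c" using pk by simp
    finally show "(LINT x|lebesgue. p x *\<^sub>R (u x - c)) = 0" using 1 by simp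
  qed
  then show ?thesis by (intro exI[of _ c]) simp
qed

text \<open>A function with locally integrable weak derivative \<open>w\<close> has a continuous representative, which is an
  indefinite integral of \<open>w\<close>.\<close>

lemma weak_derivative_indefinite_integral:
  fixes f w :: "real \<Rightarrow> complex"
  assumes f: "locally_absint f" and w: "locally_absint w"
    and wd: "\<And>p. test_function p \<Longrightarrow> (LINT x|lebesgue. deriv p x *\<^sub>R f x) = - (LINT x|lebesgue. p x *\<^sub>R w x)"
  obtains G where "continuous_on UNIV G" "AE x in lebesgue. f x = G x" "\<And>a b. a \<le> b \<Longrightarrow> G b - G a = integral {a..b} w"
proof -
  obtain F where F: "continuous_on UNIV F" "\<And>a b. a \<le> b \<Longrightarrow> F b - F a = integral {a..b} w"
    using indefinite_integral_real_line[OF w] by blast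
  have u: "locally_absint (\<lambda>x. f x - F x)" by (rule locally_absint_diff_continuous[OF f F(1)])
  have "\<exists>c. AE x in lebesgue. f x - F x = c"
  proof (rule du_Bois_Reymond[OF u])
    fix p assume p: "test_function p"
    then obtain R0 where R0: "\<And>x. R0 \<le> \<bar>x\<bar> \<Longrightarrow> p x = 0" and sp: "smooth p" unfolding test_function_iff by blast
    define R where "R = \<bar>R0\<bar> + 1"
    have R: "\<And>x. R \<le> \<bar>x\<bar> \<Longrightarrow> p x = 0" "R > 0" using R0 by (auto simp: R_def)
    have dR: "deriv p x = 0" if "R \<le> \<bar>x\<bar>" for x
      using that by (intro deriv_zero_outside[OF R0]) (auto simp: R_def)
    have cp: "continuous_on S p" "continuous_on S (deriv p)" for S using sp smooth_continuous smooth_deriv by blast+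
    have parts: "integral {-R..R} (\<lambda>x. of_real (deriv p x) * F x) + integral {-R..R} (\<lambda>x. of_real (p x) * w x)
        = of_real (p R) * F R - of_real (p (-R)) * F (-R)"
    proof (rule integration_by_parts_indefinite)
      show "((\<lambda>x. complex_of_real (p x)) has_vector_derivative of_real (deriv p x)) (at x within {-R..R})" for x
        by (rule has_vector_derivative_at_within, rule has_vector_derivative_of_real, rule smooth_has_deriv[OF sp])
      show "F x = F (-R) + integral {-R..x} w" if "x \<in> {-R..R}" for x
        using F(2)[of "-R" x] that by (simp add: algebra_simps)
      show "- R \<le> R" using R(2) by simp
      show "continuous_on {- R..R} (\<lambda>x. complex_of_real (deriv p x))" by (intro continuous_intros cp)
      show "w absolutely_integrable_on {- R..R}" using w by (rule locally_absintD)
    qed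
    have lF: "locally_absint F" using F(1) by (rule locally_absint_continuous)
    have "(LINT x|lebesgue. deriv p x *\<^sub>R (f x - F x)) = integral {-R..R} (\<lambda>x. of_real (deriv p x) * (f x - F x))"
      using LINT_eq_integral[OF u cp(2) dR] .
    also have "\<dots> = integral {-R..R} (\<lambda>x. of_real (deriv p x) * f x - of_real (deriv p x) * F x)"
      by (simp add: algebra_simps)
    also have "\<dots> = integral {-R..R} (\<lambda>x. of_real (deriv p x) * f x) - integral {-R..R} (\<lambda>x. of_real (deriv p x) * F x)"
      using f lF by (intro Henstock_Kurzweil_Integration.integral_diff set_lebesgue_integral_eq_integral(1)
        absint_continuous_mult
          locally_absintD continuous_intros cp)
    also have "integral {-R..R} (\<lambda>x. of_real (deriv p x) * f x) = - integral {-R..R} (\<lambda>x. of_real (p x) * w x)"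
      using wd[OF p] LINT_eq_integral[OF f cp(2) dR] LINT_eq_integral[OF w cp(1) R(1)] by simp
    finally show "(LINT x|lebesgue. deriv p x *\<^sub>R (f x - F x)) = 0"
      using parts R(1)[of R] R(1)[of "- R"] R(2) by (simp add: algebra_simps add_eq_0_iff)
  qed
  then obtain c where c: "AE x in lebesgue. f x - F x = c" by blast
  show ?thesis
  proof (rule that[of "\<lambda>x. F x + c"])
    show "continuous_on UNIV (\<lambda>x. F x + c)" using F(1) by (intro continuous_intros)
    show "AE x in lebesgue. f x = F x + c" using c by eventually_elim (auto simp: algebra_simps)
    show "F b + c - (F a + c) = integral {a..b} w" if "a \<le> b" for a b using F(2)[OF that] by simp
  qed
qed

section \<open>Regularity of Sobolev functions\<close>

lemma L2_sq_integrable_on: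
  assumes "f \<in> L2" shows "(\<lambda>x. (cmod (f x))\<^sup>2) integrable_on UNIV" "(\<lambda>x. (cmod (f x))\<^sup>2) integrable_on {a..b}"
proof -
  have "integrable lebesgue (\<lambda>x. (cmod (f x))\<^sup>2)" using assms by (simp add: L2_def)
  then show 1: "(\<lambda>x. (cmod (f x))\<^sup>2) integrable_on UNIV" by (rule integrable_on_lebesgue)
  show "(\<lambda>x. (cmod (f x))\<^sup>2) integrable_on {a..b}"
    by (rule integrable_on_subinterval[OF 1]) simp
qed

lemma L2_locally_absint:
  assumes "f \<in> L2" shows "locally_absint f"
  unfolding locally_absint_def
proof (intro allI)
  fix a b :: real
  show "f absolutely_integrable_on {a..b}"
  proof (rule measurable_bounded_by_integrable_imp_absolutely_integrable)
    show "f \<in> borel_measurable (lebesgue_on {a..b})"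
      using assms by (intro measurable_restrict_space1) (simp add: L2_def)
    show "(\<lambda>x. 1 + (cmod (f x))\<^sup>2) integrable_on {a..b}"
      by (intro integrable_add integrable_const_ivl L2_sq_integrable_on assms)
    show "norm (f x) \<le> 1 + (cmod (f x))\<^sup>2" for x
    proof -
      have "0 \<le> (cmod (f x) - 1/2)\<^sup>2 + 3/4" by simp
      also have "\<dots> = 1 + (cmod (f x))\<^sup>2 - cmod (f x)" by (simp add: power2_eq_square algebra_simps)
      finally show ?thesis by simp
    qed
  qed simp
qed

lemma has_vector_derivative_of_increments:
  fixes G g :: "real \<Rightarrow> complex"
  assumes "continuous_on UNIV g" "\<And>a b. a \<le> b \<Longrightarrow> G b - G a = integral {a..b} g"
  shows "(G has_vector_derivative g x) (at x)"
proof -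
  have "((\<lambda>y. integral {x - 1..y} g) has_vector_derivative g x) (at x within {x - 1..x + 1})"
    by (rule integral_has_vector_derivative) (auto intro: continuous_on_subset[OF assms(1)])
  then have "((\<lambda>y. G (x - 1) + integral {x - 1..y} g) has_vector_derivative g x) (at x within {x - 1..x + 1})"
    by (auto intro!: derivative_eq_intros)
  then have "(G has_vector_derivative g x) (at x within {x - 1..x + 1})"
  proof (rule has_vector_derivative_transform[rotated 2])
    show "G y = G (x - 1) + integral {x - 1..y} g" if "y \<in> {x - 1..x + 1}" for y
      using assms(2)[of "x - 1" y] that by (simp add: algebra_simps)
  qed simp
  then show ?thesis by (simp add: at_within_Icc_at)
qed

lemma integral_AE_cong:
  fixes f g :: "real \<Rightarrow> complex"
  assumes "AE x in lebesgue. f x = g x"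
  shows "integral S f = integral S g"
proof -
  obtain N where N: "negligible N" "\<And>x. x \<notin> N \<Longrightarrow> f x = g x"
    using assms unfolding eventually_ae_filter_negligible by blast
  show ?thesis by (rule integral_spike[OF N(1)]) (use N(2) in auto)
qed

lemma weak_deriv_spec:
  assumes "f \<in> Sobolev n" "k \<le> n"
  shows "weak_deriv k f \<in> L2" "has_weak_deriv k f (weak_deriv k f)"
proof -
  have "\<exists>g. g \<in> L2 \<and> has_weak_deriv k f g" using assms unfolding Sobolev_def by blast
  then have "weak_deriv k f \<in> L2 \<and> has_weak_deriv k f (weak_deriv k f)"
    unfolding weak_deriv_def by (rule someI_ex)
  then show "weak_deriv k f \<in> L2" "has_weak_deriv k f (weak_deriv k f)" by auto
qed

text \<open>One-dimensional Sobolev regularity. The weak derivative of order \<open>k + 1\<close> is the first weak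
  derivative of the one of order \<open>k\<close>, so the representatives \<open>G k\<close> are successive classical derivatives.\<close>

lemma Sobolev_smooth_representatives:
  assumes f: "f \<in> Sobolev (Suc n)"
  obtains G where "\<And>k. k \<le> n \<Longrightarrow> continuous_on UNIV (G k)"
    "\<And>k. k \<le> n \<Longrightarrow> AE x in lebesgue. weak_deriv k f x = G k x"
    "AE x in lebesgue. f x = G 0 x"
    "\<And>k x. k < n \<Longrightarrow> (G k has_vector_derivative G (Suc k) x) (at x)"
    "\<And>a b. a \<le> b \<Longrightarrow> G n b - G n a = integral {a..b} (weak_deriv (Suc n) f)"
proof -
  define w where "w = (\<lambda>k. weak_deriv k f)"
  have wL2: "w k \<in> L2" and wd: "has_weak_deriv k f (w k)" if "k \<le> Suc n" for k
    using weak_deriv_spec[OF f that] by (auto simp: w_def)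
  have wl: "locally_absint (w k)" if "k \<le> Suc n" for k using wL2[OF that] by (rule L2_locally_absint)
  have fl: "locally_absint f" using f by (auto simp: Sobolev_def intro: L2_locally_absint)
  have rel: "(LINT x|lebesgue. deriv p x *\<^sub>R w k x) = - (LINT x|lebesgue. p x *\<^sub>R w (Suc k) x)"
    if "k \<le> n" "test_function p" for k p
  proof -
    have a: "(LINT x|lebesgue. (deriv ^^ Suc k) p x *\<^sub>R f x) = (- 1) ^ Suc k * (LINT x|lebesgue. p x *\<^sub>R w (Suc k) x)"
      using wd[of "Suc k"] that unfolding has_weak_deriv_def by blast
    have b: "(LINT x|lebesgue. (deriv ^^ k) (deriv p) x *\<^sub>R f x) = (- 1) ^ k * (LINT x|lebesgue. deriv p x *\<^sub>R w k x)"
      using wd[of k] that test_function_deriv[OF that(2)] unfolding has_weak_deriv_def by simp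
    have "(- 1 :: complex) ^ k * (LINT x|lebesgue. deriv p x *\<^sub>R w k x)
      = (- 1) ^ k * (- (LINT x|lebesgue. p x *\<^sub>R w (Suc k) x))"
      using a b by (simp only: funpow_Suc_right comp_apply) simp
    then show ?thesis by (simp only: mult_cancel_left) simp
  qed
  have "\<forall>k. \<exists>G. k \<le> n \<longrightarrow> continuous_on UNIV G \<and> (AE x in lebesgue. w k x = G x) \<and> (\<forall>a b. a \<le> b \<longrightarrow> G b - G a
    = integral {a..b} (w (Suc k)))"
  proof (intro allI)
    fix k
    show "\<exists>G. k \<le> n \<longrightarrow> continuous_on UNIV G \<and> (AE x in lebesgue. w k x = G x) \<and> (\<forall>a b. a \<le> b \<longrightarrow> G b - G a
      = integral {a..b} (w (Suc k)))"
    proof (cases "k \<le> n")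
      case True
      show ?thesis
        by (rule weak_derivative_indefinite_integral[of "w k" "w (Suc k)"]) (use True wl rel in auto)
    qed simp
  qed
  then obtain G where G: "\<And>k. k \<le> n \<Longrightarrow> continuous_on UNIV (G k)"
    "\<And>k. k \<le> n \<Longrightarrow> AE x in lebesgue. w k x = G k x"
    "\<And>k a b. k \<le> n \<Longrightarrow> a \<le> b \<Longrightarrow> G k b - G k a = integral {a..b} (w (Suc k))" by metis
  have "AE x in lebesgue. f x - w 0 x = 0"
  proof (rule AE_zero_if_test_integrals_zero)
    show ld: "locally_absint (\<lambda>x. f x - w 0 x)" using fl wl[of 0] unfolding locally_absint_def
      by (auto intro: set_integral_diff)
    fix p assume p: "test_function p"
    then obtain R where R: "\<And>x. R \<le> \<bar>x\<bar> \<Longrightarrow> p x = 0" and sp: "smooth p" unfolding test_function_iff by blast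
    have cp: "continuous_on S p" for S using sp smooth_continuous by blast
    have "(LINT x|lebesgue. p x *\<^sub>R (f x - w 0 x)) = integral {-R..R} (\<lambda>x. of_real (p x) * (f x - w 0 x))"
      using LINT_eq_integral[OF ld cp R] .
    also have "\<dots> = integral {-R..R} (\<lambda>x. of_real (p x) * f x - of_real (p x) * w 0 x)" by (simp add: algebra_simps)
    also have "\<dots> = integral {-R..R} (\<lambda>x. of_real (p x) * f x) - integral {-R..R} (\<lambda>x. of_real (p x) * w 0 x)"
      using fl wl[of 0] by (intro Henstock_Kurzweil_Integration.integral_diff
        set_lebesgue_integral_eq_integral(1) absint_continuous_mult
          locally_absintD continuous_intros cp) auto
    also have "\<dots> = (LINT x|lebesgue. p x *\<^sub>R f x) - (LINT x|lebesgue. p x *\<^sub>R w 0 x)"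
      using LINT_eq_integral[OF fl cp R] LINT_eq_integral[OF wl[of 0] cp R] by simp
    also have "\<dots> = 0" using wd[of 0] p unfolding has_weak_deriv_def by auto
    finally show "(LINT x|lebesgue. p x *\<^sub>R (f x - w 0 x)) = 0" .
  qed
  then have f0: "AE x in lebesgue. f x = G 0 x" using G(2)[of 0] by (auto elim: eventually_elim2)
  have der: "(G k has_vector_derivative G (Suc k) x) (at x)" if "k < n" for k x
  proof (rule has_vector_derivative_of_increments)
    show "continuous_on UNIV (G (Suc k))" using G(1) that by simp
    show "G k b - G k a = integral {a..b} (G (Suc k))" if "a \<le> b" for a b
      using G(3)[of k a b] integral_AE_cong[OF G(2)[of "Suc k"]] \<open>k < n\<close> that by simp
  qed
  show ?thesis using that[of G] G f0 der by (simp add: w_def)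
qed

section \<open>Weighted interpolation inequalities\<close>

lemma integral_Cauchy_Schwarz:
  fixes f g :: "real \<Rightarrow> real"
  assumes "(\<lambda>x. (f x)\<^sup>2) integrable_on S" "(\<lambda>x. (g x)\<^sup>2) integrable_on S" "(\<lambda>x. f x * g x) integrable_on S"
  shows "(integral S (\<lambda>x. f x * g x))\<^sup>2 \<le> integral S (\<lambda>x. (f x)\<^sup>2) * integral S (\<lambda>x. (g x)\<^sup>2)"
proof -
  define A where "A = integral S (\<lambda>x. (f x)\<^sup>2)"
  define B where "B = integral S (\<lambda>x. (g x)\<^sup>2)"
  define C where "C = integral S (\<lambda>x. f x * g x)"
  have A0: "A \<ge> 0" unfolding A_def using assms(1) by (intro Henstock_Kurzweil_Integration.integral_nonneg) auto
  have q: "0 \<le> t\<^sup>2 * A - 2 * t * C + B" for t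
  proof -
    have h: "((\<lambda>x. t\<^sup>2 * (f x)\<^sup>2 - 2 * t * (f x * g x) + (g x)\<^sup>2) has_integral t\<^sup>2 * A - 2 * t * C + B) S"
      unfolding A_def B_def C_def
      by (intro has_integral_add has_integral_diff has_integral_mult_right integrable_integral assms)
    have "0 \<le> t\<^sup>2 * (f x)\<^sup>2 - 2 * t * (f x * g x) + (g x)\<^sup>2" for x
    proof -
      have "0 \<le> (t * f x - g x)\<^sup>2" by simp
      then show ?thesis by (simp add: power2_eq_square algebra_simps)
    qed
    then show ?thesis using has_integral_nonneg[OF h] by blast
  qed
  have "C\<^sup>2 \<le> A * B"
  proof (cases "A = 0")
    case True
    have "C = 0"
    proof (rule ccontr)
      assume "C \<noteq> 0"
      then show False using q[of "(B + 1) / (2 * C)"] True by (simp add: field_simps)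
    qed
    then show ?thesis using True by simp
  next
    case False
    then have A: "A > 0" using A0 by simp
    have "0 \<le> A * ((C / A)\<^sup>2 * A - 2 * (C / A) * C + B)" using q[of "C / A"] A by simp
    also have "\<dots> = A * B - C\<^sup>2" using A by (simp add: field_simps power2_eq_square)
    finally show ?thesis by simp
  qed
  then show ?thesis by (simp add: A_def B_def C_def)
qed

lemma integrable_continuous_mult_nonneg:
  fixes f g :: "real \<Rightarrow> real"
  assumes "continuous_on {a..b} f" "g integrable_on {a..b}" "\<And>x. 0 \<le> g x"
  shows "(\<lambda>x. f x * g x) integrable_on {a..b}"
proof -
  have "g absolutely_integrable_on {a..b}" using assms by (intro nonnegative_absolutely_integrable_1) auto
  then have "(\<lambda>x. f x * g x) absolutely_integrable_on {a..b}"
  proof (rule absolutely_integrable_bounded_measurable_product_real[rotated 3])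
    show "f \<in> borel_measurable (lebesgue_on {a..b})"
      by (rule continuous_imp_measurable_on_sets_lebesgue[OF assms(1)]) auto
    show "bounded (f ` {a..b})"
      using assms(1) compact_continuous_image compact_imp_bounded by blast
  qed auto
  then show ?thesis by (rule set_lebesgue_integral_eq_integral(1))
qed

text \<open>The weight \<open>jap x\<close> multiplied by a cutoff that vanishes at \<open>R\<close> and \<open>- R\<close>. The cutoff removes boundary
  terms, and on \<open>{-R..R}\<close> the derivative of the product stays bounded uniformly in \<open>R \<ge> 1\<close>. Outside this interval the
  function is not used.\<close>

definition cutw :: "real \<Rightarrow> real \<Rightarrow> real" where
  "cutw R x = jap x * (1 - x\<^sup>2 / R\<^sup>2)"

text \<open>The derivative of the cut-off weight.\<close>

definition cutw_deriv :: "real \<Rightarrow> real \<Rightarrow> real" where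
  "cutw_deriv R x = x / jap x * (1 - x\<^sup>2 / R\<^sup>2) - 2 * x * jap x / R\<^sup>2"

lemma jap_pos: "1 \<le> jap x" "0 < jap x" "(jap x)\<^sup>2 = 1 + x\<^sup>2" "\<bar>x\<bar> \<le> jap x"
proof -
  show 1: "1 \<le> jap x" by (simp add: jap_def)
  then show "0 < jap x" by linarith
  show "(jap x)\<^sup>2 = 1 + x\<^sup>2" by (simp add: jap_def)
  show "\<bar>x\<bar> \<le> jap x" unfolding jap_def by (rule real_le_rsqrt) simp
qed

lemma continuous_on_jap [continuous_intros]: "continuous_on S f \<Longrightarrow> continuous_on S (\<lambda>x. jap (f x))"
  unfolding jap_def by (intro continuous_intros)

lemma cutw_has_deriv: "(cutw R has_real_derivative cutw_deriv R x) (at x)"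
proof -
  have "1 + x\<^sup>2 > 0" by (simp add: add_pos_nonneg)
  then have "(jap has_real_derivative x / jap x) (at x)"
    unfolding jap_def by (auto intro!: derivative_eq_intros simp: field_simps)
  then have "(cutw R has_real_derivative x / jap x * (1 - x\<^sup>2 / R\<^sup>2) + (0 - 2 * x / R\<^sup>2) * jap x) (at x)"
    unfolding cutw_def
    by (intro DERIV_mult DERIV_diff DERIV_const DERIV_cdivide) (auto intro!: derivative_eq_intros)
  then show ?thesis by (simp add: cutw_deriv_def algebra_simps)
qed

lemma continuous_on_cutw: "continuous_on S (cutw R)" "continuous_on S (cutw_deriv R)"
proof -
  show "continuous_on S (cutw R)"
    by (meson DERIV_isCont continuous_at_imp_continuous_on cutw_has_deriv)
  have "jap x \<noteq> 0" for x using jap_pos(2)[of x] by simp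
  then show "continuous_on S (cutw_deriv R)"
    unfolding cutw_deriv_def by (cases "R = 0") (auto intro!: continuous_intros)
qed

lemma cutw_bounds:
  assumes "1 \<le> R" "x \<in> {-R..R}"
  shows "0 \<le> cutw R x" "cutw R x \<le> jap x" "\<bar>cutw_deriv R x\<bar> \<le> 4"
proof -
  have x: "\<bar>x\<bar> \<le> R" using assms by auto
  then have "x\<^sup>2 \<le> R\<^sup>2" using assms(1) by (simp add: abs_le_square_iff[symmetric])
  then have q: "0 \<le> 1 - x\<^sup>2 / R\<^sup>2" "1 - x\<^sup>2 / R\<^sup>2 \<le> 1" using assms(1) by (simp_all add: divide_le_eq)
  show "0 \<le> cutw R x" using q jap_pos(2)[of x] by (simp add: cutw_def)
  show "cutw R x \<le> jap x" using q jap_pos(2)[of x] by (simp add: cutw_def mult_left_le)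
  have "\<bar>x / jap x * (1 - x\<^sup>2 / R\<^sup>2)\<bar> \<le> 1 * 1"
    unfolding abs_mult abs_divide using q jap_pos[of x] by (intro mult_mono) (simp_all add: divide_le_eq)
  moreover have "\<bar>2 * x * jap x / R\<^sup>2\<bar> \<le> 3"
  proof -
    have "jap x \<le> 3/2 * R"
    proof -
      have "(jap x)\<^sup>2 \<le> (3/2 * R)\<^sup>2"
      proof -
        have "1 \<le> R\<^sup>2" using assms(1) by (simp add: one_le_power)
        then show ?thesis using \<open>x\<^sup>2 \<le> R\<^sup>2\<close> unfolding jap_pos(3) by (simp add: power_mult_distrib power_divide)
      qed
      from power2_le_imp_le[OF this] show ?thesis using assms(1) by simp
    qed
    then have "2 * \<bar>x\<bar> * jap x \<le> 2 * R * (3/2 * R)" using x jap_pos[of x] by (intro mult_mono) auto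
    then have "\<bar>2 * x * jap x\<bar> \<le> 3 * R\<^sup>2" using jap_pos(2)[of x] by (simp add: abs_mult power2_eq_square)
    then show ?thesis using assms(1) unfolding abs_divide by (simp add: divide_le_eq)
  qed
  ultimately show "\<bar>cutw_deriv R x\<bar> \<le> 4" unfolding cutw_deriv_def by linarith
qed

text \<open>The norm of \<open>cutw R x ^ m * f x\<close> in \<open>L2\<close> of the interval \<open>{-R..R}\<close>.\<close>

definition cutnorm :: "real \<Rightarrow> nat \<Rightarrow> (real \<Rightarrow> complex) \<Rightarrow> real" where
  "cutnorm R m f = sqrt (integral {-R..R} (\<lambda>x. cutw R x ^ (2 * m) * (cmod (f x))\<^sup>2))"

lemma cutnorm_nonneg: "0 \<le> cutnorm R m f"
  unfolding cutnorm_def by (cases "(\<lambda>x. cutw R x ^ (2 * m) * (cmod (f x))\<^sup>2) integrable_on {-R..R}")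
   (auto intro!: Henstock_Kurzweil_Integration.integral_nonneg simp: not_integrable_integral power_mult)

lemma cutnorm_integrable:
  assumes "(\<lambda>x. (cmod (f x))\<^sup>2) integrable_on {-R..R}"
  shows "(\<lambda>x. cutw R x ^ (2 * m) * (cmod (f x))\<^sup>2) integrable_on {-R..R}"
  by (rule integrable_continuous_mult_nonneg) (auto intro!: assms continuous_intros continuous_on_cutw)

lemma cutnorm_sq:
  assumes "(\<lambda>x. (cmod (f x))\<^sup>2) integrable_on {-R..R}"
  shows "(cutnorm R m f)\<^sup>2 = integral {-R..R} (\<lambda>x. cutw R x ^ (2 * m) * (cmod (f x))\<^sup>2)"
proof -
  have "0 \<le> integral {-R..R} (\<lambda>x. cutw R x ^ (2 * m) * (cmod (f x))\<^sup>2)"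
    by (intro Henstock_Kurzweil_Integration.integral_nonneg cutnorm_integrable assms) (auto simp: power_mult)
  then show ?thesis by (simp add: cutnorm_def)
qed

lemma cutnorm_mult_le:
  assumes f: "(\<lambda>x. (cmod (f x))\<^sup>2) integrable_on {-R..R}" and g: "(\<lambda>x. (cmod (g x))\<^sup>2) integrable_on {-R..R}"
    and fg: "(\<lambda>x. cutw R x ^ (m + n) * (cmod (f x) * cmod (g x))) integrable_on {-R..R}"
  shows "integral {-R..R} (\<lambda>x. cutw R x ^ (m + n) * (cmod (f x) * cmod (g x))) \<le> cutnorm R m f * cutnorm R n g"
proof -
  define p where "p = (\<lambda>x. cutw R x ^ m * cmod (f x))"
  define q where "q = (\<lambda>x. cutw R x ^ n * cmod (g x))"
  have p2: "(\<lambda>x. (p x)\<^sup>2) = (\<lambda>x. cutw R x ^ (2 * m) * (cmod (f x))\<^sup>2)"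
    by (auto simp: p_def power_mult_distrib power_mult[symmetric] mult.commute)
  have q2: "(\<lambda>x. (q x)\<^sup>2) = (\<lambda>x. cutw R x ^ (2 * n) * (cmod (g x))\<^sup>2)"
    by (auto simp: q_def power_mult_distrib power_mult[symmetric] mult.commute)
  have pq: "(\<lambda>x. p x * q x) = (\<lambda>x. cutw R x ^ (m + n) * (cmod (f x) * cmod (g x)))"
    by (auto simp: p_def q_def power_add)
  have "(integral {-R..R} (\<lambda>x. p x * q x))\<^sup>2 \<le> integral {-R..R} (\<lambda>x. (p x)\<^sup>2) * integral {-R..R} (\<lambda>x. (q x)\<^sup>2)"
    by (rule integral_Cauchy_Schwarz) (use cutnorm_integrable[OF f] cutnorm_integrable[OF g] fg in \<open>simp_all
      add: p2 q2 pq\<close>)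
  also have "\<dots> = (cutnorm R m f * cutnorm R n g)\<^sup>2"
    unfolding p2 q2 power_mult_distrib cutnorm_sq[OF f] cutnorm_sq[OF g] ..
  finally show ?thesis unfolding pq by (rule power2_le_imp_le) (simp add: cutnorm_nonneg)
qed

text \<open>Integrate \<open>cutw ^ (2 m) * u1 * cnj u1\<close> by parts, with \<open>u1 = u'\<close> and \<open>u1' = w\<close>. If the derivative falls on
  the weight, the remaining power of the weight on \<open>u\<close> is \<open>m - 1\<close>, and \<open>cutw ^ (m - 1) \<le> cutw ^ (m + 1) + 1\<close>.\<close>

lemma cutnorm_step:
  assumes R: "1 \<le> R" and m: "m = Suc m'"
    and u: "\<And>x. (u has_vector_derivative u1 x) (at x)" and c1: "continuous_on UNIV u1"
    and w: "locally_absint w" "(\<lambda>x. (cmod (w x))\<^sup>2) integrable_on {-R..R}"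
    and u1: "\<And>a b. a \<le> b \<Longrightarrow> u1 b - u1 a = integral {a..b} w"
  shows "(cutnorm R m u1)\<^sup>2 \<le> cutnorm R (Suc m) u * cutnorm R m' w
      + 8 * real m * (cutnorm R (Suc m) u + cutnorm R 0 u) * cutnorm R m u1"
proof -
  have c0: "continuous_on UNIV u" using u
    by (meson continuous_at_imp_continuous_on has_vector_derivative_continuous)
  have cc: "continuous_on {-R..R} u" "continuous_on {-R..R} u1" using c0 c1 continuous_on_subset by blast+
  define V where "V = (\<lambda>x. cutw R x ^ (2 * m))"
  define V' where "V' = (\<lambda>x. real (2 * m) * (cutw_deriv R x * cutw R x ^ (2 * m - 1)))"
  have Vd: "(V has_real_derivative V' x) (at x)" for x
    unfolding V_def V'_def using DERIV_power[OF cutw_has_deriv[of R x], of "2 * m"]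
    by (simp add: mult.assoc)
  have cV: "continuous_on S V" "continuous_on S V'" for S
    unfolding V_def V'_def by (intro continuous_intros continuous_on_cutw)+
  have V0: "V R = 0" "V (- R) = 0" using R m by (auto simp: V_def cutw_def)
  have Vnn: "V x \<ge> 0" for x by (simp add: V_def power_mult)
  define F where "F = (\<lambda>x. of_real (V x) * u x)"
  define F' where "F' = (\<lambda>x. of_real (V' x) * u x + of_real (V x) * u1 x)"
  have lw: "w absolutely_integrable_on {-R..R}" using w(1) locally_absintD by blast
  have lcw: "(\<lambda>x. cnj (w x)) absolutely_integrable_on {-R..R}"
    using absolutely_integrable_linear[OF lw bounded_linear_cnj] by (simp add: o_def)
  have parts: "integral {-R..R} (\<lambda>x. F' x * cnj (u1 x)) + integral {-R..R} (\<lambda>x. F x * cnj (w x)) = 0"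
  proof -
    have "integral {-R..R} (\<lambda>x. F' x * cnj (u1 x)) + integral {-R..R} (\<lambda>x. F x * cnj (w x))
        = F R * cnj (u1 R) - F (- R) * cnj (u1 (- R))"
    proof (rule integration_by_parts_indefinite)
      show "(F has_vector_derivative F' x) (at x within {-R..R})" for x
      proof (rule has_vector_derivative_at_within)
        have "((\<lambda>x. complex_of_real (V x)) has_vector_derivative of_real (V' x)) (at x)"
          by (rule has_vector_derivative_of_real[OF Vd])
        from has_vector_derivative_mult[OF this u[of x]]
        show "(F has_vector_derivative F' x) (at x)" by (simp add: F_def F'_def add.commute)
      qed
      show "continuous_on {-R..R} F'" unfolding F'_def by (intro continuous_intros cV cc)
      show "cnj (u1 x) = cnj (u1 (- R)) + integral {-R..x} (\<lambda>x. cnj (w x))" if "x \<in> {-R..R}" for x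
      proof -
        have "cnj (u1 x) = cnj (u1 (-R)) + cnj (integral {-R..x} w)"
          using u1[of "-R" x] that by (simp add: complex_cnj_add[symmetric] algebra_simps del: complex_cnj_add)
        then show ?thesis by (simp add: integral_cnj)
      qed
    qed (use R lcw in auto)
    then show ?thesis by (simp add: F_def V0)
  qed
  have i1: "(\<lambda>x. cutw R x ^ (m' + m) * (cmod (u x) * cmod (u1 x))) integrable_on {-R..R}"
    by (intro integrable_continuous_real continuous_intros continuous_on_cutw cc)
  have i2a: "(\<lambda>x. F x * cnj (w x)) absolutely_integrable_on {-R..R}"
    unfolding F_def by (intro absint_continuous_mult lcw continuous_intros cV cc)
  have nF: "norm (F x * cnj (w x)) = cutw R x ^ (Suc m + m') * (cmod (u x) * cmod (w x))" for x
  proof -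
    have "norm (F x * cnj (w x)) = V x * (cmod (u x) * cmod (w x))"
      using Vnn[of x] by (simp add: F_def norm_mult)
    moreover have "2 * m = Suc m + m'" using m by simp
    ultimately show ?thesis by (simp only: V_def)
  qed
  have i2: "(\<lambda>x. cutw R x ^ (Suc m + m') * (cmod (u x) * cmod (w x))) integrable_on {-R..R}"
  proof -
    have "(\<lambda>x. norm (F x * cnj (w x))) integrable_on {-R..R}"
      by (rule i2a[unfolded absolutely_integrable_on_def, THEN conjunct2])
    then show ?thesis by (simp only: nF)
  qed
  have sq: "(\<lambda>x. (cmod (u x))\<^sup>2) integrable_on {-R..R}" "(\<lambda>x. (cmod (u1 x))\<^sup>2) integrable_on {-R..R}"
    by (intro integrable_continuous_real continuous_intros cc)+
  have split: "integral {-R..R} (\<lambda>x. F' x * cnj (u1 x))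
     = integral {-R..R} (\<lambda>x. of_real (V' x) * u x * cnj (u1 x)) + of_real ((cutnorm R m u1)\<^sup>2)"
  proof -
    have "integral {-R..R} (\<lambda>x. F' x * cnj (u1 x))
        = integral {-R..R} (\<lambda>x. of_real (V' x) * u x * cnj (u1 x) + of_real (V x * (cmod (u1 x))\<^sup>2))"
      by (simp only: F'_def distrib_right mult.assoc of_real_mult complex_norm_square)
    also have "\<dots> = integral {-R..R} (\<lambda>x. of_real (V' x) * u x * cnj (u1 x))
      + integral {-R..R} (\<lambda>x. of_real (V x * (cmod (u1 x))\<^sup>2))"
      by (intro Henstock_Kurzweil_Integration.integral_add integrable_continuous_real continuous_intros cV cc)
    also have "integral {-R..R} (\<lambda>x. complex_of_real (V x * (cmod (u1 x))\<^sup>2)) = of_real ((cutnorm R m u1)\<^sup>2)"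
      unfolding cutnorm_sq[OF sq(2)] V_def
      by (intro integral_unique has_integral_of_real integrable_integral cutnorm_integrable sq)
    finally show ?thesis .
  qed
  define I1 where "I1 = integral {-R..R} (\<lambda>x. of_real (V' x) * u x * cnj (u1 x))"
  define I2 where "I2 = integral {-R..R} (\<lambda>x. F x * cnj (w x))"
  have "I1 + complex_of_real ((cutnorm R m u1)\<^sup>2) + I2 = 0" using parts unfolding split I1_def I2_def .
  then have "complex_of_real ((cutnorm R m u1)\<^sup>2) = - (I1 + I2)" by algebra
  then have "cmod (complex_of_real ((cutnorm R m u1)\<^sup>2)) = cmod (I1 + I2)" by (simp only: norm_minus_cancel)
  then have "(cutnorm R m u1)\<^sup>2 = cmod (I1 + I2)" unfolding norm_of_real by simp
  also have "\<dots> \<le> cmod I1 + cmod I2" by (rule norm_triangle_ineq)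
  finally have total: "(cutnorm R m u1)\<^sup>2 \<le> cmod I1 + cmod I2" .
  have t1: "cmod I1 \<le> 8 * real m * (cutnorm R m' u * cutnorm R m u1)"
  proof -
    have "cmod I1 \<le> integral {-R..R} (\<lambda>x. 8 * real m * (cutw R x ^ (m' + m) * (cmod (u x) * cmod (u1 x))))"
      unfolding I1_def
    proof (rule integral_norm_bound_integral)
      show "(\<lambda>x. of_real (V' x) * u x * cnj (u1 x)) integrable_on {-R..R}"
        by (intro integrable_continuous_real continuous_intros cV cc)
      show "(\<lambda>x. 8 * real m * (cutw R x ^ (m' + m) * (cmod (u x) * cmod (u1 x)))) integrable_on {-R..R}"
        by (intro integrable_on_mult_right i1)
      show "cmod (of_real (V' x) * u x * cnj (u1 x)) \<le> 8 * real m * (cutw R x ^ (m' + m) * (cmod (u x) * cmod (u1 x)))"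
        if x: "x \<in> {-R..R}" for x
      proof -
        have e: "2 * m - 1 = m' + m" using m by simp
        have "\<bar>V' x\<bar> = real (2 * m) * (\<bar>cutw_deriv R x\<bar> * cutw R x ^ (m' + m))"
          using cutw_bounds(1)[OF R x] unfolding V'_def e by (simp add: abs_mult)
        also have "\<dots> \<le> real (2 * m) * (4 * cutw R x ^ (m' + m))"
          using cutw_bounds[OF R x] by (intro mult_left_mono mult_right_mono) auto
        finally have "\<bar>V' x\<bar> \<le> 8 * real m * cutw R x ^ (m' + m)" by simp
        then have "\<bar>V' x\<bar> * (cmod (u x) * cmod (u1 x)) \<le> 8 * real m * cutw R x ^ (m' + m) * (cmod (u x) * cmod (u1 x))"
          by (intro mult_right_mono) auto
        then show ?thesis by (simp add: norm_mult mult.assoc)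
      qed
    qed
    also have "\<dots> = 8 * real m * integral {-R..R} (\<lambda>x. cutw R x ^ (m' + m) * (cmod (u x) * cmod (u1 x)))" by simp
    also have "\<dots> \<le> 8 * real m * (cutnorm R m' u * cutnorm R m u1)"
      by (intro mult_left_mono cutnorm_mult_le sq i1) auto
    finally show ?thesis .
  qed
  have t2: "cmod I2 \<le> cutnorm R (Suc m) u * cutnorm R m' w"
  proof -
    have "cmod I2 \<le> integral {-R..R} (\<lambda>x. cutw R x ^ (Suc m + m') * (cmod (u x) * cmod (w x)))"
      unfolding I2_def
    proof (rule integral_norm_bound_integral[OF set_lebesgue_integral_eq_integral(1)[OF i2a] i2])
      show "norm (F x * cnj (w x)) \<le> cutw R x ^ (Suc m + m') * (cmod (u x) * cmod (w x))" for x
        by (simp only: nF order_refl)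
    qed
    also have "\<dots> \<le> cutnorm R (Suc m) u * cutnorm R m' w"
      by (intro cutnorm_mult_le sq w(2) i2)
    finally show ?thesis .
  qed
  have t3: "cutnorm R m' u \<le> cutnorm R (Suc m) u + cutnorm R 0 u"
  proof (rule power2_le_imp_le)
    have "(cutnorm R m' u)\<^sup>2 \<le> integral {-R..R} (\<lambda>x. cutw R x ^ (2 * Suc m) * (cmod (u x))\<^sup>2
      + cutw R x ^ (2 * 0) * (cmod (u x))\<^sup>2)"
      unfolding cutnorm_sq[OF sq(1)]
    proof (rule integral_le)
      show "cutw R x ^ (2 * m') * (cmod (u x))\<^sup>2 \<le> cutw R x ^ (2 * Suc m) * (cmod (u x))\<^sup>2
        + cutw R x ^ (2 * 0) * (cmod (u x))\<^sup>2"
        if x: "x \<in> {-R..R}" for x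
      proof -
        have "cutw R x ^ (2 * m') \<le> cutw R x ^ (2 * Suc m) + 1"
        proof (cases "cutw R x \<le> 1")
          case True
          have "cutw R x ^ (2 * m') \<le> 1" using cutw_bounds(1)[OF R x] True by (intro power_le_one) auto
          moreover have "0 \<le> cutw R x ^ (2 * Suc m)" by (simp only: power_mult zero_le_power zero_le_power2)
          ultimately show ?thesis by linarith
        next
          case False
          then have "cutw R x ^ (2 * m') \<le> cutw R x ^ (2 * Suc m)" using m by (intro power_increasing) auto
          then show ?thesis by linarith
        qed
        then have "cutw R x ^ (2 * m') * (cmod (u x))\<^sup>2 \<le> (cutw R x ^ (2 * Suc m) + 1) * (cmod (u x))\<^sup>2"
          by (intro mult_right_mono) auto
        then show ?thesis by (simp add: distrib_right)
      qed
    qed (intro integrable_add cutnorm_integrable sq)+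
    also have "\<dots> = (cutnorm R (Suc m) u)\<^sup>2 + (cutnorm R 0 u)\<^sup>2"
      unfolding cutnorm_sq[OF sq(1)] by (intro Henstock_Kurzweil_Integration.integral_add cutnorm_integrable sq)
    also have "\<dots> \<le> (cutnorm R (Suc m) u + cutnorm R 0 u)\<^sup>2"
      using cutnorm_nonneg[of R "Suc m" u] cutnorm_nonneg[of R 0 u] by (simp add: power2_sum)
    finally show "(cutnorm R m' u)\<^sup>2 \<le> (cutnorm R (Suc m) u + cutnorm R 0 u)\<^sup>2" .
    show "0 \<le> cutnorm R (Suc m) u + cutnorm R 0 u" using cutnorm_nonneg by simp
  qed
  have "8 * real m * (cutnorm R m' u * cutnorm R m u1) \<le> 8 * real m * ((cutnorm R (Suc m) u
    + cutnorm R 0 u) * cutnorm R m u1)"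
    using t3 cutnorm_nonneg by (intro mult_left_mono mult_right_mono) auto
  then show ?thesis using total t1 t2 by (simp add: mult.assoc)
qed

text \<open>Each hypothesis in \<open>st\<close> gives \<open>b(k) \<le> \<eta> b(k + 1) + (1 / \<eta> + 32) (b(k - 1) + S)\<close> for every \<open>\<eta> > 0\<close>. The values
  of \<open>\<eta>\<close> are chosen from \<open>k = 4\<close> downwards so that the terms \<open>b(k + 1)\<close> can be absorbed successively.\<close>

lemma interpolation_chain:
  fixes b0 b1 b2 b3 b4 b5 S :: real
  assumes nn: "0 \<le> b0" "0 \<le> b1" "0 \<le> b2" "0 \<le> b3" "0 \<le> b4" "0 \<le> b5" "0 \<le> S"
    and ends: "b0 \<le> S" "b5 \<le> S"
    and st: "b1\<^sup>2 \<le> b0 * b2 + 32 * (b0 + S) * b1" "b2\<^sup>2 \<le> b1 * b3 + 32 * (b1 + S) * b2"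
      "b3\<^sup>2 \<le> b2 * b4 + 32 * (b2 + S) * b3" "b4\<^sup>2 \<le> b3 * b5 + 32 * (b3 + S) * b4"
  shows "b1 \<le> 10 ^ 11 * S" "b2 \<le> 10 ^ 11 * S" "b3 \<le> 10 ^ 11 * S" "b4 \<le> 10 ^ 11 * S"
proof -
  have lin: "y \<le> \<eta> * z + (1 / \<eta> + 32) * (x + S)"
    if "y\<^sup>2 \<le> x * z + 32 * (x + S) * y" "0 \<le> x" "0 \<le> y" "0 \<le> z" "0 < \<eta>" for x y z \<eta> :: real
  proof (rule ccontr)
    assume "\<not> ?thesis"
    then have c: "y > \<eta> * z + (1 / \<eta> + 32) * (x + S)" by simp
    define p where "p = y - 32 * (x + S)"
    have nn': "x / \<eta> \<ge> 0" "S / \<eta> \<ge> 0" "\<eta> * z \<ge> 0" "x + S \<ge> 0" using that nn by auto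
    have "\<eta> * z + x / \<eta> + S / \<eta> + 32 * (x + S) < y"
      using c by (simp add: algebra_simps add_divide_distrib)
    then have "p > \<eta> * z + x / \<eta> + S / \<eta>" by (simp add: p_def)
    then have p: "p > \<eta> * z" "p > x / \<eta>" "p \<ge> 0" using nn' by linarith+
    have "y \<ge> p" using nn'(4) by (simp add: p_def)
    have "x * z = (\<eta> * z) * (x / \<eta>)" using that by simp
    also have "\<dots> < p * p"
      using p nn' by (intro mult_strict_mono') auto
    also have "\<dots> \<le> y * p" using p \<open>y \<ge> p\<close> by (intro mult_right_mono) auto
    also have "\<dots> = y\<^sup>2 - 32 * (x + S) * y" by (simp add: p_def power2_eq_square algebra_simps)
    finally show False using that(1) by simp
  qed
  have l1: "b1 \<le> (1/1696) * b2 + 1728 * (b0 + S)" using lin[OF st(1), of "1/1696"] nn by simp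
  have l2: "b2 \<le> (1/392) * b3 + 424 * (b1 + S)" using lin[OF st(2), of "1/392"] nn by simp
  have l3: "b3 \<le> (1/66) * b4 + 98 * (b2 + S)" using lin[OF st(3), of "1/66"] nn by simp
  have l4: "b4 \<le> b5 + 33 * (b3 + S)" using lin[OF st(4), of 1] nn by simp
  show "b1 \<le> 10 ^ 11 * S" "b2 \<le> 10 ^ 11 * S" "b3 \<le> 10 ^ 11 * S" "b4 \<le> 10 ^ 11 * S"
    using l1 l2 l3 l4 ends nn by auto
qed

lemma Sigma_norm_bounds:
  assumes "g \<in> Sigma_space n"
  shows "0 \<le> Sigma_norm n g" "k \<le> n \<Longrightarrow> L2_norm (weak_deriv k g) \<le> Sigma_norm n g"
    "L2_norm (\<lambda>x. jap x ^ n *\<^sub>R g x) \<le> Sigma_norm n g"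
proof -
  have L: "0 \<le> L2_norm f" for f unfolding L2_norm_def by simp
  have So: "0 \<le> Sobolev_norm n g" unfolding Sobolev_norm_def by (simp add: sum_nonneg)
  show "0 \<le> Sigma_norm n g" using L So by (simp add: Sigma_norm_def)
  show "L2_norm (\<lambda>x. jap x ^ n *\<^sub>R g x) \<le> Sigma_norm n g" using So by (simp add: Sigma_norm_def)
  show "L2_norm (weak_deriv k g) \<le> Sigma_norm n g" if "k \<le> n"
  proof -
    have "(L2_norm (weak_deriv k g))\<^sup>2 \<le> (\<Sum>k\<le>n. (L2_norm (weak_deriv k g))\<^sup>2)"
      by (rule member_le_sum) (use that in auto)
    then have "sqrt ((L2_norm (weak_deriv k g))\<^sup>2) \<le> Sobolev_norm n g"
      unfolding Sobolev_norm_def by (rule real_sqrt_le_mono)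
    then show ?thesis by (simp add: Sigma_norm_def add_increasing2 L)
  qed
qed

lemma integral_sq_le_L2_norm:
  assumes f: "f \<in> L2" and ae: "AE x in lebesgue. cmod (f x) = u x"
  shows "integral {a..b} (\<lambda>x. (u x)\<^sup>2) \<le> (L2_norm f)\<^sup>2"
proof -
  have i: "integrable lebesgue (\<lambda>x. (cmod (f x))\<^sup>2)" using f by (simp add: L2_def)
  obtain N where N: "negligible N" "\<And>x. x \<notin> N \<Longrightarrow> cmod (f x) = u x"
    using ae unfolding eventually_ae_filter_negligible by blast
  have "integral {a..b} (\<lambda>x. (u x)\<^sup>2) = integral {a..b} (\<lambda>x. (cmod (f x))\<^sup>2)"
    by (rule integral_spike[OF N(1)]) (use N(2) in auto)
  also have "\<dots> \<le> integral UNIV (\<lambda>x. (cmod (f x))\<^sup>2)"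
    by (intro integral_subset_le L2_sq_integrable_on f) auto
  also have "\<dots> = (LINT x|lebesgue. (cmod (f x))\<^sup>2)"
    by (rule integral_lebesgue[OF i])
  also have "\<dots> = (L2_norm f)\<^sup>2" unfolding L2_norm_def by (simp add: integral_nonneg_AE)
  finally show ?thesis .
qed

text \<open>On \<open>{-R..R}\<close> the weight is at most twice the weight cut off at \<open>2 R + 1\<close>, which reduces the claim to
  bounds of \<open>cutnorm\<close>.\<close>

lemma Sigma_weighted_bounds:
  assumes g: "g \<in> Sigma_space 5"
    and G: "\<And>k. k \<le> 4 \<Longrightarrow> continuous_on UNIV (G k)"
    "\<And>k. k \<le> 4 \<Longrightarrow> AE x in lebesgue. weak_deriv k g x = G k x"
    "AE x in lebesgue. g x = G 0 x"
    "\<And>k x. k < 4 \<Longrightarrow> (G k has_vector_derivative G (Suc k) x) (at x)"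
    "\<And>a b. a \<le> b \<Longrightarrow> G 4 b - G 4 a = integral {a..b} (weak_deriv 5 g)"
    and k: "k \<le> 4"
  shows "integral {-R..R} (\<lambda>x. jap x ^ (2 * (5 - k)) * (cmod (G k x))\<^sup>2) \<le> (32 * 10 ^ 11 * Sigma_norm 5 g)\<^sup>2"
proof (cases "R \<ge> 0")
  case False
  then show ?thesis by simp
next
  case R0: True
  define S where "S = Sigma_norm 5 g"
  have S: "0 \<le> S" using Sigma_norm_bounds(1)[OF g] by (simp add: S_def)
  \<comment> \<open>On \<open>{-R..R}\<close> the cutoff at \<open>Q\<close> is at least \<open>3 / 4\<close>.\<close>
  define Q where "Q = 2 * R + 1"
  have Q: "1 \<le> Q" "0 \<le> Q" using R0 by (auto simp: Q_def)
  define w where "w = weak_deriv 5 g"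
  have gS: "g \<in> Sobolev 5" using g by (simp add: Sigma_space_def)
  have wk: "weak_deriv k g \<in> L2" if "k \<le> 5" for k using weak_deriv_spec(1)[OF gS that] .
  have wl: "locally_absint w" unfolding w_def by (rule L2_locally_absint[OF wk]) simp
  have sqw: "(\<lambda>x. (cmod (w x))\<^sup>2) integrable_on {-Q..Q}" unfolding w_def by (rule L2_sq_integrable_on[OF wk]) simp
  have cG: "continuous_on A (G k)" if "k \<le> 4" for k A using G(1)[OF that] continuous_on_subset by blast
  have sqG: "(\<lambda>x. (cmod (G k x))\<^sup>2) integrable_on {-Q..Q}" if "k \<le> 4" for k
    by (intro integrable_continuous_real continuous_intros cG that)
  have cn0: "cutnorm Q 0 (G k) \<le> S" if "k \<le> 4" for k
  proof -
    have "integral {-Q..Q} (\<lambda>x. (cmod (G k x))\<^sup>2) \<le> (L2_norm (weak_deriv k g))\<^sup>2"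
      by (rule integral_sq_le_L2_norm[OF wk]) (use that G(2)[OF that] in \<open>auto elim: eventually_mono\<close>)
    also have "\<dots> \<le> S\<^sup>2" unfolding S_def
      using that by (intro power_mono Sigma_norm_bounds(2)[OF g]) (auto simp: L2_norm_def)
    finally have "(cutnorm Q 0 (G k))\<^sup>2 \<le> S\<^sup>2" using cutnorm_sq[OF sqG[OF that], of 0] by simp
    then show ?thesis using S by (rule power2_le_imp_le)
  qed
  have b5: "cutnorm Q 0 w \<le> S"
  proof -
    have "integral {-Q..Q} (\<lambda>x. (cmod (w x))\<^sup>2) \<le> (L2_norm w)\<^sup>2"
      unfolding w_def by (rule integral_sq_le_L2_norm[OF wk]) auto
    also have "\<dots> \<le> S\<^sup>2" unfolding S_def w_def
      by (intro power_mono Sigma_norm_bounds(2)[OF g]) (auto simp: L2_norm_def)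
    finally have "(cutnorm Q 0 w)\<^sup>2 \<le> S\<^sup>2" using cutnorm_sq[OF sqw, of 0] by simp
    then show ?thesis using S by (rule power2_le_imp_le)
  qed
  have b0: "cutnorm Q 5 (G 0) \<le> S"
  proof -
    have "integral {-Q..Q} (\<lambda>x. cutw Q x ^ (2 * 5) * (cmod (G 0 x))\<^sup>2)
      \<le> integral {-Q..Q} (\<lambda>x. (jap x ^ 5 * cmod (G 0 x))\<^sup>2)"
    proof (rule integral_le)
      show "(\<lambda>x. cutw Q x ^ (2 * 5) * (cmod (G 0 x))\<^sup>2) integrable_on {-Q..Q}" by (rule cutnorm_integrable[OF sqG]) simp
      show "(\<lambda>x. (jap x ^ 5 * cmod (G 0 x))\<^sup>2) integrable_on {-Q..Q}"
        by (intro integrable_continuous_real continuous_intros cG) simp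
      show "cutw Q x ^ (2 * 5) * (cmod (G 0 x))\<^sup>2 \<le> (jap x ^ 5 * cmod (G 0 x))\<^sup>2" if "x \<in> {-Q..Q}" for x
      proof -
        have "cutw Q x ^ (2 * 5) \<le> jap x ^ (2 * 5)" using cutw_bounds[OF Q(1) that] by (intro power_mono) auto
        then have "cutw Q x ^ (2 * 5) * (cmod (G 0 x))\<^sup>2 \<le> jap x ^ (2 * 5) * (cmod (G 0 x))\<^sup>2"
          by (intro mult_right_mono) auto
        also have "\<dots> = (jap x ^ 5 * cmod (G 0 x))\<^sup>2" by (simp add: power_mult_distrib flip: power_mult)
        finally show ?thesis .
      qed
    qed
    also have "\<dots> \<le> (L2_norm (\<lambda>x. jap x ^ 5 *\<^sub>R g x))\<^sup>2"
    proof (rule integral_sq_le_L2_norm)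
      show "(\<lambda>x. jap x ^ 5 *\<^sub>R g x) \<in> L2" using g by (simp add: Sigma_space_def)
      show "AE x in lebesgue. cmod (jap x ^ 5 *\<^sub>R g x) = jap x ^ 5 * cmod (G 0 x)"
        using G(3) by eventually_elim (simp add: abs_of_pos jap_pos(2))
    qed
    also have "\<dots> \<le> S\<^sup>2" unfolding S_def
      by (intro power_mono Sigma_norm_bounds(3)[OF g]) (auto simp: L2_norm_def)
    finally have "(cutnorm Q 5 (G 0))\<^sup>2 \<le> S\<^sup>2" using cutnorm_sq[OF sqG[of 0], of 5] by simp
    then show ?thesis using S by (rule power2_le_imp_le)
  qed
  have inc: "G k b - G k a = integral {a..b} (G (Suc k))" if "k < 4" "a \<le> b" for k a b
    by (rule integral_unique[symmetric], rule fundamental_theorem_of_calculus[OF that(2)])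
       (use G(4)[OF that(1)] in \<open>auto intro: has_vector_derivative_at_within\<close>)
  define b where "b = (\<lambda>k. cutnorm Q (5 - k) (G k))"
  have lG: "locally_absint (G k)" if "k \<le> 4" for k using G(1)[OF that] by (rule locally_absint_continuous)
  have le32: "x\<^sup>2 \<le> p + 32 * (y + S) * x"
    if "x\<^sup>2 \<le> p + 8 * c * (y + d) * x" "c \<le> 4" "0 \<le> c" "d \<le> S" "0 \<le> y" "0 \<le> x" "0 \<le> d" for x p c y d :: real
  proof -
    have "8 * c * (y + d) * x \<le> 32 * (y + S) * x" using that by (intro mult_right_mono mult_mono) auto
    then show ?thesis using that(1) by linarith
  qed
  have st: "(b (Suc k))\<^sup>2 \<le> b k * b (Suc (Suc k)) + 32 * (b k + S) * b (Suc k)" if "k < 3" for k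
  proof -
    have m: "5 - Suc k = Suc (5 - Suc (Suc k))" "Suc (5 - Suc k) = 5 - k" using that by auto
    have "(cutnorm Q (5 - Suc k) (G (Suc k)))\<^sup>2 \<le> cutnorm Q (Suc (5 - Suc k)) (G k) * cutnorm Q (5
      - Suc (Suc k)) (G (Suc (Suc k)))
      + 8 * real (5 - Suc k) * (cutnorm Q (Suc (5 - Suc k)) (G k) + cutnorm Q 0 (G k)) * cutnorm Q (5
        - Suc k) (G (Suc k))"
      by (rule cutnorm_step[OF Q(1) m(1)]) (use that G(1,4) lG sqG inc in auto)
    then show ?thesis unfolding m(2) b_def by (rule le32) (use that cn0[of k] cutnorm_nonneg in auto)
  qed
  have st4: "(b 4)\<^sup>2 \<le> b 3 * cutnorm Q 0 w + 32 * (b 3 + S) * b 4"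
  proof -
    have "(cutnorm Q 1 (G 4))\<^sup>2 \<le> cutnorm Q (Suc 1) (G 3) * cutnorm Q 0 w
      + 8 * real 1 * (cutnorm Q (Suc 1) (G 3) + cutnorm Q 0 (G 3)) * cutnorm Q 1 (G 4)"
    proof (rule cutnorm_step[OF Q(1)])
      show "(G 3 has_vector_derivative G 4 x) (at x)" for x using G(4)[of 3 x] by simp
    qed (use G(1)[of 4] wl sqw G(5) in \<open>auto simp: w_def\<close>)
    then have "(cutnorm Q 1 (G 4))\<^sup>2 \<le> cutnorm Q (Suc 1) (G 3) * cutnorm Q 0 w + 32 * (cutnorm Q (Suc 1) (G 3)
      + S) * cutnorm Q 1 (G 4)"
      by (rule le32) (use cn0[of 3] cutnorm_nonneg in auto)
    moreover have "Suc 1 = (2::nat)" by simp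
    ultimately show ?thesis by (simp add: b_def numeral_2_eq_2)
  qed
  have bn: "0 \<le> b k" for k by (simp add: b_def cutnorm_nonneg)
  have bS: "b k \<le> 10 ^ 11 * S"
  proof -
    have b0': "b 0 \<le> S" using b0 by (simp add: b_def)
    have s: "(b 1)\<^sup>2 \<le> b 0 * b 2 + 32 * (b 0 + S) * b 1" "(b 2)\<^sup>2 \<le> b 1 * b 3 + 32 * (b 1 + S) * b 2"
      "(b 3)\<^sup>2 \<le> b 2 * b 4 + 32 * (b 2 + S) * b 3"
      using st[of 0] st[of 1] st[of 2] by (simp_all add: eval_nat_numeral)
    note ic = interpolation_chain[OF bn bn bn bn bn cutnorm_nonneg S b0' b5 s st4]
    consider "k = 0" | "k = 1" | "k = 2" | "k = 3" | "k = 4" using k by linarith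
    then show ?thesis using ic b0' S by cases auto
  qed
  have "integral {-R..R} (\<lambda>x. jap x ^ (2 * (5 - k)) * (cmod (G k x))\<^sup>2)
      \<le> integral {-R..R} (\<lambda>x. 32\<^sup>2 * (cutw Q x ^ (2 * (5 - k)) * (cmod (G k x))\<^sup>2))"
  proof (rule integral_le)
    show "(\<lambda>x. jap x ^ (2 * (5 - k)) * (cmod (G k x))\<^sup>2) integrable_on {-R..R}"
      by (intro integrable_continuous_real continuous_intros cG k)
    show "(\<lambda>x. 32\<^sup>2 * (cutw Q x ^ (2 * (5 - k)) * (cmod (G k x))\<^sup>2)) integrable_on {-R..R}"
      by (intro integrable_continuous_real continuous_intros continuous_on_cutw cG k)
    show "jap x ^ (2 * (5 - k)) * (cmod (G k x))\<^sup>2 \<le> 32\<^sup>2 * (cutw Q x ^ (2 * (5 - k)) * (cmod (G k x))\<^sup>2)"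
      if x: "x \<in> {-R..R}" for x
    proof -
      have half: "jap x \<le> 2 * cutw Q x"
      proof -
        have "\<bar>x\<bar> \<le> R" using x by auto
        then have "(2 * \<bar>x\<bar>)\<^sup>2 \<le> Q\<^sup>2" using R0 by (intro power_mono) (auto simp: Q_def)
        then have "4 * x\<^sup>2 \<le> Q\<^sup>2" by (simp add: power_mult_distrib)
        then have "2 * x\<^sup>2 \<le> Q\<^sup>2" using zero_le_power2[of x] by linarith
        then have "x\<^sup>2 / Q\<^sup>2 \<le> 1 / 2" using Q by (simp add: divide_le_eq)
        moreover have "1 \<le> 2 * (1 - r)" if "r \<le> 1 / 2" for r :: real using that by simp
        ultimately have "1 \<le> 2 * (1 - x\<^sup>2 / Q\<^sup>2)" by blast
        from mult_left_mono[OF this, of "jap x"] have "jap x * 1 \<le> jap x * (2 * (1 - x\<^sup>2 / Q\<^sup>2))"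
          using jap_pos(2)[of x] by simp
        then show ?thesis by (simp only: cutw_def mult_1_right mult.left_commute[of 2])
      qed
      have "jap x ^ (2 * (5 - k)) \<le> (2 * cutw Q x) ^ (2 * (5 - k))"
        using half jap_pos(2)[of x] by (intro power_mono) auto
      also have "\<dots> = 2 ^ (2 * (5 - k)) * cutw Q x ^ (2 * (5 - k))" by (rule power_mult_distrib)
      also have "\<dots> \<le> 2 ^ 10 * cutw Q x ^ (2 * (5 - k))"
      proof (rule mult_right_mono)
        show "(2::real) ^ (2 * (5 - k)) \<le> 2 ^ 10" by (rule power_increasing) auto
        show "0 \<le> cutw Q x ^ (2 * (5 - k))" by (simp add: power_mult)
      qed
      finally have "jap x ^ (2 * (5 - k)) * (cmod (G k x))\<^sup>2 \<le> 2 ^ 10 * cutw Q x ^ (2 * (5 - k)) * (cmod (G k x))\<^sup>2"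
        by (intro mult_right_mono) auto
      then show ?thesis by (simp add: mult.assoc)
    qed
  qed
  also have "\<dots> = 32\<^sup>2 * integral {-R..R} (\<lambda>x. cutw Q x ^ (2 * (5 - k)) * (cmod (G k x))\<^sup>2)" by simp
  also have "\<dots> \<le> 32\<^sup>2 * integral {-Q..Q} (\<lambda>x. cutw Q x ^ (2 * (5 - k)) * (cmod (G k x))\<^sup>2)"
    using R0 by (intro mult_left_mono integral_subset_le integrable_continuous_real continuous_intros
      continuous_on_cutw cG k)
      (auto simp: Q_def power_mult)
  also have "\<dots> = 32\<^sup>2 * (b k)\<^sup>2" unfolding b_def cutnorm_sq[OF sqG[OF k]] ..
  also have "\<dots> \<le> 32\<^sup>2 * (10 ^ 11 * S)\<^sup>2" using bS bn by (intro mult_left_mono power_mono) auto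
  finally show ?thesis by (simp add: S_def power_mult_distrib)
qed

section \<open>Pointwise consistency of the discrete operator\<close>

lemma increment_le_integral:
  fixes f f' :: "real \<Rightarrow> complex"
  assumes f: "\<And>x. (f has_vector_derivative f' x) (at x)" and c: "continuous_on UNIV f'"
    and xy: "x \<in> {A..B}" "y \<in> {A..B}"
  shows "cmod (f y - f x) \<le> integral {A..B} (\<lambda>t. cmod (f' t))"
proof -
  have cc: "continuous_on S f'" for S using c continuous_on_subset by blast
  have *: "cmod (f y - f x) \<le> integral {A..B} (\<lambda>t. cmod (f' t))" if "x \<le> y" "x \<in> {A..B}" "y \<in> {A..B}" for x y
  proof -
    have "(f' has_integral f y - f x) {x..y}"
      by (rule fundamental_theorem_of_calculus[OF that(1)]) (rule has_vector_derivative_at_within[OF f])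
    then have "f y - f x = integral {x..y} f'" by (rule integral_unique[symmetric])
    then have "cmod (f y - f x) \<le> integral {x..y} (\<lambda>t. cmod (f' t))"
      by (simp only:) (intro integral_norm_bound_integral integrable_continuous_real continuous_intros cc order_refl)
    also have "\<dots> \<le> integral {A..B} (\<lambda>t. cmod (f' t))"
      using that by (intro integral_subset_le integrable_continuous_real continuous_intros cc) auto
    finally show ?thesis .
  qed
  show ?thesis using *[of x y] *[of y x] xy by (cases "x \<le> y") (auto simp: norm_minus_commute)
qed

lemma growth_from_zero:
  fixes f f' :: "real \<Rightarrow> complex"
  assumes "\<And>x. (f has_vector_derivative f' x) (at x)" "f 0 = 0"
    and "\<And>x. x \<in> {0..h} \<Longrightarrow> cmod (f' x) \<le> B" "t \<in> {0..h}" "0 \<le> B"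
  shows "cmod (f t) \<le> B * h"
proof -
  have "(f' has_integral f t - f 0) {0..t}"
    using assms(4) by (intro fundamental_theorem_of_calculus) (auto intro: has_vector_derivative_at_within assms(1))
  then have "cmod (f t - f 0) \<le> B * measure lborel (cbox 0 t)"
    using assms(3,4,5) by (intro has_integral_bound[of B f']) auto
  also have "\<dots> \<le> B * h" using assms(4,5) by (intro mult_left_mono) auto
  finally show ?thesis using assms(2) by simp
qed

text \<open>A pointwise value is the sum of an average and an increment.\<close>

lemma point_value_le_integral:
  fixes f f' :: "real \<Rightarrow> complex"
  assumes f: "\<And>x. (f has_vector_derivative f' x) (at x)" and c: "continuous_on UNIV f'" and h: "0 < h" "h \<le> 1"
  shows "cmod (f a) \<le> 1 / h * (integral {a - h..a + h} (\<lambda>t. cmod (f t)) + integral {a - h..a + h} (\<lambda>t. cmod (f' t)))"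
proof -
  define I where "I = integral {a - h..a + h} (\<lambda>t. cmod (f t))"
  define I' where "I' = integral {a - h..a + h} (\<lambda>t. cmod (f' t))"
  have cf: "continuous_on S f" for S using f
    by (meson continuous_at_imp_continuous_on has_vector_derivative_continuous)
  have cc: "continuous_on S f'" for S using c continuous_on_subset by blast
  have nn: "0 \<le> I" "0 \<le> I'" unfolding I_def I'_def
    by (intro Henstock_Kurzweil_Integration.integral_nonneg integrable_continuous_real continuous_intros cf cc; simp)+
  have "integral {a - h..a + h} (\<lambda>t. cmod (f a) - I') \<le> I"
    unfolding I_def
  proof (rule integral_le)
    show "cmod (f a) - I' \<le> cmod (f t)" if "t \<in> {a - h..a + h}" for t
      using increment_le_integral[OF f c, of t "a - h" "a + h" a] that h norm_triangle_ineq2[of "f a" "f t"]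
      unfolding I'_def by auto
  qed (intro integrable_continuous_real continuous_intros cf)+
  then have "2 * h * (cmod (f a) - I') \<le> I" using h by simp
  then have "2 * h * cmod (f a) \<le> I + 2 * h * I'" by (simp add: algebra_simps)
  also have "\<dots> \<le> 2 * I + 2 * 1 * I'" using h nn by (intro add_mono mult_right_mono) auto
  finally have "h * cmod (f a) \<le> I + I'" by simp
  then show ?thesis using h unfolding I_def[symmetric] I'_def[symmetric] by (simp add: field_simps)
qed

text \<open>Both bounds follow by integrating from \<open>0\<close> to \<open>h\<close> in the step size, starting from bounds of the highest
  derivative of the difference.\<close>

lemma second_difference_bounds:
  fixes G :: "nat \<Rightarrow> real \<Rightarrow> complex"
  assumes G: "\<And>k. k \<le> 4 \<Longrightarrow> continuous_on UNIV (G k)" "\<And>k x. k < 4 \<Longrightarrow> (G k has_vector_derivative G (Suc k) x) (at x)"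
    and h: "0 < h"
  shows "cmod (G 0 (a + h) + G 0 (a - h) - 2 * G 0 a) \<le> h * integral {a - h..a + h} (\<lambda>t. cmod (G 2 t))"
    and "cmod (G 0 (a + h) + G 0 (a - h) - 2 * G 0 a - of_real (h\<^sup>2) * G 2 a) \<le> h ^ 3 * integral {a - h..a
      + h} (\<lambda>t. cmod (G 4 t))"
proof -
  have nn: "0 \<le> integral {a - h..a + h} (\<lambda>t. cmod (G k t))" if "k \<le> 4" for k
    by (intro Henstock_Kurzweil_Integration.integral_nonneg integrable_continuous_real continuous_intros
        continuous_on_subset[OF G(1)[OF that]]) auto
  have lin: "((\<lambda>t. a + t) has_vector_derivative 1) (at t)" "((\<lambda>t. a - t) has_vector_derivative - 1) (at t)" for t
    by (auto intro!: derivative_eq_intros)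
  have dp: "((\<lambda>t. G k (a + t)) has_vector_derivative G (Suc k) (a + t)) (at t)" if "k < 4" for k t
    using vector_diff_chain_at[OF lin(1) G(2)[OF that, of "a + t"]] by (simp add: o_def)
  have dm: "((\<lambda>t. G k (a - t)) has_vector_derivative - G (Suc k) (a - t)) (at t)" if "k < 4" for k t
    using vector_diff_chain_at[OF lin(2) G(2)[OF that, of "a - t"]] by (simp add: o_def)
  have inc: "cmod (G k (a + t) - G k (a - t)) \<le> integral {a - h..a + h} (\<lambda>t. cmod (G (Suc k) t))"
    if "k < 4" "t \<in> {0..h}" for k t
    using that by (intro increment_le_integral G) auto
  show "cmod (G 0 (a + h) + G 0 (a - h) - 2 * G 0 a) \<le> h * integral {a - h..a + h} (\<lambda>t. cmod (G 2 t))"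
  proof -
    have "cmod (G 0 (a + h) + G 0 (a - h) - 2 * G 0 a) \<le> integral {a - h..a + h} (\<lambda>t. cmod (G 2 t)) * h"
    proof (rule growth_from_zero[where f = "\<lambda>t. G 0 (a + t) + G 0 (a - t) - 2 * G 0 a" and f' = "\<lambda>t. G 1 (a + t)
      - G 1 (a - t)"])
      show "((\<lambda>t. G 0 (a + t) + G 0 (a - t) - 2 * G 0 a) has_vector_derivative G 1 (a + t) - G 1 (a - t)) (at t)" for t
        using has_vector_derivative_diff[OF has_vector_derivative_add[OF dp[of 0 t] dm[of 0 t]]
          has_vector_derivative_const[of "2 * G 0 a"]] by simp
      show "cmod (G 1 (a + x) - G 1 (a - x)) \<le> integral {a - h..a + h} (\<lambda>t. cmod (G 2 t))" if "x \<in> {0..h}" for x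
        using inc[of 1 x] that by (simp add: eval_nat_numeral)
    qed (use h nn[of 2] in auto)
    then show ?thesis by (simp add: mult.commute)
  qed
  show "cmod (G 0 (a + h) + G 0 (a - h) - 2 * G 0 a - of_real (h\<^sup>2) * G 2 a) \<le> h ^ 3 * integral {a - h..a
    + h} (\<lambda>t. cmod (G 4 t))"
  proof -
    define I where "I = integral {a - h..a + h} (\<lambda>t. cmod (G 4 t))"
    have I: "0 \<le> I" using nn[of 4] by (simp add: I_def)
    have d: "(G 0 has_vector_derivative G 1 x) (at x)" "(G 1 has_vector_derivative G 2 x) (at x)"
      "(G 2 has_vector_derivative G 3 x) (at x)" for x
      using G(2)[of 0 x] G(2)[of 1 x] G(2)[of 2 x] by (simp_all add: eval_nat_numeral)
    have s2: "cmod (G 2 (a + t) + G 2 (a - t) - 2 * G 2 a) \<le> I * h" if "t \<in> {0..h}" for t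
    proof (rule growth_from_zero[where f = "\<lambda>t. G 2 (a + t) + G 2 (a - t) - 2 * G 2 a" and f' = "\<lambda>t. G 3 (a + t)
      - G 3 (a - t)"])
      show "((\<lambda>t. G 2 (a + t) + G 2 (a - t) - 2 * G 2 a) has_vector_derivative G 3 (a + t) - G 3 (a - t)) (at t)" for t
        using has_vector_derivative_diff[OF has_vector_derivative_add[OF dp[of 2 t] dm[of 2 t]]
          has_vector_derivative_const[of "2 * G 2 a"]]
        by (simp add: eval_nat_numeral)
      show "cmod (G 3 (a + x) - G 3 (a - x)) \<le> I" if "x \<in> {0..h}" for x
        using inc[of 3 x] that by (simp add: I_def eval_nat_numeral)
    qed (use that I in auto)
    have s1: "cmod (G 1 (a + t) - G 1 (a - t) - of_real (2 * t) * G 2 a) \<le> I * h * h" if "t \<in> {0..h}" for t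
    proof (rule growth_from_zero[where f = "\<lambda>t. G 1 (a + t) - G 1 (a - t) - of_real (2 * t) * G 2 a" and f'
      = "\<lambda>t. G 2 (a + t) + G 2 (a - t) - 2 * G 2 a"])
      show "((\<lambda>t. G 1 (a + t) - G 1 (a - t) - of_real (2 * t) * G 2 a) has_vector_derivative G 2 (a + t)
        + G 2 (a - t) - 2 * G 2 a) (at t)" for t
      proof -
        have "((\<lambda>t. complex_of_real (2 * t) * G 2 a) has_vector_derivative 2 * G 2 a) (at t)"
          by (auto intro!: derivative_eq_intros)
        from has_vector_derivative_diff[OF has_vector_derivative_diff[OF dp[of 1 t] dm[of 1 t]] this]
        show ?thesis by (simp add: eval_nat_numeral)
      qed
    qed (use that I h s2 in auto)
    have "cmod (G 0 (a + h) + G 0 (a - h) - 2 * G 0 a - of_real (h\<^sup>2) * G 2 a) \<le> I * h * h * h"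
    proof (rule growth_from_zero[where f = "\<lambda>t. G 0 (a + t) + G 0 (a - t) - 2 * G 0 a - of_real (t\<^sup>2) * G 2 a"
      and f' = "\<lambda>t. G 1 (a + t) - G 1 (a - t) - of_real (2 * t) * G 2 a"])
      show "((\<lambda>t. G 0 (a + t) + G 0 (a - t) - 2 * G 0 a - of_real (t\<^sup>2) * G 2 a) has_vector_derivative G 1 (a
        + t) - G 1 (a - t) - of_real (2 * t) * G 2 a) (at t)" for t
      proof -
        have "((\<lambda>t. complex_of_real (t\<^sup>2) * G 2 a) has_vector_derivative of_real (2 * t) * G 2 a) (at t)"
          by (intro has_vector_derivative_mult_left has_vector_derivative_of_real) (auto intro!: derivative_eq_intros)
        from has_vector_derivative_diff[OF has_vector_derivative_diff[OF has_vector_derivative_add[OF dp[of 0 t]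
          dm[of 0 t]] has_vector_derivative_const[of "2 * G 0 a"]] this]
        show ?thesis by simp
      qed
    qed (use I h s1 in auto)
    then show ?thesis by (simp add: I_def power3_eq_cube mult.commute mult.left_commute)
  qed
qed

text \<open>With \<open>s = a h\<close> both coefficients have the form \<open>sqrt (1 + y)\<close>, where \<open>\<bar>y\<bar> \<le> 2 (s\<^sup>2 + h\<^sup>2)\<close>. The third bound uses
  \<open>sqrt (1 + y) - 1 - y / 2 = - (sqrt (1 + y) - 1)\<^sup>2 / 2\<close>.\<close>

lemma hopping_coefficient_bounds:
  fixes a h :: real
  assumes h: "0 < h" "h \<le> 1" and ah: "\<bar>a * h\<bar> \<le> 1"
  defines "p \<equiv> sqrt ((1 + a * h + h\<^sup>2) * (1 - a * h))"
  defines "q \<equiv> sqrt ((1 - a * h + h\<^sup>2) * (1 + a * h))"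
  shows "\<bar>(p + q) / 2 - 1\<bar> \<le> 2 * h\<^sup>2 * (1 + a\<^sup>2)"
    and "\<bar>(p - q) / 2\<bar> \<le> 16 * h ^ 3 * (1 + a\<^sup>2)\<^sup>2"
    and "\<bar>(p + q - 2) / h\<^sup>2 + a\<^sup>2 - 1\<bar> \<le> 4 * h\<^sup>2 * (1 + a\<^sup>2)\<^sup>2"
proof -
  define s where "s = a * h"
  define K where "K = h\<^sup>2 * (1 + a\<^sup>2)"
  define y where "y = - s\<^sup>2 + h\<^sup>2 - s * h\<^sup>2"
  define z where "z = - s\<^sup>2 + h\<^sup>2 + s * h\<^sup>2"
  have K: "K = s\<^sup>2 + h\<^sup>2" by (simp add: K_def s_def power_mult_distrib algebra_simps)
  have s1: "\<bar>s\<bar> \<le> 1" "-1 \<le> s" "s \<le> 1" using ah by (auto simp: s_def)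
  have p2: "p\<^sup>2 = 1 + y" and q2: "q\<^sup>2 = 1 + z" and pq: "0 \<le> p" "0 \<le> q"
  proof -
    have "0 \<le> (1 + s + h\<^sup>2) * (1 - s)" "0 \<le> (1 - s + h\<^sup>2) * (1 + s)" using s1
      by (auto intro!: mult_nonneg_nonneg add_nonneg_nonneg)
    then have "p\<^sup>2 = (1 + s + h\<^sup>2) * (1 - s)" "q\<^sup>2 = (1 - s + h\<^sup>2) * (1 + s)" "0 \<le> p" "0 \<le> q"
      by (auto simp: p_def q_def s_def)
    then show "p\<^sup>2 = 1 + y" "q\<^sup>2 = 1 + z" "0 \<le> p" "0 \<le> q"
      by (auto simp: y_def z_def power2_eq_square algebra_simps)
  qed
  have sh: "\<bar>s * h\<^sup>2\<bar> \<le> h\<^sup>2" using s1 by (simp add: abs_mult mult_left_le_one_le)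
  have yz: "\<bar>y\<bar> \<le> 2 * K" "\<bar>z\<bar> \<le> 2 * K"
  proof -
    have "0 \<le> s\<^sup>2" "0 \<le> h\<^sup>2" "s * h\<^sup>2 \<le> h\<^sup>2" "- (s * h\<^sup>2) \<le> h\<^sup>2" using sh by (auto simp: abs_le_iff)
    then show "\<bar>y\<bar> \<le> 2 * K" "\<bar>z\<bar> \<le> 2 * K"
      unfolding y_def z_def K abs_le_iff distrib_left by (intro conjI; linarith)+
  qed
  have lin: "\<bar>c - 1\<bar> \<le> \<bar>x\<bar>" if "c\<^sup>2 = 1 + x" "0 \<le> c" for c x :: real
  proof -
    have "x = (c - 1) * (c + 1)" using that by (simp add: power2_eq_square algebra_simps)
    then have "\<bar>x\<bar> = \<bar>c - 1\<bar> * (c + 1)" using that by (simp add: abs_mult)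
    moreover have "\<bar>c - 1\<bar> * 1 \<le> \<bar>c - 1\<bar> * (c + 1)" using that by (intro mult_left_mono) auto
    ultimately show ?thesis by simp
  qed
  have p1: "\<bar>p - 1\<bar> \<le> 2 * K" "\<bar>q - 1\<bar> \<le> 2 * K" using lin[OF p2 pq(1)] lin[OF q2 pq(2)] yz by linarith+
  then show "\<bar>(p + q) / 2 - 1\<bar> \<le> 2 * h\<^sup>2 * (1 + a\<^sup>2)" by (simp add: K_def abs_le_iff field_simps)
  have K0: "0 \<le> K" by (simp add: K)
  have sqd: "(p - 1)\<^sup>2 \<le> (2 * K)\<^sup>2" "(q - 1)\<^sup>2 \<le> (2 * K)\<^sup>2"
    using p1 K0 by (metis abs_ge_zero power2_abs power_mono)+
  have X: "(p + q - 2) + s\<^sup>2 - h\<^sup>2 = - (((p - 1)\<^sup>2 + (q - 1)\<^sup>2) / 2)"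
  proof -
    have "(p - 1)\<^sup>2 = 2 + y - 2 * p" "(q - 1)\<^sup>2 = 2 + z - 2 * q" using p2 q2 by (simp_all add: power2_diff)
    then show ?thesis by (simp add: y_def z_def field_simps)
  qed
  have "\<bar>(p + q - 2) + s\<^sup>2 - h\<^sup>2\<bar> = ((p - 1)\<^sup>2 + (q - 1)\<^sup>2) / 2"
    unfolding X abs_minus_cancel by (rule abs_of_nonneg) simp
  also have "\<dots> \<le> 4 * K\<^sup>2" using sqd by (simp add: power_mult_distrib)
  finally have t: "\<bar>(p + q - 2) + s\<^sup>2 - h\<^sup>2\<bar> \<le> 4 * K\<^sup>2" .
  have h2: "h\<^sup>2 > 0" using h by simp
  have "(p + q - 2) / h\<^sup>2 + a\<^sup>2 - 1 = ((p + q - 2) + s\<^sup>2 - h\<^sup>2) / h\<^sup>2"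
    using h by (simp add: s_def field_simps)
  then have "\<bar>(p + q - 2) / h\<^sup>2 + a\<^sup>2 - 1\<bar> = \<bar>(p + q - 2) + s\<^sup>2 - h\<^sup>2\<bar> / h\<^sup>2" by (simp add: abs_divide)
  also have "\<dots> \<le> 4 * K\<^sup>2 / h\<^sup>2" using t h2 by (intro divide_right_mono) auto
  also have "\<dots> = 4 * h\<^sup>2 * (1 + a\<^sup>2)\<^sup>2" using h2 by (simp add: K_def power2_eq_square)
  finally show "\<bar>(p + q - 2) / h\<^sup>2 + a\<^sup>2 - 1\<bar> \<le> 4 * h\<^sup>2 * (1 + a\<^sup>2)\<^sup>2" .
  have a1: "\<bar>a\<bar> \<le> 1 + a\<^sup>2"
  proof -
    have "0 \<le> (\<bar>a\<bar> - 1/2)\<^sup>2 + 3/4" by simp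
    then show ?thesis by (simp add: power2_eq_square algebra_simps)
  qed
  have one: "1 \<le> 1 + a\<^sup>2" by simp
  show "\<bar>(p - q) / 2\<bar> \<le> 16 * h ^ 3 * (1 + a\<^sup>2)\<^sup>2"
  proof (cases "\<bar>s\<bar> \<le> 1 / 2")
    case True
    have half: "1 / 2 \<le> c" if "c\<^sup>2 = 1 + x" "0 \<le> c" "- 3 / 4 \<le> x" for c x :: real
      by (rule power2_le_imp_le) (use that in \<open>auto simp: power2_eq_square\<close>)
    have "s\<^sup>2 \<le> (1/2)\<^sup>2" using True by (metis abs_ge_zero power2_abs power_mono)
    then have "- 3 / 4 \<le> y" "- 3 / 4 \<le> z" using sh unfolding y_def z_def by (auto simp: abs_le_iff power2_eq_square)
    then have "1 / 2 \<le> p" "1 / 2 \<le> q" using half[OF p2 pq(1)] half[OF q2 pq(2)] by auto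
    then have "\<bar>p - q\<bar> * 1 \<le> \<bar>p - q\<bar> * (p + q)" by (intro mult_left_mono) auto
    also have "\<dots> = \<bar>(p - q) * (p + q)\<bar>" using pq by (simp add: abs_mult)
    also have "(p - q) * (p + q) = p\<^sup>2 - q\<^sup>2" by (simp add: power2_eq_square algebra_simps)
    also have "\<bar>p\<^sup>2 - q\<^sup>2\<bar> = 2 * h ^ 3 * \<bar>a\<bar>"
      using h unfolding p2 q2 y_def z_def s_def by (simp add: abs_mult power2_eq_square power3_eq_cube)
    also have "\<dots> \<le> 2 * h ^ 3 * (1 + a\<^sup>2)\<^sup>2"
    proof -
      have "1 + a\<^sup>2 \<le> (1 + a\<^sup>2)\<^sup>2" by (rule self_le_power) auto
      then show ?thesis using a1 h by (intro mult_left_mono) auto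
    qed
    finally have "\<bar>p - q\<bar> \<le> 2 * h ^ 3 * (1 + a\<^sup>2)\<^sup>2" by simp
    moreover have "0 \<le> h ^ 3 * (1 + a\<^sup>2)\<^sup>2" using h by simp
    ultimately show ?thesis by simp
  next
    case False
    have "\<bar>p - q\<bar> \<le> 4"
    proof -
      have "s\<^sup>2 \<le> 1" "h\<^sup>2 \<le> 1" using s1 h by (simp_all add: abs_square_le_1 power_le_one)
      then have "K \<le> 2" unfolding K by linarith
      then have "p\<^sup>2 \<le> 4\<^sup>2" "q\<^sup>2 \<le> 4\<^sup>2" using p2 q2 yz by (simp_all add: abs_le_iff)
      then have "p \<le> 4" "q \<le> 4" using power2_le_imp_le[of p 4] power2_le_imp_le[of q 4] by simp_all
      then show ?thesis using pq by simp
    qed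
    also have "4 \<le> 32 * \<bar>s\<bar> ^ 3"
    proof -
      have "(1/2) ^ 3 \<le> \<bar>s\<bar> ^ 3" using False by (intro power_mono) auto
      then show ?thesis by (simp add: power3_eq_cube)
    qed
    also have "\<dots> = 32 * h ^ 3 * (\<bar>a\<bar> * a\<^sup>2)"
      using h by (simp add: s_def abs_mult power_mult_distrib power3_eq_cube power2_eq_square)
    also have "\<dots> \<le> 32 * h ^ 3 * ((1 + a\<^sup>2) * (1 + a\<^sup>2))"
      using a1 h by (intro mult_left_mono mult_mono) auto
    finally show ?thesis by (simp add: power2_eq_square)
  qed
qed

text \<open>The local error splits into the error of the second difference and three terms that carry the deviations
  of the coefficients.\<close>

lemma consistency_identity:
  fixes u up um g :: complex and p q h a :: real
  assumes "h \<noteq> 0"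
  shows "- g + a\<^sup>2 *\<^sub>R u - (- (1 / h\<^sup>2 * p) *\<^sub>R up - (1 / h\<^sup>2 * q) *\<^sub>R um + (1 + 2 / h\<^sup>2) *\<^sub>R u)
    = (1 / h\<^sup>2) *\<^sub>R (up + um - 2 * u - of_real (h\<^sup>2) * g) + (1 / h\<^sup>2 * ((p + q) / 2 - 1)) *\<^sub>R (up + um - 2 * u)
      + (1 / h\<^sup>2 * ((p - q) / 2)) *\<^sub>R (up - um) + ((p + q - 2) / h\<^sup>2 + a\<^sup>2 - 1) *\<^sub>R u"
proof -
  define c where "c = 1 / h\<^sup>2"
  define P where "P = (p + q) / 2"
  define M where "M = (p - q) / 2"
  have e: "1 / h\<^sup>2 = c" "2 / h\<^sup>2 = 2 * c" "(p + q - 2) / h\<^sup>2 = c * (2 * P - 2)"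
    by (simp_all add: c_def P_def)
  have pq: "p = P + M" "q = P - M" by (auto simp: P_def M_def field_simps)
  have c: "c * (h\<^sup>2 * z) = z" "h\<^sup>2 * (c * z) = z" "c * (z * h\<^sup>2) = z" for z using assms by (auto simp: c_def)
  show ?thesis
    unfolding e P_def[symmetric] M_def[symmetric] unfolding pq by (simp add: complex_eq_iff algebra_simps c)
qed

lemma consistency_pointwise:
  fixes G :: "nat \<Rightarrow> real \<Rightarrow> complex" and a h :: real
  assumes G: "\<And>k. k \<le> 4 \<Longrightarrow> continuous_on UNIV (G k)" "\<And>k x. k < 4 \<Longrightarrow> (G k has_vector_derivative G (Suc k) x) (at x)"
    and h: "0 < h" "h \<le> 1"
  defines "I \<equiv> \<lambda>k. integral {a - h..a + h} (\<lambda>t. cmod (G k t))"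
  defines "p \<equiv> sqrt ((1 + a * h + h\<^sup>2) * (1 - a * h))"
  defines "q \<equiv> sqrt ((1 - a * h + h\<^sup>2) * (1 + a * h))"
  defines "B \<equiv> 20 * h * ((1 + a\<^sup>2)\<^sup>2 * I 0 + (1 + a\<^sup>2)\<^sup>2 * I 1 + (1 + a\<^sup>2) * I 2 + (1 + a\<^sup>2) * I 3 + I 4)"
  shows "\<bar>a * h\<bar> \<le> 1 \<Longrightarrow> cmod (- G 2 a + a\<^sup>2 *\<^sub>R G 0 a
      - (- (1 / h\<^sup>2 * p) *\<^sub>R G 0 (a + h) - (1 / h\<^sup>2 * q) *\<^sub>R G 0 (a - h) + (1 + 2 / h\<^sup>2) *\<^sub>R G 0 a)) \<le> B"
    and "1 < \<bar>a * h\<bar> \<Longrightarrow> cmod (- G 2 a + a\<^sup>2 *\<^sub>R G 0 a) \<le> B"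
proof -
  define J where "J = 1 + a\<^sup>2"
  have J: "1 \<le> J" "J \<le> J\<^sup>2" "a\<^sup>2 \<le> J" by (auto simp: J_def intro: self_le_power)
  have In: "0 \<le> I k" if "k \<le> 4" for k unfolding I_def
    by (intro Henstock_Kurzweil_Integration.integral_nonneg integrable_continuous_real continuous_intros
        continuous_on_subset[OF G(1)[OF that]]) auto
  have G': "(G 0 has_vector_derivative G 1 x) (at x)" "(G 1 has_vector_derivative G 2 x) (at x)"
    "(G 2 has_vector_derivative G 3 x) (at x)" for x
    using G(2)[of 0 x] G(2)[of 1 x] G(2)[of 2 x] by (simp_all add: eval_nat_numeral)
  have pv0: "cmod (G 0 a) \<le> 1 / h * (I 0 + I 1)"
    unfolding I_def by (rule point_value_le_integral[OF G'(1) G(1) h]) simp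
  have pv2: "cmod (G 2 a) \<le> 1 / h * (I 2 + I 3)"
    unfolding I_def by (rule point_value_le_integral[OF G'(3) G(1) h]) simp
  have h2: "h\<^sup>2 > 0" using h by simp
  show "cmod (- G 2 a + a\<^sup>2 *\<^sub>R G 0 a) \<le> B" if "1 < \<bar>a * h\<bar>"
  proof -
    have "1\<^sup>2 \<le> \<bar>a * h\<bar>\<^sup>2" using that by (intro power_mono) auto
    then have "1 \<le> h\<^sup>2 * a\<^sup>2" by (simp add: power_mult_distrib mult.commute)
    also have "\<dots> \<le> h\<^sup>2 * J" using J by (intro mult_left_mono) auto
    finally have "1 / h * 1 \<le> 1 / h * (h\<^sup>2 * J)" using h by (intro mult_left_mono) auto
    then have inv: "1 / h \<le> h * J" using h by (simp add: power2_eq_square)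
    have "cmod (- G 2 a + a\<^sup>2 *\<^sub>R G 0 a) \<le> cmod (G 2 a) + a\<^sup>2 * cmod (G 0 a)"
      using norm_triangle_ineq[of "- G 2 a" "a\<^sup>2 *\<^sub>R G 0 a"] by simp
    also have "\<dots> \<le> h * J * (I 2 + I 3) + J * (h * J * (I 0 + I 1))"
    proof (intro add_mono mult_mono)
      show "cmod (G 2 a) \<le> h * J * (I 2 + I 3)"
        using pv2 mult_right_mono[OF inv, of "I 2 + I 3"] In by simp
      show "cmod (G 0 a) \<le> h * J * (I 0 + I 1)"
        using pv0 mult_right_mono[OF inv, of "I 0 + I 1"] In by simp
    qed (use J in auto)
    also have "\<dots> = 1 * (h * (J\<^sup>2 * I 0 + J\<^sup>2 * I 1 + J * I 2 + J * I 3))"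
      by (simp add: power2_eq_square algebra_simps)
    also have "\<dots> \<le> 20 * (h * (J\<^sup>2 * I 0 + J\<^sup>2 * I 1 + J * I 2 + J * I 3 + I 4))"
      using h J In by (intro mult_mono mult_left_mono) (auto intro!: mult_nonneg_nonneg add_nonneg_nonneg)
    finally show ?thesis by (simp add: B_def J_def)
  qed
  show "cmod (- G 2 a + a\<^sup>2 *\<^sub>R G 0 a
      - (- (1 / h\<^sup>2 * p) *\<^sub>R G 0 (a + h) - (1 / h\<^sup>2 * q) *\<^sub>R G 0 (a - h) + (1 + 2 / h\<^sup>2) *\<^sub>R G 0 a)) \<le> B"
        if ah: "\<bar>a * h\<bar> \<le> 1"
  proof -
    note hc = hopping_coefficient_bounds[OF h ah, folded p_def q_def J_def]
    define D2 where "D2 = G 0 (a + h) + G 0 (a - h) - 2 * G 0 a"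
    define D1 where "D1 = G 0 (a + h) - G 0 (a - h)"
    have d2: "cmod D2 \<le> h * I 2" "cmod (D2 - of_real (h\<^sup>2) * G 2 a) \<le> h ^ 3 * I 4"
      using second_difference_bounds[where G = G and a = a, OF G h(1)] by (auto simp: D2_def I_def)
    have d1: "cmod D1 \<le> I 1" unfolding D1_def I_def
      using h by (intro increment_le_integral[OF G'(1) G(1)]) auto
    have e1: "cmod ((1 / h\<^sup>2) *\<^sub>R (D2 - of_real (h\<^sup>2) * G 2 a)) \<le> h * I 4"
    proof -
      have "1 / h\<^sup>2 * cmod (D2 - of_real (h\<^sup>2) * G 2 a) \<le> 1 / h\<^sup>2 * (h ^ 3 * I 4)"
        using d2 by (intro mult_left_mono) auto
      then show ?thesis using h by (simp add: power2_eq_square power3_eq_cube)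
    qed
    have e2: "cmod ((1 / h\<^sup>2 * ((p + q) / 2 - 1)) *\<^sub>R D2) \<le> h * (2 * J * I 2)"
    proof -
      have "1 / h\<^sup>2 * \<bar>(p + q) / 2 - 1\<bar> * cmod D2 \<le> 1 / h\<^sup>2 * (2 * h\<^sup>2 * J) * (h * I 2)"
        using hc(1) d2(1) J h by (intro mult_mono) auto
      also have "\<dots> = h * (2 * J * I 2)" using h by simp
      finally show ?thesis by (simp add: abs_mult)
    qed
    have e3: "cmod ((1 / h\<^sup>2 * ((p - q) / 2)) *\<^sub>R D1) \<le> h * (16 * J\<^sup>2 * I 1)"
    proof -
      have "1 / h\<^sup>2 * \<bar>(p - q) / 2\<bar> * cmod D1 \<le> 1 / h\<^sup>2 * (16 * h ^ 3 * J\<^sup>2) * I 1"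
        using hc(2) d1 J h by (intro mult_mono) auto
      also have "\<dots> = h * (16 * J\<^sup>2 * I 1)" using h by (simp add: power2_eq_square power3_eq_cube)
      finally show ?thesis by (simp add: abs_mult)
    qed
    have e4: "cmod (((p + q - 2) / h\<^sup>2 + a\<^sup>2 - 1) *\<^sub>R G 0 a) \<le> h * (4 * J\<^sup>2 * (I 0 + I 1))"
    proof -
      have "\<bar>(p + q - 2) / h\<^sup>2 + a\<^sup>2 - 1\<bar> * cmod (G 0 a) \<le> (4 * h\<^sup>2 * J\<^sup>2) * (1 / h * (I 0 + I 1))"
        using hc(3) pv0 by (intro mult_mono) auto
      also have "\<dots> = h * (4 * J\<^sup>2 * (I 0 + I 1))" using h by (simp add: power2_eq_square)
      finally show ?thesis by simp
    qed
    have "cmod (- G 2 a + a\<^sup>2 *\<^sub>R G 0 a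
      - (- (1 / h\<^sup>2 * p) *\<^sub>R G 0 (a + h) - (1 / h\<^sup>2 * q) *\<^sub>R G 0 (a - h) + (1 + 2 / h\<^sup>2) *\<^sub>R G 0 a))
      = cmod ((1 / h\<^sup>2) *\<^sub>R (D2 - of_real (h\<^sup>2) * G 2 a) + (1 / h\<^sup>2 * ((p + q) / 2 - 1)) *\<^sub>R D2
        + (1 / h\<^sup>2 * ((p - q) / 2)) *\<^sub>R D1 + ((p + q - 2) / h\<^sup>2 + a\<^sup>2 - 1) *\<^sub>R G 0 a)"
      using consistency_identity[of h "G 2 a" a "G 0 a" p "G 0 (a + h)" q "G 0 (a - h)"] h
      unfolding D1_def D2_def by simp
    also have "\<dots> \<le> h * I 4 + h * (2 * J * I 2) + h * (16 * J\<^sup>2 * I 1) + h * (4 * J\<^sup>2 * (I 0 + I 1))"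
      by (intro norm_triangle_le add_mono e1 e2 e3 e4)
    also have "\<dots> = h * (4 * (J\<^sup>2 * I 0) + 20 * (J\<^sup>2 * I 1) + 2 * (J * I 2) + I 4)" by (simp add: algebra_simps)
    also have "\<dots> \<le> h * (20 * (J\<^sup>2 * I 0) + 20 * (J\<^sup>2 * I 1) + 20 * (J * I 2) + 20 * (J * I 3) + 20 * I 4)"
    proof -
      have "0 \<le> J\<^sup>2 * I 0" "0 \<le> J * I 2" "0 \<le> J * I 3" "0 \<le> I 4" using J In by auto
      then have "4 * (J\<^sup>2 * I 0) + 20 * (J\<^sup>2 * I 1) + 2 * (J * I 2) + I 4
          \<le> 20 * (J\<^sup>2 * I 0) + 20 * (J\<^sup>2 * I 1) + 20 * (J * I 2) + 20 * (J * I 3) + 20 * I 4" by linarith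
      then show ?thesis using h by (intro mult_left_mono) auto
    qed
    finally show ?thesis by (simp add: B_def J_def algebra_simps)
  qed
qed

section \<open>Consistency in the discrete norm\<close>

lemma sum_adjacent_integrals:
  fixes f :: "real \<Rightarrow> real"
  assumes "continuous_on UNIV f" "0 < h"
  shows "(\<Sum>i<N. integral {c + h * real i..c + h * real (Suc i)} f) = integral {c..c + h * real N} f"
proof (induction N)
  case (Suc N)
  have "integral {c..c + h * real N} f + integral {c + h * real N..c + h * real (Suc N)} f = integral {c..c
    + h * real (Suc N)} f"
    using assms by (intro Henstock_Kurzweil_Integration.integral_combine integrable_continuous_real)
      (auto intro: continuous_on_subset mult_left_mono)
  then show ?case using Suc by simp
qed simp

text \<open>Each cell of the grid lies in at most two of the intervals.\<close>

lemma sum_grid_integrals: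
  fixes f :: "real \<Rightarrow> real" and J :: "int set"
  assumes f: "continuous_on UNIV f" "\<And>x. 0 \<le> f x" and h: "0 < h" and J: "J \<subseteq> {- int n<..<int n}"
  shows "(\<Sum>j\<in>J. integral {h * of_int j - h..h * of_int j + h} f) \<le> 2 * integral {- (h * real n)..h * real n} f"
proof -
  have fi: "f integrable_on {a..b}" for a b
    by (intro integrable_continuous_real continuous_on_subset[OF f(1)]) auto
  have fJ: "finite J" using J finite_subset by blast
  have half: "(\<Sum>j\<in>J. integral {h * of_int (j + d)..h * of_int (j + d) + h} f) \<le> integral {- (h * real n)..h * real n} f"
    if d: "d = 0 \<or> d = - 1" for d :: int
  proof -
    \<comment> \<open>Shift the indices to natural numbers; \<open>d = 0\<close> gives the right halves of the intervals and \<open>d =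
      - 1\<close> the left halves.\<close>
    define \<phi> where "\<phi> = (\<lambda>j. nat (j + d + int n))"
    have "0 \<le> j + d + int n" if "j \<in> J" for j using J d that by auto
    then have inj: "inj_on \<phi> J" by (auto simp: inj_on_def \<phi>_def eq_nat_nat_iff)
    have "j + d + int n < 2 * int n" if "j \<in> J" for j using J d that by auto
    then have sub: "\<phi> ` J \<subseteq> {..<2 * n}" using J by (force simp: \<phi>_def)
    have eq: "h * of_int (j + d) = - (h * real n) + h * real (\<phi> j)" if "j \<in> J" for j
    proof -
      have "real (\<phi> j) = of_int (j + d) + real n" using that J d by (auto simp: \<phi>_def)
      then show ?thesis by (simp add: algebra_simps)
    qed
    have "(\<Sum>j\<in>J. integral {h * of_int (j + d)..h * of_int (j + d) + h} f)
        = (\<Sum>j\<in>J. integral {- (h * real n) + h * real (\<phi> j)..- (h * real n) + h * real (Suc (\<phi> j))} f)"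
      by (rule sum.cong[OF refl]) (simp only: eq of_nat_Suc, simp add: algebra_simps)
    also have "\<dots> = (\<Sum>i\<in>\<phi> ` J. integral {- (h * real n) + h * real i..- (h * real n) + h * real (Suc i)} f)"
      by (simp add: sum.reindex[OF inj])
    also have "\<dots> \<le> (\<Sum>i<2 * n. integral {- (h * real n) + h * real i..- (h * real n) + h * real (Suc i)} f)"
      by (rule sum_mono2[OF _ sub]) (auto intro!: Henstock_Kurzweil_Integration.integral_nonneg fi f(2))
    also have "\<dots> = integral {- (h * real n)..h * real n} f"
      unfolding sum_adjacent_integrals[OF f(1) h] by (simp add: algebra_simps)
    finally show ?thesis .
  qed
  have "(\<Sum>j\<in>J. integral {h * of_int j - h..h * of_int j + h} f)
      = (\<Sum>j\<in>J. integral {h * of_int (j + - 1)..h * of_int (j + - 1) + h} f + integral {h * of_int (j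
        + 0)..h * of_int (j + 0) + h} f)"
  proof (rule sum.cong[OF refl])
    fix j
    have "integral {h * of_int j - h..h * of_int j} f + integral {h * of_int j..h * of_int j + h} f
      = integral {h * of_int j - h..h * of_int j + h} f"
      using h by (intro Henstock_Kurzweil_Integration.integral_combine fi) auto
    then show "integral {h * of_int j - h..h * of_int j + h} f = integral {h * of_int (j + - 1)..h * of_int (j +
      - 1) + h} f + integral {h * of_int (j + 0)..h * of_int (j + 0) + h} f"
      by (simp add: algebra_simps)
  qed
  also have "\<dots> \<le> integral {- (h * real n)..h * real n} f + integral {- (h * real n)..h * real n} f"
    unfolding sum.distrib by (intro add_mono half) auto
  finally show ?thesis by simp
qed

lemma disc_osc_consistency:
  "\<exists>C::real. \<forall>N. 0 < N \<and> even N \<longrightarrow>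
            (\<forall>g\<in>Sigma_space 5.
               (\<lambda>a. grid_proj (step N) (harm_osc g) a
                     - disc_osc (step N) (grid_proj (step N) g) a) \<in> ell2 (step N)
             \<and> ell2_norm (step N)
                 (\<lambda>a. grid_proj (step N) (harm_osc g) a
                       - disc_osc (step N) (grid_proj (step N) g) a)
               \<le> C * (step N)\<^sup>2 * Sigma_norm 5 g)"
proof -
  define c where "c = (32 * 10 ^ 11 :: real)"
  show ?thesis
  proof (intro exI[of _ "1800 * c"] allI impI ballI)
    fix N :: nat and g assume N: "0 < N \<and> even N" and g: "g \<in> Sigma_space 5"
    define h where "h = step N"
    obtain m where m: "N = 2 * m" "0 < m" using N by auto
    have hm: "h = 1 / sqrt (real m)" using m step_even by (simp add: h_def)
    have h: "0 < h" "h \<le> 1" using m by (auto simp: hm)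
    define S where "S = Sigma_norm 5 g"
    have S: "0 \<le> S" using Sigma_norm_bounds(1)[OF g] by (simp add: S_def)
    have gS: "g \<in> Sobolev (Suc 4)" using g by (simp add: Sigma_space_def)
    obtain G where G: "\<And>k. k \<le> 4 \<Longrightarrow> continuous_on UNIV (G k)"
      "\<And>k. k \<le> 4 \<Longrightarrow> AE x in lebesgue. weak_deriv k g x = G k x"
      "AE x in lebesgue. g x = G 0 x"
      "\<And>k x. k < 4 \<Longrightarrow> (G k has_vector_derivative G (Suc k) x) (at x)"
      "\<And>a b. a \<le> b \<Longrightarrow> G 4 b - G 4 a = integral {a..b} (weak_deriv (Suc 4) g)"
      using Sobolev_smooth_representatives[OF gS] by blast
    have G5: "\<And>a b. a \<le> b \<Longrightarrow> G 4 b - G 4 a = integral {a..b} (weak_deriv 5 g)" using G(5) by (simp add: eval_nat_numeral)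
    have cG: "continuous_on A (G k)" if "k \<le> 4" for k A using G(1)[OF that] continuous_on_subset by blast
    have rep0: "cont_rep g = G 0" by (rule cont_rep_eq) (use G(1)[of 0] G(3) in auto)
    have repH: "cont_rep (harm_osc g) = (\<lambda>x. - G 2 x + x\<^sup>2 *\<^sub>R G 0 x)"
    proof (rule cont_rep_eq)
      show "continuous_on UNIV (\<lambda>x. - G 2 x + x\<^sup>2 *\<^sub>R G 0 x)" by (intro continuous_intros cG) auto
      show "AE x in lebesgue. harm_osc g x = - G 2 x + x\<^sup>2 *\<^sub>R G 0 x"
        using G(2)[of 2] G(3) by (auto simp: harm_osc_def elim: eventually_elim2)
    qed
    define E where "E = (\<lambda>a. grid_proj h (harm_osc g) a - disc_osc h (grid_proj h g) a)"
    define \<Phi> where "\<Phi> = (\<lambda>x. jap x ^ 4 * cmod (G 0 x) + jap x ^ 4 * cmod (G 1 x) + jap x ^ 2 * cmod (G 2 x)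
        + jap x ^ 2 * cmod (G 3 x) + cmod (G 4 x))"
    have c\<Phi>: "continuous_on A \<Phi>" for A unfolding \<Phi>_def by (intro continuous_intros cG) auto
    have Eb: "cmod (E (h * of_int j)) \<le> 180 * h * integral {h * of_int j - h..h * of_int j + h} \<Phi>" for j :: int
    proof -
      define a where "a = h * of_int j"
      define I where "I = (\<lambda>k. integral {a - h..a + h} (\<lambda>t. cmod (G k t)))"
      define J where "J = 1 + a\<^sup>2"
      have ag: "a \<in> grid h" "a + h \<in> grid h" "a - h \<in> grid h"
      proof -
        show "a \<in> grid h" by (auto simp: a_def grid_def)
        have "a + h = h * of_int (j + 1)" "a - h = h * of_int (j - 1)" by (auto simp: a_def algebra_simps)
        then show "a + h \<in> grid h" "a - h \<in> grid h" unfolding grid_def by blast+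
      qed
      have gp: "grid_proj h g x = G 0 x" if "x \<in> grid h" for x using that by (simp add: grid_proj_def rep0)
      have gH: "grid_proj h (harm_osc g) a = - G 2 a + a\<^sup>2 *\<^sub>R G 0 a" using ag by (simp add: grid_proj_def repH)
      have supp: "a \<in> grid_support h \<longleftrightarrow> \<bar>a * h\<bar> \<le> 1"
        using ag h by (auto simp: grid_support_def abs_le_iff field_simps)
      have "cmod (E a) \<le> 20 * h * (J\<^sup>2 * I 0 + J\<^sup>2 * I 1 + J * I 2 + J * I 3 + I 4)"
      proof (cases "\<bar>a * h\<bar> \<le> 1")
        case True
        then show ?thesis using consistency_pointwise(1)[where G = G, OF G(1) G(4) h True] supp
          unfolding E_def disc_osc_def gH gp[OF ag(1)] gp[OF ag(2)] gp[OF ag(3)] I_def J_def by simp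
      next
        case False
        then have "1 < \<bar>a * h\<bar>" by simp
        from consistency_pointwise(2)[where G = G, OF G(1) G(4) h this] show ?thesis using supp False
          unfolding E_def disc_osc_def gH I_def J_def by simp
      qed
      also have "J\<^sup>2 * I 0 + J\<^sup>2 * I 1 + J * I 2 + J * I 3 + I 4 = integral {a - h..a
        + h} (\<lambda>t. J\<^sup>2 * cmod (G 0 t) + J\<^sup>2 * cmod (G 1 t)
          + J * cmod (G 2 t) + J * cmod (G 3 t) + cmod (G 4 t))"
        unfolding I_def
        by (rule integral_unique[symmetric])
           (intro has_integral_add has_integral_mult_right integrable_integral integrable_continuous_real
             continuous_intros cG; simp)
      also have "\<dots> \<le> integral {a - h..a + h} (\<lambda>t. 9 * \<Phi> t)"
      proof (rule integral_le)
        fix t assume t: "t \<in> {a - h..a + h}"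
        have "J \<le> 3 * (jap t)\<^sup>2"
        proof -
          have "\<bar>a - t\<bar> \<le> 1" using t h by (auto simp: abs_le_iff)
          then have "(a - t)\<^sup>2 \<le> 1" by (simp add: abs_square_le_1)
          moreover have "a\<^sup>2 \<le> 2 * t\<^sup>2 + 2 * (a - t)\<^sup>2"
          proof -
            have "0 \<le> (a - 2 * t)\<^sup>2" by simp
            then show ?thesis by (simp add: power2_eq_square algebra_simps)
          qed
          moreover have "1 + x \<le> 3 * (1 + y)" if "d \<le> 1" "x \<le> 2 * y + 2 * d" "0 \<le> y" for d x y :: real
            using that by simp
          ultimately show ?thesis unfolding J_def jap_pos(3) by (metis zero_le_power2)
        qed
        then have J3: "J \<le> 9 * jap t ^ 2" using zero_le_power2[of "jap t"] by linarith
        have "J\<^sup>2 \<le> (3 * (jap t)\<^sup>2)\<^sup>2" using \<open>J \<le> 3 * (jap t)\<^sup>2\<close> by (rule power_mono) (simp add: J_def)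
        then have J4: "J\<^sup>2 \<le> 9 * jap t ^ 4" by (simp add: power_mult_distrib flip: power_mult)
        have "J\<^sup>2 * cmod (G 0 t) + J\<^sup>2 * cmod (G 1 t) + J * cmod (G 2 t) + J * cmod (G 3 t) + 1 * cmod (G 4 t)
            \<le> 9 * jap t ^ 4 * cmod (G 0 t) + 9 * jap t ^ 4 * cmod (G 1 t) + 9 * jap t ^ 2 * cmod (G 2 t)
              + 9 * jap t ^ 2 * cmod (G 3 t) + 9 * cmod (G 4 t)"
          using J3 J4 by (intro add_mono mult_right_mono) auto
        then show "J\<^sup>2 * cmod (G 0 t) + J\<^sup>2 * cmod (G 1 t) + J * cmod (G 2 t) + J * cmod (G 3 t) + cmod (G 4 t)
          \<le> 9 * \<Phi> t"
          by (simp add: \<Phi>_def algebra_simps)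
      qed (intro integrable_continuous_real continuous_intros cG c\<Phi>; simp)+
      also have "\<dots> = 9 * integral {a - h..a + h} \<Phi>" by simp
      finally show ?thesis using h by (simp add: a_def mult_left_mono)
    qed
    have "E \<in> ell2 h \<and> ell2_norm h E \<le> 1800 * c * h\<^sup>2 * S"
    proof (rule ell2I[OF h(1)])
      show "0 \<le> 1800 * c * h\<^sup>2 * S" using S by (simp add: c_def)
      fix F assume F: "finite F" "F \<subseteq> grid h"
      have inj: "inj_on (\<lambda>j::int. h * of_int j) A" for A using h by (auto simp: inj_on_def)
      obtain J where J: "F = (\<lambda>j::int. h * of_int j) ` J" "finite J"
        using F inj unfolding grid_def by (metis finite_imageD subset_imageE)
      obtain n where n: "J \<subseteq> {- int n<..<int n}"
      proof -
        obtain b where b: "\<forall>j\<in>J. \<bar>j\<bar> \<le> b" using J(2)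
          by (metis finite_imageI finite_nat_iff_bounded_le Max_ge image_eqI)
        have "J \<subseteq> {- int (nat b + 1)<..<int (nat b + 1)}" using b by force
        then show ?thesis by (rule that)
      qed
      define R where "R = h * real n"
      have iPhi: "integral {-R..R} (\<lambda>x. (\<Phi> x)\<^sup>2) \<le> 25 * (c * S)\<^sup>2"
      proof -
        define T where "T = (\<lambda>k x. jap x ^ (2 * (5 - k)) * (cmod (G k x))\<^sup>2)"
        have Ti: "T k integrable_on {-R..R}" if "k \<le> 4" for k
          unfolding T_def by (intro integrable_continuous_real continuous_intros cG that)
        have Tb: "integral {-R..R} (T k) \<le> (c * S)\<^sup>2" if "k \<le> 4" for k
          unfolding T_def c_def S_def using Sigma_weighted_bounds[OF g G(1,2,3,4) G5 that] by simp
        have "integral {-R..R} (\<lambda>x. (\<Phi> x)\<^sup>2) \<le> integral {-R..R} (\<lambda>x. 5 * (T 0 x + T 1 x + T 2 x + T 3 x + T 4 x))"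
        proof (rule integral_le)
          show "(\<lambda>x. (\<Phi> x)\<^sup>2) integrable_on {-R..R}" by (intro integrable_continuous_real continuous_intros c\<Phi>)
          show "(\<lambda>x. 5 * (T 0 x + T 1 x + T 2 x + T 3 x + T 4 x)) integrable_on {-R..R}"
            by (intro integrable_on_mult_right integrable_add Ti) auto
          fix x
          have sq5: "(v + w + x + y + z)\<^sup>2 \<le> 5 * (v\<^sup>2 + w\<^sup>2 + x\<^sup>2 + y\<^sup>2 + z\<^sup>2)" for v w x y z :: real
          proof -
            have "0 \<le> (v - w)\<^sup>2 + (v - x)\<^sup>2 + (v - y)\<^sup>2 + (v - z)\<^sup>2 + (w - x)\<^sup>2 + (w - y)\<^sup>2 + (w - z)\<^sup>2
              + (x - y)\<^sup>2 + (x - z)\<^sup>2 + (y - z)\<^sup>2" by (intro add_nonneg_nonneg zero_le_power2)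
            then show ?thesis by (simp add: power2_eq_square algebra_simps)
          qed
          have tk: "(jap x ^ i * cmod (G k x))\<^sup>2 \<le> T k x" if "i \<le> 5 - k" for i k
          proof -
            have "(jap x ^ i * cmod (G k x))\<^sup>2 = jap x ^ (2 * i) * (cmod (G k x))\<^sup>2"
              by (simp add: power_mult_distrib mult.commute flip: power_mult)
            also have "\<dots> \<le> T k x" unfolding T_def
              using that jap_pos(1)[of x] by (intro mult_right_mono power_increasing) auto
            finally show ?thesis .
          qed
          have "(\<Phi> x)\<^sup>2 \<le> 5 * ((jap x ^ 4 * cmod (G 0 x))\<^sup>2 + (jap x ^ 4 * cmod (G 1 x))\<^sup>2
            + (jap x ^ 2 * cmod (G 2 x))\<^sup>2
              + (jap x ^ 2 * cmod (G 3 x))\<^sup>2 + (cmod (G 4 x))\<^sup>2)" unfolding \<Phi>_def by (rule sq5)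
          also have "\<dots> \<le> 5 * (T 0 x + T 1 x + T 2 x + T 3 x + T 4 x)"
            using tk[of 0 4] tk[of 4 0] tk[of 4 1] tk[of 2 2] tk[of 2 3] by (intro mult_left_mono add_mono) auto
          finally show "(\<Phi> x)\<^sup>2 \<le> 5 * (T 0 x + T 1 x + T 2 x + T 3 x + T 4 x)" .
        qed
        also have "\<dots> = 5 * (integral {-R..R} (T 0) + integral {-R..R} (T 1) + integral {-R..R} (T 2)
          + integral {-R..R} (T 3) + integral {-R..R} (T 4))"
          by (rule integral_unique) (intro has_integral_mult_right has_integral_add integrable_integral Ti; simp)
        also have "\<dots> \<le> 5 * ((c * S)\<^sup>2 + (c * S)\<^sup>2 + (c * S)\<^sup>2 + (c * S)\<^sup>2 + (c * S)\<^sup>2)"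
          by (intro mult_left_mono add_mono Tb) auto
        finally show ?thesis by simp
      qed
      have Eb2: "(cmod (E (h * of_int j)))\<^sup>2 \<le> (180 * h)\<^sup>2 * (2 * h * integral {h * of_int j - h..h * of_int j
        + h} (\<lambda>x. (\<Phi> x)\<^sup>2))" for j :: int
      proof -
        have "(cmod (E (h * of_int j)))\<^sup>2 \<le> (180 * h * integral {h * of_int j - h..h * of_int j + h} \<Phi>)\<^sup>2"
          using Eb by (intro power_mono) auto
        also have "\<dots> = (180 * h)\<^sup>2 * (integral {h * of_int j - h..h * of_int j + h} (\<lambda>x. 1 * \<Phi> x))\<^sup>2"
          by (simp add: power_mult_distrib)
        also have "\<dots> \<le> (180 * h)\<^sup>2 * (integral {h * of_int j - h..h * of_int j
          + h} (\<lambda>x. 1\<^sup>2) * integral {h * of_int j - h..h * of_int j + h} (\<lambda>x. (\<Phi> x)\<^sup>2))"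
          by (intro mult_left_mono integral_Cauchy_Schwarz integrable_continuous_real continuous_intros c\<Phi>) auto
        finally show ?thesis using h by simp
      qed
      have "h * (\<Sum>a\<in>F. (cmod (E a))\<^sup>2) = h * (\<Sum>j\<in>J. (cmod (E (h * of_int j)))\<^sup>2)"
        unfolding J(1) by (simp add: sum.reindex[OF inj])
      also have "\<dots> \<le> h * (\<Sum>j\<in>J. (180 * h)\<^sup>2 * (2 * h * integral {h * of_int j - h..h * of_int j + h} (\<lambda>x. (\<Phi> x)\<^sup>2)))"
        using h Eb2 by (intro mult_left_mono sum_mono) auto
      also have "\<dots> = 2 * 180\<^sup>2 * h ^ 4 * (\<Sum>j\<in>J. integral {h * of_int j - h..h * of_int j + h} (\<lambda>x. (\<Phi> x)\<^sup>2))"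
        by (simp add: sum_distrib_left power2_eq_square power4_eq_xxxx mult_ac)
      also have "\<dots> \<le> 2 * 180\<^sup>2 * h ^ 4 * (2 * (25 * (c * S)\<^sup>2))"
      proof (rule mult_left_mono)
        have "(\<Sum>j\<in>J. integral {h * of_int j - h..h * of_int j + h} (\<lambda>x. (\<Phi> x)\<^sup>2)) \<le> 2 * integral {-R..R} (\<lambda>x. (\<Phi> x)\<^sup>2)"
          unfolding R_def by (rule sum_grid_integrals[OF _ _ h(1) n]) (auto intro!: continuous_intros c\<Phi>)
        then show "(\<Sum>j\<in>J. integral {h * of_int j - h..h * of_int j + h} (\<lambda>x. (\<Phi> x)\<^sup>2)) \<le> 2 * (25 * (c * S)\<^sup>2)"
          using iPhi by linarith
      qed (use h in auto)
      also have "\<dots> = (1800 * c * h\<^sup>2 * S)\<^sup>2"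
        by (simp add: power_mult_distrib power2_eq_square power4_eq_xxxx mult_ac)
      finally show "h * (\<Sum>a\<in>F. (cmod (E a))\<^sup>2) \<le> (1800 * c * h\<^sup>2 * S)\<^sup>2" .
    qed
    then show "(\<lambda>a. grid_proj (step N) (harm_osc g) a - disc_osc (step N) (grid_proj (step N) g) a) \<in> ell2 (step N)
             \<and> ell2_norm (step N) (\<lambda>a. grid_proj (step N) (harm_osc g) a - disc_osc (step N) (grid_proj (step N) g) a)
               \<le> 1800 * c * (step N)\<^sup>2 * Sigma_norm 5 g"
      unfolding E_def h_def S_def .
  qed
qed

theorem theorem2:
  shows "(\<exists>(C::real) (N0::nat). \<forall>N\<ge>N0. 0 < N \<and> even N \<longrightarrow>
            (\<forall>g\<in>Sigma_space 5.
               (\<lambda>a. grid_proj (step N) (harm_osc g) a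
                     - disc_osc (step N) (grid_proj (step N) g) a) \<in> ell2 (step N)
             \<and> ell2_norm (step N)
                 (\<lambda>a. grid_proj (step N) (harm_osc g) a
                       - disc_osc (step N) (grid_proj (step N) g) a)
               \<le> C * (step N)\<^sup>2 * Sigma_norm 5 g))
       \<and> (\<forall>(\<delta>::real) (\<sigma>::real). 0 < \<delta> \<and> \<delta> < 1 \<and> 0 \<le> \<sigma> \<longrightarrow>
           (\<exists>(C::real) (N0::nat). \<forall>N\<ge>N0. 0 < N \<and> even N \<longrightarrow>
              (\<lambda>a. complex_of_real
                     (jap a powr \<sigma> * (rho N a - 1 / sqrt pi * exp (- a\<^sup>2)))) \<in> ell2 (step N)
            \<and> ell2_norm (step N)
                 (\<lambda>a. complex_of_real
                        (jap a powr \<sigma> * (rho N a - 1 / sqrt pi * exp (- a\<^sup>2))))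
               \<le> C * step N powr (2 - \<delta>)
            \<and> (\<forall>n::nat. real n \<le> 1/3 * \<delta> * \<bar>ln (step N)\<bar> \<longrightarrow>
                 (\<lambda>a. complex_of_real (jap a powr \<sigma>)
                        * (complex_of_real (kravchuk_fun N n a)
                           - grid_proj (step N) (\<lambda>x. complex_of_real (hermite_fun n x)) a))
                   \<in> ell2 (step N)
               \<and> ell2_norm (step N)
                   (\<lambda>a. complex_of_real (jap a powr \<sigma>)
                          * (complex_of_real (kravchuk_fun N n a)
                             - grid_proj (step N) (\<lambda>x. complex_of_real (hermite_fun n x)) a))
                 \<le> C * step N powr (2 - \<delta>))))"
proof -
  have uniform: "\<exists>(C::real) (N0::nat). \<forall>N\<ge>N0. P C N" if "\<exists>C. \<forall>N. P C N" for P
    using that by blast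
  show ?thesis
    by (intro conjI allI impI uniform[OF disc_osc_consistency])
       (elim conjE, rule uniform[OF kravchuk_asymptotics], assumption+)
qed

end
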